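(* Let $K$ be an abelian number field of conductor $n$, and let $\hat{T}_{\mathbb{Q}^{(n)}/K}:\mathbb{Q}^{(n)}\to K$ be the adjusted trace map. Then $\hat{T}_{\mathbb{Q}^{(n)}/K}(\mathcal{O}^{(n)})=\mathcal{O}_K$.
   Context: An abelian number field is a finite abelian extension of $\mathbb{Q}$; its conductor is the smallest positive integer $n$ with $K\subseteq\mathbb{Q}^{(n)}:=\mathbb{Q}(\zeta_n)$, where $\zeta_n$ is a primitive $n$-th root of unity. $\mathcal{O}_K$ is the ring of integers of $K$ and $\mathcal{O}^{(n)}=\mathbb{Z}[\zeta_n]$ that of $\mathbb{Q}^{(n)}$. "Tamely ramified" means "not wildly ramified at any nonzero prime" (unramified is allowed). $T_{L/K}$ is the usual field trace. Definition of the adjusted trace map $\hat{T}_{\mathbb{Q}^{(n)}/K}$: if $\mathbb{Q}^{(n)}/K$ is tamely ramified, $\hat{T}_{\mathbb{Q}^{(n)}/K}=T_{\mathbb{Q}^{(n)}/K}$. Otherwise let $e=v_2(n)$ (in this case $e\geq 3$) and $m=n/2^e$; then $\mathcal{O}^{(n)}=\mathcal{O}^{(2^e)}\otimes_{\mathbb{Z}}\mathcal{O}^{(m)}$ (with $x\otimes y$ identified with the product $xy$) has $\mathbb{Z}$-basis $\{\zeta_{2^e}^{i}\otimes\zeta_m^{j} : 0\le i\le 2^{e-1}-1,\ 0\le j\le\phi(m)-1\}$, with $\phi$ Euler's function. Put $$\hat{T}_{\mathbb{Q}^{(n)}/K}(\zeta_{2^e}^{i}\otimes\zeta_m^{j})=\begin{cases}\frac12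 T_{\mathbb{Q}^{(n)}/K}(\zeta_m^{j}) & i=0,\\ T_{\mathbb{Q}^{(n)}/K}(\zeta_{2^e}^{i}\otimes\zeta_m^{j}) & 1\le i\le 2^{e-1}-1,\end{cases}$$ and extend to a $\mathbb{Q}$-linear map $\mathbb{Q}^{(n)}\to K$. *)

theory Defs
  imports
    "HOL-Algebra.Algebra"
    "HOL-Algebra.Algebraic_Closure_Type"
    "HOL-Number_Theory.Number_Theory"
begin

text \<open>
  Number fields are realised as subfields of the complex numbers, which are turned into a
  record-based ring so that the notions of \<open>HOL-Algebra\<close> apply to subsets of \<^typ>\<open>complex\<close>.
\<close>

abbreviation complex_ring :: "complex ring" where
  "complex_ring \<equiv> ring_of_type_algebra"

definition subfield_ring :: "complex set \<Rightarrow> complex ring" where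
  "subfield_ring K = complex_ring\<lparr>carrier := K\<rparr>"


subsection \<open>Abelian number fields and conductors\<close>

definition galois_automorphisms :: "complex set \<Rightarrow> complex set \<Rightarrow> (complex \<Rightarrow> complex) set" where
  "galois_automorphisms L K =
     {\<sigma> \<in> ring_iso (subfield_ring L) (subfield_ring L). \<forall>x\<in>K. \<sigma> x = x}"

text \<open>
  A finite extension is Galois if the base field is the fixed field of its automorphism group.
  The maps \<open>\<sigma>\<close> are only meaningful on \<open>L\<close>, so commutativity is required pointwise on \<open>L\<close>.
\<close>

definition abelian_extension :: "complex set \<Rightarrow> complex set \<Rightarrow> bool" where
  "abelian_extension L K \<longleftrightarrow>
     subfield K complex_ring \<and> subfield L complex_ring \<and> K \<subseteq> L \<and>
     ring.finite_dimension complex_ring K L \<and>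
     {x \<in> L. \<forall>\<sigma>\<in>galois_automorphisms L K. \<sigma> x = x} = K \<and>
     (\<forall>\<sigma>\<in>galois_automorphisms L K. \<forall>\<tau>\<in>galois_automorphisms L K. \<forall>x\<in>L. \<sigma> (\<tau> x) = \<tau> (\<sigma> x))"

definition abelian_number_field :: "complex set \<Rightarrow> bool" where
  "abelian_number_field K \<longleftrightarrow> abelian_extension K \<rat>"

text \<open>
  A fixed choice of primitive \<open>n\<close>-th roots of unity. Neither the cyclotomic fields nor the adjusted
  trace map depend on it: another choice permutes the \<open>zeta (2^e) ^ i\<close> with \<open>0 < i < 2^(e-1)\<close> up to sign
  and gives another \<open>\<rat>\<close>-basis of the same field of odd level.
\<close>

definition zeta :: "nat \<Rightarrow> complex" where
  "zeta n = cis (2 * pi / real n)"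

text \<open>A subfield of the complex numbers contains the rationals, so this is \<open>\<rat>(\<zeta>\<^sub>n)\<close>.\<close>

definition cyclotomic_field :: "nat \<Rightarrow> complex set" where
  "cyclotomic_field n = generate_field complex_ring {zeta n}"

definition is_conductor :: "complex set \<Rightarrow> nat \<Rightarrow> bool" where
  "is_conductor K n \<longleftrightarrow>
     n > 0 \<and> K \<subseteq> cyclotomic_field n \<and> (\<forall>k. k > 0 \<and> K \<subseteq> cyclotomic_field k \<longrightarrow> n \<le> k)"


subsection \<open>Rings of integers and tame ramification\<close>

definition ring_of_integers :: "complex set \<Rightarrow> complex set" where
  "ring_of_integers K = {x \<in> K. algebraic_int x}"

definition integer_ring :: "complex set \<Rightarrow> complex ring" where
  "integer_ring K = complex_ring\<lparr>carrier := ring_of_integers K\<rparr>"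

text \<open>
  For a nonzero prime ideal \<open>P\<close> of the integers of \<open>L\<close>, the exponent of \<open>P\<close> in the factorisation
  of the extension of \<open>P \<inter> K\<close> to the integers of \<open>L\<close>, i.e. the largest \<open>k\<close> such that the \<open>k\<close>-th
  power of \<open>P\<close> contains (divides) that ideal.
\<close>

definition ramification_index :: "complex set \<Rightarrow> complex set \<Rightarrow> complex set \<Rightarrow> nat" where
  "ramification_index L K P =
     (GREATEST k. genideal (integer_ring L) (P \<inter> K) \<subseteq> P [^]\<^bsub>ideals_set (integer_ring L)\<^esub> k)"

text \<open>
  Wild ramification at \<open>P\<close>: the residue characteristic, i.e. the prime number \<open>p\<close> in \<open>P\<close>, divides
  the ramification index. Residue fields are finite, so inseparable residue extensions do not occur.
\<close>

definition wildly_ramified_at :: "complex set \<Rightarrow> complex set \<Rightarrow> complex set \<Rightarrow> bool" where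
  "wildly_ramified_at L K P \<longleftrightarrow>
     (\<exists>p::nat. Factorial_Ring.prime p \<and> of_nat p \<in> P \<and> p dvd ramification_index L K P)"

definition tamely_ramified :: "complex set \<Rightarrow> complex set \<Rightarrow> bool" where
  "tamely_ramified L K \<longleftrightarrow>
     (\<forall>P. primeideal P (integer_ring L) \<and> P \<noteq> {0} \<longrightarrow> \<not> wildly_ramified_at L K P)"


subsection \<open>The trace and the adjusted trace map\<close>

text \<open>
  The trace of the \<open>K\<close>-linear map ``multiplication by \<open>x\<close>'' on \<open>L\<close>, computed from its matrix \<open>A\<close>
  with respect to any \<open>K\<close>-basis of \<open>L\<close>; the value does not depend on the basis.
\<close>

definition field_trace :: "complex set \<Rightarrow> complex set \<Rightarrow> complex \<Rightarrow> complex" where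
  "field_trace L K x =
     (THE t. \<exists>Us A.
        ring.independent complex_ring K Us \<and> ring.Span complex_ring K Us = L \<and>
        (\<forall>i<length Us. \<forall>j<length Us. A i j \<in> K) \<and>
        (\<forall>j<length Us. x * Us ! j = (\<Sum>i<length Us. A i j * Us ! i)) \<and>
        t = (\<Sum>i<length Us. A i i))"

text \<open>
  Coordinates of \<open>x\<close> in the \<open>\<rat>\<close>-basis \<open>zeta (2^e) ^ i * zeta m ^ j\<close> (the image of the tensor product
  basis) of the cyclotomic field of level \<open>2^e * m\<close>, for odd \<open>m\<close> and \<open>e > 0\<close>. They are unique for
  \<open>i\<close>, \<open>j\<close> in the range of summation and are only used there.
\<close>

definition tensor_basis_coords :: "nat \<Rightarrow> nat \<Rightarrow> complex \<Rightarrow> nat \<Rightarrow> nat \<Rightarrow> rat" where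
  "tensor_basis_coords e m x =
     (SOME c. x = (\<Sum>i<2^(e-1). \<Sum>j<totient m. of_rat (c i j) * (zeta (2^e) ^ i * zeta m ^ j)))"

text \<open>
  The adjusted trace map from the \<open>n\<close>-th cyclotomic field to its subfield \<open>K\<close>. If the extension is
  not tamely ramified, it is defined by \<open>\<rat>\<close>-linear extension from the tensor product basis.
\<close>

definition adjusted_trace :: "nat \<Rightarrow> complex set \<Rightarrow> complex \<Rightarrow> complex" where
  "adjusted_trace n K x =
     (let L = cyclotomic_field n in
      if tamely_ramified L K then field_trace L K x
      else
        (let e = multiplicity 2 n; m = n div 2^e; c = tensor_basis_coords e m x in
           \<Sum>i<2^(e-1). \<Sum>j<totient m. of_rat (c i j) *
             (if i = 0 then 1/2 * field_trace L K (zeta m ^ j)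
              else field_trace L K (zeta (2^e) ^ i * zeta m ^ j))))"

end

theory Submission
  imports Defs "Jordan_Normal_Form.Char_Poly"
begin

text \<open>
  Let \<open>L = \<rat>(\<zeta>\<^sub>n)\<close>, \<open>A = \<int>[\<zeta>\<^sub>n]\<close> and \<open>H = Gal(L/K)\<close>. For a prime \<open>p\<close> write \<open>n = p\<^sup>a m\<close> with \<open>m\<close> prime to \<open>p\<close>,
  let \<open>\<zeta>\<close> be a primitive root of unity of order \<open>p\<^sup>a\<close>, and let \<open>I\<close> be the inertia group at \<open>p\<close>, the part
  of \<open>H\<close> congruent to \<open>1\<close> modulo \<open>m\<close>. As \<open>n\<close> is the conductor, \<open>H\<close> does not contain the kernel of
  reduction modulo \<open>n / p\<close>; hence \<open>I\<close> embeds into the units modulo \<open>p\<close> (modulo \<open>4\<close> if \<open>p = 2\<close>), and \<open>p\<close>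
  divides the order of \<open>I\<close> only if \<open>p = 2\<close> and \<open>I = {1, \<sigma>}\<close> with \<open>\<sigma> \<zeta> = \<plusminus> \<zeta>\<^sup>-\<^sup>1\<close>.

  Suppose that this does not happen. By a Vandermonde argument the traces of the powers of \<open>\<zeta>\<^sub>m\<close> generate an
  ideal of \<open>A\<close> prime to \<open>p\<close>, for every \<open>p\<close>, so the trace is surjective on integers. The same argument
  for the products of these powers with \<open>(1 - \<zeta>) ^ (p - 1)\<close> yields elements of \<open>K\<close> of valuation at most \<open>p - 1\<close> at any
  given prime above \<open>p\<close>. So the ramification index is less than \<open>p\<close>, and the extension is tame.

  In the exceptional case the integers fixed by \<open>\<sigma>\<close> are polynomials over \<open>\<int>[\<zeta>\<^sub>m]\<close> in \<open>\<theta> = \<zeta> + \<sigma> \<zeta>\<close>, which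
  has valuation \<open>2\<close> above \<open>2\<close>; hence the elements of \<open>K\<close> have even valuation and the extension is wild.
  The adjusted trace map has the same image as half the trace on the integers fixed by \<open>\<sigma>\<close>, and the
  Vandermonde argument applies to the latter.
\<close>

hide_const (open) UnivPoly.coeff Divisibility.prime

section \<open>Polynomials over subrings of the complex numbers\<close>

text \<open>Nothing is localised and no factorisation theory of ideals enters. Every local statement
  at \<open>p\<close> rests on two facts about \<open>A\<close>: \<open>p\<close> is a unit times a
  power of \<open>unif p\<close>, and for some \<open>q\<close> all \<open>x\<close> satisfy
  \<open>x ^ q = x\<close> modulo \<open>unif p\<close>. The second fact makes \<open>A\<close>
  reduced modulo \<open>unif p\<close> and provides an explicit annihilator:
  \<open>1 - x ^ (q - 1)\<close> kills \<open>x\<close> modulo \<open>unif p\<close>. This replaces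
  residue fields in the proof that \<open>A\<close> is integrally closed, in the passage from ideals
  of \<open>A\<close> to ideals of \<open>K \<inter> A\<close>, and in the description of the powers
  of a prime ideal. The halving at \<open>i = 0\<close> has the following origin. For an integer
  fixed by the involution \<sigma>, equal conjugates come in pairs, so half its trace is still
  integral. An integer \<open>x\<close> and the fixed integer \<open>x + \<sigma> x\<close> satisfy
  \<open>T x = 1/2 T (x + \<sigma> x)\<close>. A fixed integer is a sum of such symmetrised terms
  and of an element of \<open>\<int>[\<zeta>_m]\<close>; only the latter is its own \<sigma>-image
  and is not symmetrised, so only its trace has to be halved.\<close>

locale complex_subring =
  fixes S :: "complex set"
  assumes one_closed [simp, intro]: "1 \<in> S"
    and diff_closed [intro]: "x \<in> S \<Longrightarrow> y \<in> S \<Longrightarrow> x - y \<in> S"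
    and mult_closed [intro]: "x \<in> S \<Longrightarrow> y \<in> S \<Longrightarrow> x * y \<in> S"
begin

lemma zero_closed [simp, intro]: "0 \<in> S"
  using diff_closed[OF one_closed one_closed] by simp

lemma uminus_closed [intro]: "x \<in> S \<Longrightarrow> - x \<in> S"
  using diff_closed[OF zero_closed, of x] by simp

lemma add_closed [intro]: "x \<in> S \<Longrightarrow> y \<in> S \<Longrightarrow> x + y \<in> S"
  using diff_closed[OF _ uminus_closed, of x y] by simp

lemma power_closed [intro]: "x \<in> S \<Longrightarrow> x ^ k \<in> S"
  by (induction k) auto

lemma sum_closed [intro]: "(\<And>i. i \<in> I \<Longrightarrow> f i \<in> S) \<Longrightarrow> sum f I \<in> S"
  by (induction I rule: infinite_finite_induct) auto

lemma prod_closed [intro]: "(\<And>i. i \<in> I \<Longrightarrow> f i \<in> S) \<Longrightarrow> prod f I \<in> S"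
  by (induction I rule: infinite_finite_induct) auto

lemma of_nat_closed [simp, intro]: "of_nat k \<in> S"
  by (induction k) auto

lemma of_int_closed [simp, intro]: "of_int k \<in> S"
proof (cases k)
  case (nonneg m)
  then show ?thesis
    by simp
next
  case (neg m)
  then show ?thesis
    using uminus_closed[OF of_nat_closed[of "Suc m"]] by simp
qed

lemma numeral_closed [simp, intro]: "numeral k \<in> S"
  using of_nat_closed[of "numeral k"] by simp

lemma Ints_subset: "\<int> \<subseteq> S"
  by (auto elim: Ints_cases)

end

lemma complex_subring_Ints: "complex_subring \<int>"
  by unfold_locales auto

text \<open>All rings that occur are subsets of the complex numbers, so polynomials over them share
  one type and carry a condition on the coefficients.\<close>

definition coeffs_in :: "complex set \<Rightarrow> complex poly \<Rightarrow> bool" where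
  "coeffs_in S p \<longleftrightarrow> (\<forall>i. coeff p i \<in> S)"

lemma coeffs_in_mono: "coeffs_in S p \<Longrightarrow> S \<subseteq> T \<Longrightarrow> coeffs_in T p"
  by (auto simp: coeffs_in_def)

context complex_subring
begin

lemma coeffs_in_0 [simp, intro]: "coeffs_in S 0"
  by (auto simp: coeffs_in_def)

lemma coeffs_in_pCons_iff [simp]: "coeffs_in S (pCons a p) \<longleftrightarrow> a \<in> S \<and> coeffs_in S p"
  by (auto simp: coeffs_in_def coeff_pCons split: nat.splits)

lemma coeffs_in_1 [simp, intro]: "coeffs_in S 1"
  by (simp add: one_pCons)

lemma coeffs_in_add [intro]: "coeffs_in S p \<Longrightarrow> coeffs_in S q \<Longrightarrow> coeffs_in S (p + q)"
  by (auto simp: coeffs_in_def)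

lemma coeffs_in_diff [intro]: "coeffs_in S p \<Longrightarrow> coeffs_in S q \<Longrightarrow> coeffs_in S (p - q)"
  by (auto simp: coeffs_in_def)

lemma coeffs_in_smult [intro]: "a \<in> S \<Longrightarrow> coeffs_in S p \<Longrightarrow> coeffs_in S (smult a p)"
  by (auto simp: coeffs_in_def)

lemma coeffs_in_monom [intro]: "a \<in> S \<Longrightarrow> coeffs_in S (monom a k)"
  by (auto simp: coeffs_in_def)

lemma coeffs_in_mult [intro]: "coeffs_in S p \<Longrightarrow> coeffs_in S q \<Longrightarrow> coeffs_in S (p * q)"
  by (auto simp: coeffs_in_def coeff_mult)

lemma coeffs_in_prod [intro]: "(\<And>i. i \<in> I \<Longrightarrow> coeffs_in S (f i)) \<Longrightarrow> coeffs_in S (prod f I)"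
  by (induction I rule: infinite_finite_induct) auto

lemma coeffs_in_sum [intro]: "(\<And>i. i \<in> I \<Longrightarrow> coeffs_in S (f i)) \<Longrightarrow> coeffs_in S (sum f I)"
  by (induction I rule: infinite_finite_induct) auto

lemma coeffs_in_pderiv [intro]: "coeffs_in S p \<Longrightarrow> coeffs_in S (pderiv p)"
proof -
  assume "coeffs_in S p"
  then have "of_nat (Suc i) * coeff p (Suc i) \<in> S" for i
    by (intro mult_closed of_nat_closed) (simp add: coeffs_in_def)
  then show ?thesis
    by (simp add: coeffs_in_def coeff_pderiv)
qed

lemma poly_closed [intro]: "coeffs_in S p \<Longrightarrow> x \<in> S \<Longrightarrow> poly p x \<in> S"
  by (induction p) auto

text \<open>A monic divisor requires no division of coefficients. Hence this serves the fields
  \<open>\<rat>\<close> and \<open>K\<close> as well as \<open>\<int>\<close>, where it yields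
  integral coordinates.\<close>

lemma monic_division:
  assumes f: "coeffs_in S f" "lead_coeff f = 1" and p: "coeffs_in S p"
  shows "\<exists>q r. coeffs_in S q \<and> coeffs_in S r \<and> p = f * q + r \<and> (r = 0 \<or> degree r < degree f)"
  using p
proof (induction "degree p" arbitrary: p rule: less_induct)
  case (less p)
  show ?case
  proof (cases "p = 0 \<or> degree p < degree f")
    case True
    then show ?thesis
      using less.prems by (intro exI[of _ 0] exI[of _ p]) auto
  next
    case False
    then have p0: "p \<noteq> 0" and deg: "degree f \<le> degree p"
      by auto
    define t where "t = monom (lead_coeff p) (degree p - degree f)"
    define p' where "p' = p - f * t"
    have t: "coeffs_in S t"
      using less.prems by (auto simp: t_def coeffs_in_def)
    then have p': "coeffs_in S p'"
      using less.prems f by (auto simp: p'_def)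
    have f0: "f \<noteq> 0"
      using f by auto
    have t0: "t \<noteq> 0"
      using p0 by (simp add: t_def)
    have dft: "degree (f * t) = degree p"
      using f0 t0 deg p0 by (simp add: degree_mult_eq t_def degree_monom_eq)
    have lc: "coeff (f * t) (degree p) = lead_coeff p"
      using lead_coeff_mult[of f t] f p0 unfolding dft by (simp add: t_def degree_monom_eq)
    have cancel: "coeff p' (degree p) = 0"
      by (simp add: p'_def lc)
    have "degree p' \<le> degree p"
      unfolding p'_def using dft by (intro degree_diff_le) auto
    show ?thesis
    proof (cases "degree p' < degree p")
      case True
      from less.hyps[OF True p'] obtain q r where qr: "coeffs_in S q" "coeffs_in S r"
        "p' = f * q + r" "r = 0 \<or> degree r < degree f"
        by auto
      have "p = f * (q + t) + r"
        using qr(3) by (simp add: p'_def algebra_simps)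
      with qr t show ?thesis
        by (intro exI[of _ "q + t"] exI[of _ r]) auto
    next
      case False
      with \<open>degree p' \<le> degree p\<close> have "degree p' = degree p"
        by simp
      with cancel have "p' = 0"
        by (metis leading_coeff_0_iff)
      then have "p = f * t + 0"
        by (simp add: p'_def)
      with t show ?thesis
        by (intro exI[of _ t] exI[of _ 0]) auto
    qed
  qed
qed

end

locale complex_subfield = complex_subring +
  assumes inverse_closed [intro]: "x \<in> S \<Longrightarrow> inverse x \<in> S"
begin

lemma divide_closed [intro]: "x \<in> S \<Longrightarrow> y \<in> S \<Longrightarrow> x / y \<in> S"
  by (auto simp: divide_inverse)

lemma of_rat_closed [simp, intro]: "of_rat r \<in> S"
  by (cases r) (auto simp: of_rat_rat)

lemma Rats_subset: "\<rat> \<subseteq> S"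
  by (auto elim: Rats_cases)

lemma minimal_polynomial_ex:
  assumes "coeffs_in S p0" "p0 \<noteq> 0" "poly p0 x = 0"
  obtains f where "coeffs_in S f" "lead_coeff f = 1" "poly f x = 0"
    "\<And>p. coeffs_in S p \<Longrightarrow> poly p x = 0 \<Longrightarrow> \<exists>q. coeffs_in S q \<and> p = f * q"
proof -
  define Q where "Q = (\<lambda>p. coeffs_in S p \<and> p \<noteq> 0 \<and> poly p x = 0)"
  have "Q p0"
    using assms by (simp add: Q_def)
  then obtain g where g: "Q g" and min: "\<And>p. Q p \<Longrightarrow> degree g \<le> degree p"
    using arg_min_natI[of Q p0 degree] arg_min_nat_le[of Q _ degree] by blast
  define f where "f = smult (inverse (lead_coeff g)) g"
  have lc: "lead_coeff g \<noteq> 0" "lead_coeff g \<in> S"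
    using g by (auto simp: Q_def coeffs_in_def)
  have f: "coeffs_in S f" "lead_coeff f = 1" "poly f x = 0" "degree f = degree g"
    using g lc unfolding f_def Q_def by auto
  have "\<exists>q. coeffs_in S q \<and> p = f * q" if p: "coeffs_in S p" "poly p x = 0" for p
  proof -
    obtain q r where qr: "coeffs_in S q" "coeffs_in S r" "p = f * q + r" "r = 0 \<or> degree r < degree f"
      using monic_division[OF f(1,2) p(1)] by auto
    have "poly r x = 0"
      using p(2) f(3) by (simp add: qr(3))
    have "r = 0"
    proof (rule ccontr)
      assume "r \<noteq> 0"
      then have "Q r"
        using qr \<open>poly r x = 0\<close> by (simp add: Q_def)
      then show False
        using min[of r] qr(4) \<open>r \<noteq> 0\<close> f(4) by simp
    qed
    then show ?thesis
      using qr by auto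
  qed
  then show ?thesis
    using that f by blast
qed

end

lemma complex_subfield_Rats: "complex_subfield \<rat>"
  by unfold_locales auto

section \<open>Rings generated by one element\<close>

definition adjoin :: "complex set \<Rightarrow> complex \<Rightarrow> complex set" where
  "adjoin S x = {poly p x | p. coeffs_in S p}"

context complex_subring
begin

lemma complex_subring_adjoin: "complex_subring (adjoin S x)"
proof
  show "1 \<in> adjoin S x"
    unfolding adjoin_def by (auto intro!: exI[of _ 1])
next
  fix y z assume "y \<in> adjoin S x" "z \<in> adjoin S x"
  then obtain p q where "coeffs_in S p" "coeffs_in S q" "y = poly p x" "z = poly q x"
    by (auto simp: adjoin_def)
  then show "y - z \<in> adjoin S x" "y * z \<in> adjoin S x"
    unfolding adjoin_def using coeffs_in_diff[of p q] coeffs_in_mult[of p q]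
    by (force intro: exI[of _ "p - q"], force intro: exI[of _ "p * q"])
qed

lemma adjoin_generator: "x \<in> adjoin S x"
  unfolding adjoin_def by (auto intro!: exI[of _ "[:0, 1:]"])

lemma adjoin_base: "S \<subseteq> adjoin S x"
  unfolding adjoin_def by (auto intro!: exI[of _ "[:_:]"])

end

lemma adjoin_subset:
  assumes "complex_subring T" "S \<subseteq> T" "x \<in> T"
  shows "adjoin S x \<subseteq> T"
  using assms complex_subring.poly_closed coeffs_in_mono unfolding adjoin_def by blast

lemma adjoinE:
  assumes "y \<in> adjoin S x"
  obtains p where "coeffs_in S p" "y = poly p x"
  using assms by (auto simp: adjoin_def)

lemma adjoinI: "coeffs_in S p \<Longrightarrow> poly p x \<in> adjoin S x"
  by (auto simp: adjoin_def)

section \<open>Roots of unity\<close>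

lemma zeta_power: "zeta n ^ k = cis (2 * pi * real k / real n)"
  by (simp add: zeta_def DeMoivre mult_ac)

lemma zeta_nonzero [simp]: "zeta n \<noteq> 0"
  by (simp add: zeta_def)

lemma zeta_power_self [simp]: "n > 0 \<Longrightarrow> zeta n ^ n = 1"
  by (simp add: zeta_power)

lemma zeta_power_eq_iff:
  assumes "n > 0"
  shows "zeta n ^ i = zeta n ^ j \<longleftrightarrow> [i = j] (mod n)"
proof -
  have inj: "inj_on (\<lambda>k. zeta n ^ k) {..<n}"
    using bij_betw_roots_unity[OF assms] by (simp add: bij_betw_def zeta_power)
  have m: "zeta n ^ (k mod n) = zeta n ^ k" for k
  proof -
    have "zeta n ^ k = zeta n ^ (n * (k div n) + k mod n)"
      by simp
    also have "\<dots> = zeta n ^ (k mod n)"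
      using assms by (simp only: power_add power_mult zeta_power_self) simp
    finally show ?thesis ..
  qed
  show ?thesis
    using inj_onD[OF inj, of "i mod n" "j mod n"] assms m by (auto simp: cong_def) (metis m)
qed

lemma zeta_power_eq_1_iff: "n > 0 \<Longrightarrow> zeta n ^ k = 1 \<longleftrightarrow> n dvd k"
  using zeta_power_eq_iff[of n k 0] by (simp add: cong_0_iff)

lemma zeta_power_mod: "n > 0 \<Longrightarrow> zeta n ^ (k mod n) = zeta n ^ k"
  by (simp add: zeta_power_eq_iff cong_def)

lemma zeta_divisor: "d > 0 \<Longrightarrow> k > 0 \<Longrightarrow> zeta (d * k) ^ k = zeta d"
  by (simp add: zeta_power) (simp add: zeta_def)

lemma roots_of_unity_eq:
  assumes "n > 0"
  shows "{z::complex. z ^ n = 1} = (\<lambda>k. zeta n ^ k) ` {..<n}"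
  using bij_betw_roots_unity[OF assms] by (simp add: bij_betw_def zeta_power)

lemma inj_on_zeta_power: "n > 0 \<Longrightarrow> inj_on (\<lambda>k. zeta n ^ k) {..<n}"
  by (auto simp: inj_on_def zeta_power_eq_iff cong_def)

text \<open>Multiplication by an element of \<open>\<int>[z]\<close> acts on the powers of \<open>z\<close> through an integer matrix.\<close>

lemma algebraic_int_adjoin_root_of_unity:
  fixes z :: complex
  assumes n: "n > 0" and z: "z ^ n = 1" and x: "x \<in> adjoin \<int> z"
  shows "algebraic_int x"
proof -
  obtain p where p: "coeffs_in \<int> p" "x = poly p z"
    using x by (rule adjoinE)
  have zmod: "z ^ (i mod n) = z ^ i" for i
  proof -
    have "z ^ i = z ^ (n * (i div n) + i mod n)"
      by simp
    also have "\<dots> = z ^ (i mod n)"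
      by (simp only: power_add power_mult z) simp
    finally show ?thesis ..
  qed
  have "\<forall>i. \<exists>k. coeff p i = of_int k"
    using p(1) by (auto simp: coeffs_in_def elim!: Ints_cases)
  then obtain a :: "nat \<Rightarrow> int" where a: "coeff p i = of_int (a i)" for i
    by metis
  define M :: "int mat" where
    "M = mat n n (\<lambda>(k, l). \<Sum>i \<in> {i. i \<le> degree p \<and> (i + k) mod n = l}. a i)"
  define M' :: "complex mat" where "M' = map_mat of_int M"
  define v where "v = vec n (\<lambda>k. z ^ k)"
  have M': "M' \<in> carrier_mat n n"
    by (simp add: M'_def M_def)
  have row: "(\<Sum>l<n. M' $$ (k, l) * z ^ l) = x * z ^ k" if k: "k < n" for k
  proof -
    have "(\<Sum>l<n. M' $$ (k, l) * z ^ l) =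
        (\<Sum>l<n. \<Sum>i \<in> {i. i \<le> degree p \<and> (i + k) mod n = l}. of_int (a i) * z ^ (i + k))"
      using k by (auto simp: M'_def M_def sum_distrib_right zmod intro!: sum.cong)
    also have "\<dots> = (\<Sum>l<n. sum (\<lambda>i. of_int (a i) * z ^ (i + k)) {i \<in> {..degree p}. (i + k) mod n = l})"
      by (intro sum.cong refl) auto
    also have "\<dots> = (\<Sum>i\<le>degree p. of_int (a i) * z ^ (i + k))"
      using n by (intro sum.group) auto
    also have "\<dots> = x * z ^ k"
      by (simp add: p(2) poly_altdef a sum_distrib_left sum_distrib_right power_add mult_ac)
    finally show ?thesis .
  qed
  have "eigenvector M' v x"
    unfolding eigenvector_def
  proof (intro conjI)
    show "v \<in> carrier_vec (dim_row M')"
      using M' by (auto simp: v_def)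
    have "v $ 0 = 1"
      using n by (simp add: v_def)
    then show "v \<noteq> 0\<^sub>v (dim_row M')"
      using M' n by auto
    show "M' *\<^sub>v v = x \<cdot>\<^sub>v v"
    proof (rule eq_vecI)
      fix k assume "k < dim_vec (x \<cdot>\<^sub>v v)"
      then have k: "k < n"
        by (simp add: v_def)
      show "(M' *\<^sub>v v) $ k = (x \<cdot>\<^sub>v v) $ k"
        using row[OF k] k M' by (auto simp: v_def scalar_prod_def lessThan_atLeast0)
    qed (use M' in \<open>auto simp: v_def\<close>)
  qed
  then have "poly (char_poly M') x = 0"
    using eigenvalue_root_char_poly[OF M'] unfolding eigenvalue_def by blast
  moreover have "char_poly M' = map_poly of_int (char_poly M)"
    unfolding M'_def by (rule of_int_hom.char_poly_hom[of _ n]) (simp add: M_def)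
  moreover have "lead_coeff (char_poly M) = 1"
    using degree_monic_char_poly[of M n] by (simp add: M_def)
  ultimately show ?thesis
    unfolding algebraic_int_altdef_ipoly by auto
qed

lemma monic_root_polynomial:
  assumes "n > 0"
  shows "lead_coeff (monom 1 n - 1 :: complex poly) = 1" "degree (monom 1 n - 1 :: complex poly) = n"
proof -
  have *: "degree (- 1 :: complex poly) < degree (monom 1 n :: complex poly)"
    using assms by (simp add: degree_monom_eq)
  have "degree (monom 1 n + (- 1) :: complex poly) = degree (monom 1 n :: complex poly)"
    using * by (rule degree_add_eq_left)
  then show "degree (monom 1 n - 1 :: complex poly) = n"
    by (simp add: degree_monom_eq)
  then show "lead_coeff (monom 1 n - 1 :: complex poly) = 1"
    using assms by simp
qed

text \<open>The derivative of \<open>X ^ n - 1\<close> vanishes at most at 0, so all roots of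
  \<open>X ^ n - 1\<close>, and those of its factors, are simple. A monic factor is thus determined
  by its set of roots.\<close>

lemma monic_divisor_of_root_polynomial:
  fixes f :: "complex poly"
  assumes n: "n > 0" and fg: "f * g = monom 1 n - 1" and f: "lead_coeff f = 1"
  shows "f = (\<Prod>a | poly f a = 0. [:- a, 1:])" "finite {a. poly f a = 0}"
    "card {a. poly f a = 0} = degree f" "\<And>a. poly f a = 0 \<Longrightarrow> a ^ n = 1"
proof -
  have ev: "poly f a * poly g a = a ^ n - 1" for a
    using arg_cong[OF fg, of "\<lambda>p. poly p a"] by (simp add: poly_monom)
  show root: "a ^ n = 1" if "poly f a = 0" for a
    using ev[of a] that by simp
  have "rsquarefree f"
    unfolding rsquarefree_roots
  proof (intro allI notI)
    fix a assume a: "poly f a = 0 \<and> poly (pderiv f) a = 0"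
    have "pderiv (f * g) = monom (of_nat n) (n - 1)"
      by (simp add: fg pderiv_diff pderiv_monom)
    from arg_cong[OF this, of "\<lambda>p. poly p a"] have "of_nat n * a ^ (n - 1) = 0"
      using a by (simp add: pderiv_mult poly_monom)
    moreover have "a \<noteq> 0"
      using root[of a] a n by (auto simp: power_0_left)
    ultimately show False
      using n by simp
  qed
  then show "f = (\<Prod>a | poly f a = 0. [:- a, 1:])"
    using complex_poly_decompose_rsquarefree[of f] f by simp
  moreover show "finite {a. poly f a = 0}"
    using f by (intro poly_roots_finite) auto
  ultimately show "card {a. poly f a = 0} = degree f"
    by (metis (no_types, lifting) degree_prod_sum_eq card_eq_sum degree_pCons_eq_if one_neq_zero pCons_eq_0_iff sum.cong degree_0 One_nat_def)
qed

text \<open>This takes the place of Gauss's lemma: the coefficients are sums of products of roots of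
  unity, hence algebraic integers, and a rational algebraic integer is an integer.\<close>

lemma coeffs_in_Ints_of_Rats:
  assumes n: "n > 0" and fg: "f * g = monom 1 n - 1" and f: "lead_coeff f = 1" and "coeffs_in \<rat> f"
  shows "coeffs_in \<int> f"
proof -
  interpret complex_subring "adjoin \<int> (zeta n)"
    by (rule complex_subring.complex_subring_adjoin[OF complex_subring_Ints])
  have z: "zeta n \<in> adjoin \<int> (zeta n)"
    by (rule complex_subring.adjoin_generator[OF complex_subring_Ints])
  have root: "a \<in> adjoin \<int> (zeta n)" if "poly f a = 0" for a
  proof -
    have "a \<in> (\<lambda>k. zeta n ^ k) ` {..<n}"
      using monic_divisor_of_root_polynomial(4)[OF n fg f that] roots_of_unity_eq[OF n] by blast
    then show ?thesis
      using z by auto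
  qed
  have "coeffs_in (adjoin \<int> (zeta n)) (\<Prod>a | poly f a = 0. [:- a, 1:])"
    using root by (intro coeffs_in_prod) (auto intro!: uminus_closed)
  then have "coeffs_in (adjoin \<int> (zeta n)) f"
    using monic_divisor_of_root_polynomial(1)[OF n fg f] by simp
  then have "algebraic_int (coeff f i)" for i
    using n by (intro algebraic_int_adjoin_root_of_unity[OF n zeta_power_self]) (auto simp: coeffs_in_def)
  then show ?thesis
    using assms(4) rational_algebraic_int_is_int by (auto simp: coeffs_in_def)
qed

section \<open>Frobenius modulo a prime, and conjugates of roots of unity\<close>

context complex_subring
begin

lemma freshmans_dream:
  assumes p: "prime (p::nat)" and "x \<in> S" "y \<in> S"
  shows "\<exists>w\<in>S. (x + y) ^ p = x ^ p + y ^ p + of_nat p * w"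
proof -
  have p1: "p > 1"
    using p by (rule prime_gt_1_nat)
  define g where "g k = of_nat ((p choose k) div p) * x ^ k * y ^ (p - k)" for k
  have mid: "of_nat (p choose k) * x ^ k * y ^ (p - k) = of_nat p * g k" if "k \<in> {0<..<p}" for k
  proof -
    have "p dvd (p choose k)"
      using that p by (intro dvd_choose_prime) auto
    then have "p choose k = p * ((p choose k) div p)"
      by simp
    then have "of_nat (p choose k) = (of_nat p * of_nat ((p choose k) div p) :: complex)"
      by (metis of_nat_mult)
    then show ?thesis
      by (simp add: g_def)
  qed
  have "{..p} = insert 0 (insert p {0<..<p})"
    using p1 by auto
  then have "(x + y) ^ p = y ^ p + x ^ p + (\<Sum>k\<in>{0<..<p}. of_nat (p choose k) * x ^ k * y ^ (p - k))"
    using p1 by (simp add: binomial_ring)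
  also have "(\<Sum>k\<in>{0<..<p}. of_nat (p choose k) * x ^ k * y ^ (p - k)) = of_nat p * sum g {0<..<p}"
    using mid by (simp add: sum_distrib_left)
  finally have "(x + y) ^ p = x ^ p + y ^ p + of_nat p * sum g {0<..<p}"
    by simp
  moreover have "sum g {0<..<p} \<in> S"
    unfolding g_def using assms by (intro sum_closed mult_closed of_nat_closed power_closed)
  ultimately show ?thesis
    by blast
qed

text \<open>Raising to the power \<open>p\<close> is additive modulo \<open>p\<close> and, by
  Fermat, fixes integer coefficients.\<close>

lemma frobenius_poly:
  assumes p: "prime (p::nat)" and "coeffs_in \<int> f" and z: "z \<in> S"
  shows "\<exists>w\<in>S. poly f z ^ p = poly f (z ^ p) + of_nat p * w"
  using assms(2)
proof (induction f)
  case 0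
  then show ?case
    using prime_gt_0_nat[OF p] by (auto simp: power_0_left)
next
  case (pCons a f)
  interpret I: complex_subring \<int>
    by (rule complex_subring_Ints)
  from pCons have a: "a \<in> \<int>" and f: "coeffs_in \<int> f"
    by auto
  obtain w where w: "w \<in> S" "poly f z ^ p = poly f (z ^ p) + of_nat p * w"
    using pCons.IH[OF f] by auto
  have fz: "poly f z \<in> S"
    using coeffs_in_mono[OF f Ints_subset] z by auto
  obtain v where v: "v \<in> S" "(a + z * poly f z) ^ p = a ^ p + (z * poly f z) ^ p + of_nat p * v"
    using freshmans_dream[OF p, of a "z * poly f z"] a fz z Ints_subset by blast
  obtain k where k: "a = of_int k"
    using a by (rule Ints_cases)
  have "[k ^ p = k] (mod int p)"
  proof (cases "int p dvd k")
    case True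
    then show ?thesis
      using prime_gt_0_nat[OF p] by (simp add: cong_def dvd_imp_mod_0 dvd_power_le)
         (metis True dvd_imp_mod_0 dvd_power dvd_trans)
  next
    case False
    \<comment> \<open>\<open>fermat_theorem\<close> concerns natural numbers, so \<open>k\<close> is
      replaced by its least residue.\<close>
    define l where "l = nat (k mod int p)"
    have kl: "[int l = k] (mod int p)"
      using prime_gt_0_nat[OF p] by (simp add: l_def cong_def)
    have "\<not> p dvd l"
      using False kl by (metis cong_dvd_iff int_dvd_int_iff)
    then have "[int (l ^ (p - 1)) = int 1] (mod int p)"
      using fermat_theorem[OF p] by (simp only: cong_int_iff)
    then have "[k ^ (p - 1) = 1] (mod int p)"
      using cong_pow[OF kl, of "p - 1"] by (metis cong_sym cong_trans of_nat_1 of_nat_power)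
    then show ?thesis
      using cong_scalar_left[of "k ^ (p - 1)" 1 "int p" k] prime_gt_0_nat[OF p]
      by (simp add: power_eq_if)
  qed
  then obtain u where u: "k ^ p = k + int p * u"
    using cong_iff_lin[of k "k ^ p" "int p"] cong_sym by auto
  have "a ^ p = of_int (k ^ p)"
    by (simp add: k)
  also have "\<dots> = a + of_nat p * of_int u"
    by (simp only: u k) simp
  finally have ap: "a ^ p = a + of_nat p * of_int u" .
  have "poly (pCons a f) z ^ p = poly (pCons a f) (z ^ p) + of_nat p * (of_int u + z ^ p * w + v)"
    by (simp add: v(2) ap power_mult_distrib w(2) algebra_simps)
  moreover have "of_int u + z ^ p * w + v \<in> S"
    using z w v by auto
  ultimately show ?case
    by blast
qed

end

text \<open>
  If \<open>z ^ p\<close> were a root of the cofactor \<open>g\<close> of the minimal polynomial \<open>f\<close> in \<open>X ^ n - 1\<close>, the derivative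
  of \<open>f * g\<close> at \<open>z ^ p\<close> would be divisible by \<open>f (z ^ p)\<close>, hence by \<open>p\<close>.
\<close>

lemma conjugate_root_of_unity_prime:
  assumes n: "n > 0" and p: "prime (p::nat)" "\<not> p dvd n" and z: "z ^ n = 1"
    and r: "coeffs_in \<rat> r" "poly r z = 0"
  shows "poly r (z ^ p) = 0"
proof -
  interpret Q: complex_subfield \<rat>
    by (rule complex_subfield_Rats)
  have X: "coeffs_in \<rat> (monom 1 n - 1)" "poly (monom 1 n - 1) z = 0"
    using z by (auto simp: poly_monom)
  have "monom 1 n - 1 \<noteq> (0 :: complex poly)"
    using monic_root_polynomial(1)[OF n] by (metis coeff_0 zero_neq_one)
  with X obtain f where f: "coeffs_in \<rat> f" "lead_coeff f = 1" "poly f z = 0"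
    and fmin: "\<And>p. coeffs_in \<rat> p \<Longrightarrow> poly p z = 0 \<Longrightarrow> \<exists>q. coeffs_in \<rat> q \<and> p = f * q"
    using Q.minimal_polynomial_ex by metis
  obtain g where g: "coeffs_in \<rat> g" "monom 1 n - 1 = f * g"
    using fmin[OF X] by auto
  have "lead_coeff (f * g) = 1"
    unfolding g(2)[symmetric] by (rule monic_root_polynomial(1)[OF n])
  then have lg: "lead_coeff g = 1"
    using f(2) by (simp add: lead_coeff_mult)
  have fi: "coeffs_in \<int> f"
    using coeffs_in_Ints_of_Rats[OF n g(2)[symmetric] f(2) f(1)] .
  have gi: "coeffs_in \<int> g"
    using coeffs_in_Ints_of_Rats[OF n _ lg g(1), of f] g(2) by (simp add: mult.commute)
  have "poly f (z ^ p) = 0"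
  proof (rule ccontr)
    assume nz: "poly f (z ^ p) \<noteq> 0"
    define A where "A = adjoin \<int> z"
    interpret A: complex_subring A
      unfolding A_def by (rule complex_subring.complex_subring_adjoin[OF complex_subring_Ints])
    have zA: "z \<in> A"
      unfolding A_def by (rule complex_subring.adjoin_generator[OF complex_subring_Ints])
    obtain w where w: "w \<in> A" "poly f z ^ p = poly f (z ^ p) + of_nat p * w"
      using A.frobenius_poly[OF p(1) fi zA] by auto
    \<comment> \<open>As \<open>f\<close> vanishes at \<open>z\<close>, Frobenius leaves only the
      multiple of \<open>p\<close>.\<close>
    have fzp: "poly f (z ^ p) = of_nat p * (- w)"
      using w(2) f(3) prime_gt_0_nat[OF p(1)] by (simp add: power_0_left eq_neg_iff_add_eq_0)
    have zp: "(z ^ p) ^ n = 1"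
      using z by (metis power_mult mult.commute power_one)
    have gz: "poly g (z ^ p) = 0"
      using arg_cong[OF g(2), of "\<lambda>q. poly q (z ^ p)"] zp nz by (simp add: poly_monom)
    have "pderiv (f * g) = monom (of_nat n) (n - 1)"
      by (simp add: g(2)[symmetric] pderiv_diff pderiv_monom)
    from arg_cong[OF this, of "\<lambda>q. poly q (z ^ p)"]
    have "of_nat n * (z ^ p) ^ (n - 1) = poly f (z ^ p) * poly (pderiv g) (z ^ p)"
      using gz by (simp add: pderiv_mult poly_monom)
    then have "of_nat n * (z ^ p) ^ (n - 1) * z ^ p = of_nat p * (- w * poly (pderiv g) (z ^ p) * z ^ p)"
      by (simp add: fzp)
    \<comment> \<open>Since \<open>z ^ p\<close> is a unit, the derivative at this point is
      \<open>n\<close> times a unit; so \<open>n / p\<close> would lie in \<open>A\<close> and be a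
      rational algebraic integer.\<close>
    moreover have "(z ^ p) ^ (n - 1) * z ^ p = 1"
      using zp n by (metis power_minus_mult)
    ultimately have "of_nat n = of_nat p * (- w * poly (pderiv g) (z ^ p) * z ^ p)"
      by (metis mult.assoc mult.right_neutral)
    then have "of_nat n / of_nat p = - w * poly (pderiv g) (z ^ p) * z ^ p"
      using prime_gt_0_nat[OF p(1)] by (simp add: field_simps)
    moreover have "coeffs_in A (pderiv g)"
      using coeffs_in_mono[OF gi A.Ints_subset] by auto
    ultimately have "of_nat n / of_nat p \<in> A"
      using w(1) zA by (auto intro!: A.uminus_closed A.mult_closed A.poly_closed)
    then have "algebraic_int (of_nat n / of_nat p :: complex)"
      using algebraic_int_adjoin_root_of_unity[OF n z] by (simp add: A_def)
    then have "of_nat n / of_nat p \<in> (\<int> :: complex set)"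
      by (rule rational_algebraic_int_is_int) auto
    then obtain k where "of_nat n / of_nat p = (of_int k :: complex)"
      by (rule Ints_cases)
    then have "(of_nat n :: complex) = of_int k * of_nat p"
      using prime_gt_0_nat[OF p(1)] by (simp add: field_simps)
    then have "(of_int (int n) :: complex) = of_int (k * int p)"
      by simp
    then have "int n = k * int p"
      unfolding of_int_eq_iff .
    then have "int p dvd int n"
      by simp
    then show False
      using p(2) by simp
  qed
  then show ?thesis
    using fmin[OF r] by auto
qed

text \<open>This is the irreducibility of the cyclotomic polynomials in the form that makes \<sigma>
  well defined. Splitting a prime \<open>p\<close> off \<open>c\<close> replaces \<open>z\<close> by
  \<open>z ^ p\<close>, so \<open>z\<close> stays arbitrary in the induction.\<close>

theorem conjugate_root_of_unity:
  assumes n: "n > 0" and c: "coprime c n" and z: "z ^ n = 1"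
    and r: "coeffs_in \<rat> r" "poly r z = 0"
  shows "poly r (z ^ c) = 0"
  using c z r(2)
proof (induction c arbitrary: z rule: prime_divisors_induct)
  \<comment> \<open>\<open>coprime 0 n\<close> forces \<open>n = 1\<close>, hence
    \<open>z = 1\<close>.\<close>
  case zero
  then show ?case
    by (simp add: power_0_left)
next
  case (unit c)
  then show ?case
    by simp
next
  case (factor p c)
  have "poly r (z ^ p) = 0"
    using conjugate_root_of_unity_prime[OF n factor.hyps _ factor.prems(2) r(1) factor.prems(3)]
      factor.prems(1) factor.hyps n
    by (metis coprime_common_divisor dvd_triv_left not_prime_unit)
  moreover have "(z ^ p) ^ n = 1"
    using factor.prems(2) by (metis power_mult mult.commute power_one)
  moreover have "coprime c n"
    using factor.prems(1) by simp
  ultimately show ?case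
    using factor.IH[of "z ^ p"] by (simp add: power_mult)
qed

section \<open>Cyclotomic fields and their automorphisms\<close>

lemma common_denominator:
  assumes "coeffs_in \<rat> p"
  shows "\<exists>d>0. coeffs_in \<int> (smult (of_nat d) p)"
  using assms
proof (induction p)
  case 0
  then show ?case
    by (auto simp: coeffs_in_def)
next
  case (pCons a p)
  interpret Q: complex_subring \<rat>
    using complex_subfield_Rats by (simp add: complex_subfield_def)
  interpret Z: complex_subring \<int>
    by (rule complex_subring_Ints)
  obtain d where d: "d > 0" "coeffs_in \<int> (smult (of_nat d) p)"
    using pCons by auto
  have "a \<in> \<rat>"
    using pCons.prems by simp
  then obtain k l where kl: "l > 0" "a = of_int k / of_int l"
    by (auto elim: Rats_cases')
  have l: "(of_nat (nat l) :: complex) = of_int l"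
    using kl(1) by simp
  have "of_nat (nat l * d) * a = of_nat d * (of_int l * a)"
    by (simp add: l mult_ac)
  also have "\<dots> = of_int (int d * k)"
    using kl by simp
  finally have "of_nat (nat l * d) * a \<in> \<int>"
    by (metis Ints_of_int)
  moreover have "smult (of_nat (nat l * d)) p = smult (of_nat (nat l)) (smult (of_nat d) p)"
    by simp
  then have "coeffs_in \<int> (smult (of_nat (nat l * d)) p)"
    using d(2) by (metis Z.coeffs_in_smult Z.of_nat_closed)
  ultimately show ?case
    using d(1) kl(1) by (intro exI[of _ "nat l * d"]) auto
qed

lemma adjoin_Rats_denominator:
  assumes "x \<in> adjoin \<rat> z"
  obtains d where "d > 0" "of_nat d * x \<in> adjoin \<int> z"
proof -
  obtain p where p: "coeffs_in \<rat> p" "x = poly p z"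
    using assms by (rule adjoinE)
  obtain d where "d > 0" "coeffs_in \<int> (smult (of_nat d) p)"
    using common_denominator[OF p(1)] by auto
  then show ?thesis
    using that[of d] adjoinI[of \<int> "smult (of_nat d) p" z] by (simp add: p(2))
qed

lemma complex_subring_Rats: "complex_subring \<rat>"
  using complex_subfield_Rats by (simp add: complex_subfield_def)

text \<open>Write the minimal polynomial \<open>f\<close> as \<open>c + X * g\<close>. Then
  \<open>y * g(y) = - c\<close>, and \<open>c\<close> is nonzero, for otherwise \<open>g\<close>,
  which has smaller degree, would be a multiple of \<open>f\<close>.\<close>

lemma algebraic_int_inverse_in_adjoin:
  fixes y :: complex
  assumes y: "algebraic_int y" "y \<noteq> 0"
  shows "inverse y \<in> adjoin \<rat> y"
proof -
  interpret Q: complex_subfield \<rat>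
    by (rule complex_subfield_Rats)
  obtain p0 where p0: "lead_coeff p0 = 1" "\<forall>i. coeff p0 i \<in> \<int>" "poly p0 y = 0"
    using y(1) by (auto elim: algebraic_int.cases)
  have "coeffs_in \<rat> p0" "p0 \<noteq> 0"
    using p0 Ints_subset_Rats by (auto simp: coeffs_in_def)
  with p0(3) obtain f where f: "coeffs_in \<rat> f" "lead_coeff f = 1" "poly f y = 0"
    and fmin: "\<And>p. coeffs_in \<rat> p \<Longrightarrow> poly p y = 0 \<Longrightarrow> \<exists>q. coeffs_in \<rat> q \<and> p = f * q"
    using Q.minimal_polynomial_ex by metis
  obtain c g where fcg: "f = pCons c g"
    by (cases f)
  have cg: "c \<in> \<rat>" "coeffs_in \<rat> g"
    using f(1) by (auto simp: fcg)
  have "c \<noteq> 0"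
  proof
    assume "c = 0"
    then have "poly g y = 0"
      using f(3) y(2) by (simp add: fcg)
    then obtain q where q: "g = f * q"
      using fmin cg(2) by blast
    have "g \<noteq> 0"
      using f(2) \<open>c = 0\<close> fcg by auto
    then have "degree f \<le> degree g"
      using q by (metis dvd_imp_degree_le dvd_triv_left)
    then show False
      using \<open>g \<noteq> 0\<close> by (simp add: fcg)
  qed
  have "y * poly g y = - c"
    using f(3) by (simp add: fcg eq_neg_iff_add_eq_0 add.commute)
  then have "inverse y = poly (smult (- (1 / c)) g) y"
    using \<open>c \<noteq> 0\<close> y(2) by (simp add: field_simps)
  moreover have "coeffs_in \<rat> (smult (- (1 / c)) g)"
    using cg by (intro Q.coeffs_in_smult Q.uminus_closed Q.divide_closed) auto
  ultimately show ?thesis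
    by (metis adjoinI)
qed

text \<open>A positive integer multiple of \<open>x\<close> is an algebraic integer, to which the
  previous lemma applies. So \<open>\<rat>[z]\<close> is already the field
  \<open>\<rat>(z)\<close>.\<close>

lemma complex_subfield_adjoin_root_of_unity:
  assumes n: "n > 0" and z: "z ^ n = 1"
  shows "complex_subfield (adjoin \<rat> z)"
proof -
  interpret S: complex_subring "adjoin \<rat> z"
    by (rule complex_subring.complex_subring_adjoin[OF complex_subring_Rats])
  show ?thesis
  proof
    fix x assume x: "x \<in> adjoin \<rat> z"
    show "inverse x \<in> adjoin \<rat> z"
    proof (cases "x = 0")
      case False
      obtain d where d: "d > 0" "of_nat d * x \<in> adjoin \<int> z"
        using x by (rule adjoin_Rats_denominator)
      have "adjoin \<rat> (of_nat d * x) \<subseteq> adjoin \<rat> z"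
        using x complex_subring.adjoin_base[OF complex_subring_Rats]
        by (intro adjoin_subset S.complex_subring_axioms) auto
      moreover have "inverse (of_nat d * x) \<in> adjoin \<rat> (of_nat d * x)"
        using algebraic_int_adjoin_root_of_unity[OF n z d(2)] d(1) False
        by (intro algebraic_int_inverse_in_adjoin) auto
      ultimately have "of_nat d * inverse (of_nat d * x) \<in> adjoin \<rat> z"
        by blast
      moreover have "of_nat d * inverse (of_nat d * x) = inverse x"
        using d(1) False by (simp add: field_simps)
      ultimately show ?thesis
        by metis
    qed simp
  qed
qed

text \<open>The definitions speak of record-based rings, the arguments use the arithmetic of the
  type \<open>complex\<close>; this equivalence is the bridge.\<close>

lemma complex_subfield_iff: "subfield K complex_ring \<longleftrightarrow> complex_subfield K"
proof
  interpret C: field complex_ring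
    by (rule field_from_type_algebra)
  have C: "carrier complex_ring = UNIV" "monoid.mult complex_ring = (*)" "add complex_ring = (+)"
    "one complex_ring = 1" "ring.zero complex_ring = 0"
    by (simp_all add: ring_of_type_algebra_def)
  have neg: "a_inv complex_ring x = - x" for x
    using C.minus_equality[of "- x" x] by (simp add: C)
  have inv: "m_inv complex_ring x = inverse x" if "x \<noteq> 0" for x
    using C.comm_inv_char[of x "inverse x"] that by (simp add: C)
  {
    assume K: "subfield K complex_ring"
    note sub = subfieldE(1)[OF K]
    show "complex_subfield K"
    proof
      show "1 \<in> K"
        using subringE(3)[OF sub] by (simp add: C)
      fix x y assume xy: "x \<in> K" "y \<in> K"
      show "x * y \<in> K"
        using subringE(6)[OF sub xy] by (simp add: C)
      have "- y \<in> K"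
        using subringE(5)[OF sub xy(2)] by (simp add: neg)
      then show "x - y \<in> K"
        using subringE(7)[OF sub xy(1), of "- y"] by (simp add: C)
    next
      fix x assume x: "x \<in> K"
      show "inverse x \<in> K"
      proof (cases "x = 0")
        case False
        then show ?thesis
          using C.subfield_m_inv(1)[OF K, of x] x by (simp add: C inv)
      qed (use x in simp)
    qed
  }
  {
    assume "complex_subfield K"
    then interpret K: complex_subfield K .
    show "subfield K complex_ring"
    proof (rule C.subfieldI')
      show "subring K complex_ring"
        by (rule C.subringI) (auto simp: C neg)
      show "m_inv complex_ring k \<in> K" if "k \<in> K - {ring.zero complex_ring}" for k
        using that by (auto simp: C inv)
    qed
  }
qed

lemma cyclotomic_field_eq:
  assumes n: "n > 0"
  shows "cyclotomic_field n = adjoin \<rat> (zeta n)"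
proof
  interpret C: field complex_ring
    by (rule field_from_type_algebra)
  have "subfield (adjoin \<rat> (zeta n)) complex_ring"
    unfolding complex_subfield_iff using n
    by (intro complex_subfield_adjoin_root_of_unity[of n]) auto
  then show "cyclotomic_field n \<subseteq> adjoin \<rat> (zeta n)"
    unfolding cyclotomic_field_def
    using complex_subring.adjoin_generator[OF complex_subring_Rats]
    by (intro C.generate_field_min_subfield1) (auto simp: ring_of_type_algebra_def)
  have "subfield (cyclotomic_field n) complex_ring"
    unfolding cyclotomic_field_def
    by (intro C.generate_field_is_subfield) (auto simp: ring_of_type_algebra_def)
  then interpret S: complex_subfield "cyclotomic_field n"
    by (simp add: complex_subfield_iff)
  show "adjoin \<rat> (zeta n) \<subseteq> cyclotomic_field n"
    using S.Rats_subset
    by (intro adjoin_subset S.complex_subring_axioms)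
      (auto simp: cyclotomic_field_def intro: generate_field.incl)
qed

section \<open>The cyclotomic field and its automorphisms\<close>

locale cyclotomic =
  fixes n :: nat
  assumes n_pos: "n > 0"
begin

abbreviation \<zeta> :: complex where "\<zeta> \<equiv> zeta n"

definition L :: "complex set" where "L = adjoin \<rat> \<zeta>"

definition A :: "complex set" where "A = adjoin \<int> \<zeta>"

lemma zeta_n: "\<zeta> ^ n = 1"
  using n_pos by simp

sublocale L: complex_subfield L
  unfolding L_def by (rule complex_subfield_adjoin_root_of_unity[OF n_pos zeta_n])

sublocale A: complex_subring A
  unfolding A_def by (rule complex_subring.complex_subring_adjoin[OF complex_subring_Ints])

lemma zeta_in_A: "\<zeta> \<in> A"
  unfolding A_def by (rule complex_subring.adjoin_generator[OF complex_subring_Ints])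

lemma A_subset_L: "A \<subseteq> L"
  unfolding A_def L_def adjoin_def using coeffs_in_mono[OF _ Ints_subset_Rats] by auto

lemma zeta_in_L: "\<zeta> \<in> L"
  using zeta_in_A A_subset_L by auto

lemma zeta_power_in_A [intro]: "\<zeta> ^ k \<in> A"
  using zeta_in_A by auto

lemma zeta_divisor_power:
  assumes "d dvd n"
  shows "zeta d = \<zeta> ^ (n div d)"
  using zeta_divisor[of d "n div d"] assms n_pos
  by (metis dvd_div_eq_0_iff dvd_mult_div_cancel dvd_pos_nat gr0I)

lemma zeta_divisor_in_A: "d dvd n \<Longrightarrow> zeta d ^ k \<in> A"
  by (simp only: zeta_divisor_power[of d]) auto

lemma algebraic_int_A: "x \<in> A \<Longrightarrow> algebraic_int x"
  unfolding A_def by (rule algebraic_int_adjoin_root_of_unity[OF n_pos zeta_n])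

text \<open>The automorphism that raises \<zeta> to the power \<open>c\<close>. For \<open>c\<close>
  prime to \<open>n\<close> the choice of the polynomial does not matter, by
  \<open>conjugate_root_of_unity\<close>; for other \<open>c\<close> the value has no
  meaning.\<close>

definition \<sigma> :: "nat \<Rightarrow> complex \<Rightarrow> complex" where
  "\<sigma> c x = poly (SOME p. coeffs_in \<rat> p \<and> x = poly p \<zeta>) (\<zeta> ^ c)"

lemma sigma_poly:
  assumes c: "coprime c n" and p: "coeffs_in \<rat> p"
  shows "\<sigma> c (poly p \<zeta>) = poly p (\<zeta> ^ c)"
proof -
  interpret Q: complex_subring \<rat>
    by (rule complex_subring_Rats)
  define q where "q = (SOME q. coeffs_in \<rat> q \<and> poly p \<zeta> = poly q \<zeta>)"
  have q: "coeffs_in \<rat> q \<and> poly p \<zeta> = poly q \<zeta>"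
    unfolding q_def by (rule someI[of _ p]) (use p in simp)
  have "poly (q - p) (\<zeta> ^ c) = 0"
    using q p by (intro conjugate_root_of_unity[OF n_pos c zeta_n]) auto
  then show ?thesis
    by (simp add: \<sigma>_def q_def)
qed

lemma L_cases:
  assumes "x \<in> L"
  obtains p where "coeffs_in \<rat> p" "x = poly p \<zeta>"
  using assms unfolding L_def by (rule adjoinE)

lemma A_cases:
  assumes "x \<in> A"
  obtains p where "coeffs_in \<int> p" "x = poly p \<zeta>"
  using assms unfolding A_def by (rule adjoinE)

context
  fixes c assumes c: "coprime c n"
begin

lemma sigma_rat: "x \<in> \<rat> \<Longrightarrow> \<sigma> c x = x"
  using sigma_poly[OF c, of "[:x:]"] by (simp add: coeffs_in_def coeff_pCons split: nat.splits)

lemma sigma_in_L: "x \<in> L \<Longrightarrow> \<sigma> c x \<in> L"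
  by (elim L_cases)
    (auto simp: sigma_poly[OF c] intro!: L.poly_closed coeffs_in_mono[OF _ L.Rats_subset] zeta_in_L)

lemma sigma_in_A: "x \<in> A \<Longrightarrow> \<sigma> c x \<in> A"
  by (elim A_cases) (auto simp: sigma_poly[OF c coeffs_in_mono[OF _ Ints_subset_Rats]]
    intro!: A.poly_closed coeffs_in_mono[OF _ A.Ints_subset])

lemma sigma_add: "x \<in> L \<Longrightarrow> y \<in> L \<Longrightarrow> \<sigma> c (x + y) = \<sigma> c x + \<sigma> c y"
proof (elim L_cases)
  interpret Q: complex_subring \<rat>
    by (rule complex_subring_Rats)
  fix p q assume "coeffs_in \<rat> p" "x = poly p \<zeta>" "coeffs_in \<rat> q" "y = poly q \<zeta>"
  then show ?thesis
    using sigma_poly[OF c, of "p + q"] by (auto simp: sigma_poly[OF c])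
qed

lemma sigma_mult: "x \<in> L \<Longrightarrow> y \<in> L \<Longrightarrow> \<sigma> c (x * y) = \<sigma> c x * \<sigma> c y"
proof (elim L_cases)
  interpret Q: complex_subring \<rat>
    by (rule complex_subring_Rats)
  fix p q assume "coeffs_in \<rat> p" "x = poly p \<zeta>" "coeffs_in \<rat> q" "y = poly q \<zeta>"
  then show ?thesis
    using sigma_poly[OF c, of "p * q"] by (auto simp: sigma_poly[OF c])
qed

lemma sigma_uminus: "x \<in> L \<Longrightarrow> \<sigma> c (- x) = - \<sigma> c x"
  using sigma_mult[of "-1" x] sigma_rat[of "-1"] by auto

lemma sigma_diff: "x \<in> L \<Longrightarrow> y \<in> L \<Longrightarrow> \<sigma> c (x - y) = \<sigma> c x - \<sigma> c y"
  using sigma_add[of x "- y"] sigma_uminus[of y] by auto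

lemma sigma_power: "x \<in> L \<Longrightarrow> \<sigma> c (x ^ k) = \<sigma> c x ^ k"
  by (induction k) (auto simp: sigma_mult sigma_rat L.power_closed)

lemma sigma_sum: "(\<And>i. i \<in> I \<Longrightarrow> f i \<in> L) \<Longrightarrow> \<sigma> c (sum f I) = (\<Sum>i\<in>I. \<sigma> c (f i))"
  by (induction I rule: infinite_finite_induct) (auto simp: sigma_add sigma_rat L.sum_closed)

lemma sigma_zeta_power: "\<sigma> c (\<zeta> ^ k) = \<zeta> ^ (c * k)"
  using sigma_poly[OF c, of "monom 1 k"]
  by (simp add: complex_subring.coeffs_in_monom[OF complex_subring_Rats] poly_monom power_mult)

lemma sigma_zeta_divisor: "d dvd n \<Longrightarrow> \<sigma> c (zeta d ^ k) = zeta d ^ (c * k)"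
  by (simp only: zeta_divisor_power[of d] sigma_zeta_power mult_ac flip: power_mult)

end

lemma sigma_sigma:
  assumes c: "coprime c n" and d: "coprime d n" and x: "x \<in> L"
  shows "\<sigma> c (\<sigma> d x) = \<sigma> (c * d) x"
proof -
  interpret Q: complex_subring \<rat>
    by (rule complex_subring_Rats)
  obtain p where p: "coeffs_in \<rat> p" "x = poly p \<zeta>"
    using x by (rule L_cases)
  have "coeffs_in \<rat> (p \<circ>\<^sub>p monom 1 d)"
    using p(1) by (induction p) (auto simp: pcompose_pCons intro!: Q.coeffs_in_add Q.coeffs_in_mult Q.coeffs_in_monom)
  then have "\<sigma> c (poly (p \<circ>\<^sub>p monom 1 d) \<zeta>) = poly (p \<circ>\<^sub>p monom 1 d) (\<zeta> ^ c)"
    by (rule sigma_poly[OF c])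
  moreover have "coprime (c * d) n"
    using c d by simp
  ultimately show ?thesis
    using p by (simp add: sigma_poly[OF d] sigma_poly poly_pcompose poly_monom power_mult)
qed

lemma sigma_cong: "[c = d] (mod n) \<Longrightarrow> \<sigma> c x = \<sigma> d x"
  using zeta_power_eq_iff[OF n_pos, of c d] by (simp add: \<sigma>_def)

lemma sigma_1: "x \<in> L \<Longrightarrow> \<sigma> (Suc 0) x = x"
  by (elim L_cases) (simp add: sigma_poly)

end

section \<open>Galois correspondence for a subfield of the cyclotomic field\<close>

locale cyclotomic_subfield = cyclotomic n + K: complex_subfield K for n K +
  assumes K_subset_L: "K \<subseteq> L"
begin

text \<open>The Galois group of \<open>L / K\<close> as residues modulo \<open>n\<close>.
  Representatives lie below \<open>n\<close>, so for \<open>n = 1\<close> the identity is 0; this is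
  why it appears as \<open>Suc 0 mod n\<close> below.\<close>

definition H :: "nat set" where
  "H = {c. c < n \<and> coprime c n \<and> (\<forall>x\<in>K. \<sigma> c x = x)}"

lemma finite_H [simp, intro]: "finite H"
  by (rule finite_subset[of _ "{..<n}"]) (auto simp: H_def)

lemma H_coprime: "c \<in> H \<Longrightarrow> coprime c n"
  by (simp add: H_def)

lemma H_less: "c \<in> H \<Longrightarrow> c < n"
  by (simp add: H_def)

lemma H_fixes: "c \<in> H \<Longrightarrow> x \<in> K \<Longrightarrow> \<sigma> c x = x"
  by (simp add: H_def)

lemma mod_in_H_iff: "c mod n \<in> H \<longleftrightarrow> coprime c n \<and> (\<forall>x\<in>K. \<sigma> c x = x)"
  using n_pos sigma_cong[of "c mod n" c] by (auto simp: H_def cong_def)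

lemma one_in_H: "Suc 0 mod n \<in> H"
  unfolding mod_in_H_iff using K_subset_L sigma_1 by auto

lemma card_H_pos: "card H > 0"
  using one_in_H by (auto simp: card_gt_0_iff)

lemma mult_in_H: "c \<in> H \<Longrightarrow> d \<in> H \<Longrightarrow> c * d mod n \<in> H"
  unfolding mod_in_H_iff using H_coprime H_fixes K_subset_L
  by (auto simp: subset_iff simp flip: sigma_sigma)

lemma bij_betw_mult_H:
  assumes c: "c \<in> H"
  shows "bij_betw (\<lambda>d. c * d mod n) H H"
proof -
  have "inj_on (\<lambda>d. c * d mod n) H"
  proof (rule inj_onI)
    fix d d' assume *: "d \<in> H" "d' \<in> H" "c * d mod n = c * d' mod n"
    then have "[c * d = c * d'] (mod n)"
      by (simp add: cong_def)
    then have "[d = d'] (mod n)"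
      using H_coprime[OF c] by (simp add: cong_mult_lcancel_nat)
    then show "d = d'"
      using * H_less by (auto simp: cong_def)
  qed
  moreover have "(\<lambda>d. c * d mod n) ` H \<subseteq> H"
    using mult_in_H[OF c] by auto
  ultimately show ?thesis
    by (simp add: bij_betw_def endo_inj_surj)
qed

lemma sigma_poly_K:
  assumes c: "c \<in> H" and g: "coeffs_in K g"
  shows "\<sigma> c (poly g \<zeta>) = poly g (\<zeta> ^ c)"
  using g
proof (induction g)
  case 0
  then show ?case
    using sigma_rat[OF H_coprime[OF c], of 0] by simp
next
  case (pCons a g)
  have "a \<in> K" "coeffs_in K g"
    using pCons.prems by auto
  moreover have "a \<in> L" "poly g \<zeta> \<in> L"
    using K_subset_L coeffs_in_mono[OF \<open>coeffs_in K g\<close> K_subset_L] \<open>a \<in> K\<close> zeta_in_L by auto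
  moreover have "\<sigma> c \<zeta> = \<zeta> ^ c"
    using sigma_zeta_power[OF H_coprime[OF c], of 1] by simp
  ultimately show ?case
    using pCons.IH zeta_in_L H_fixes[OF c] H_coprime[OF c]
    by (simp add: sigma_add sigma_mult L.mult_closed)
qed

end

text \<open>With \<open>k = gcd c n\<close> and \<open>d = n div k\<close> the witness is
  \<open>(X ^ n - 1) / (X ^ d - 1)\<close>. As \<open>k > 1\<close>, the primitive root is not a
  \<open>d\<close>-th root of unity and is a zero; \<open>zeta n ^ c\<close> is a
  \<open>d\<close>-th root of unity, where the value is \<open>k\<close>. This shows that conjugates
  of primitive roots are primitive.\<close>

lemma vanishing_at_primitive_root:
  assumes n: "n > 0" and c: "\<not> coprime c n"
  obtains s where "coeffs_in \<int> s" "poly s (zeta n) = 0" "poly s (zeta n ^ c) \<noteq> 0"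
proof -
  define k where "k = gcd c n"
  define d where "d = n div k"
  have "k \<noteq> 1"
    unfolding k_def using c coprime_iff_gcd_eq_1[of c n] by blast
  moreover have "k \<noteq> 0"
    using n by (simp add: k_def)
  ultimately have k1: "k > 1"
    by linarith
  have kc: "k dvd c" and kn: "k dvd n"
    by (simp_all add: k_def)
  have nd: "n = d * k"
    using kn unfolding d_def by (rule dvd_div_mult_self[symmetric])
  have d0: "d > 0"
    using n unfolding nd by simp
  have dn: "d < n"
    using d0 k1 unfolding nd by simp
  have zd: "zeta n ^ d \<noteq> 1"
    unfolding zeta_power_eq_1_iff[OF n] using d0 dn by (auto dest: dvd_imp_le)
  have zdk: "(zeta n ^ d) ^ k = 1"
    unfolding power_mult[symmetric] nd[symmetric] by (rule zeta_power_self[OF n])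
  obtain j where j: "c = k * j"
    using kc by (rule dvdE)
  have cd: "(zeta n ^ c) ^ d = 1"
  proof -
    have "(zeta n ^ c) ^ d = ((zeta n ^ d) ^ k) ^ j"
      unfolding j power_mult[symmetric] by (simp add: mult_ac)
    then show ?thesis
      unfolding zdk by simp
  qed
  define s where "s = (\<Sum>i<k. monom (1::complex) (d * i))"
  have ev: "poly s y = (\<Sum>i<k. (y ^ d) ^ i)" for y
    unfolding s_def poly_sum by (simp add: poly_monom power_mult)
  show ?thesis
  proof (rule that[of s])
    show "coeffs_in \<int> s"
      unfolding s_def
      by (intro complex_subring.coeffs_in_sum complex_subring.coeffs_in_monom complex_subring_Ints) auto
    have "(zeta n ^ d - 1) * poly s (zeta n) = 0"
      unfolding ev using power_diff_1_eq[of "zeta n ^ d" k] zdk by simp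
    then show "poly s (zeta n) = 0"
      using zd by simp
    show "poly s (zeta n ^ c) \<noteq> 0"
      unfolding ev cd using k1 by simp
  qed
qed

context cyclotomic_subfield
begin

lemma inj_on_zeta_H: "inj_on (\<lambda>c. \<zeta> ^ c) H"
  using inj_on_zeta_power[OF n_pos] by (rule inj_on_subset) (auto simp: H_def)

text \<open>The roots of the minimal polynomial over \<open>K\<close> are exactly the powers
  \<open>\<zeta> ^ c\<close> with \<open>c \<in> H\<close>. The equality of degree and
  \<open>card H\<close> is the source of all Galois theory used below.\<close>

lemma minimal_polynomial_zeta:
  obtains f g where "coeffs_in K f" "lead_coeff f = 1" "poly f \<zeta> = 0" "degree f = card H"
    "f * g = monom 1 n - 1"
proof -
  define F where "F = (monom 1 n - 1 :: complex poly)"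
  have F: "coeffs_in K F" "F \<noteq> 0" "poly F \<zeta> = 0"
    using monic_root_polynomial[OF n_pos] zeta_n by (auto simp: F_def poly_monom)
  obtain f where f: "coeffs_in K f" "lead_coeff f = 1" "poly f \<zeta> = 0"
    and fmin: "\<And>p. coeffs_in K p \<Longrightarrow> poly p \<zeta> = 0 \<Longrightarrow> \<exists>q. coeffs_in K q \<and> p = f * q"
    using K.minimal_polynomial_ex[OF F] by metis
  obtain g where g: "f * g = monom 1 n - 1"
    using fmin[OF F(1,3)] unfolding F_def by metis
  note roots = monic_divisor_of_root_polynomial[OF n_pos g f(2)]
  have "{a. poly f a = 0} = (\<lambda>c. \<zeta> ^ c) ` H"
  proof (intro equalityI subsetI)
    fix a assume "a \<in> (\<lambda>c. \<zeta> ^ c) ` H"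
    then obtain c where c: "c \<in> H" "a = \<zeta> ^ c"
      by auto
    then show "a \<in> {a. poly f a = 0}"
      using sigma_poly_K[OF c(1) f(1)] sigma_rat[OF H_coprime[OF c(1)], of 0] f(3) by simp
  next
    fix a assume "a \<in> {a. poly f a = 0}"
    then have a: "poly f a = 0"
      by simp
    then obtain c where c: "c < n" "a = \<zeta> ^ c"
      using roots(4)[OF a] roots_of_unity_eq[OF n_pos] by blast
    have "coprime c n"
    proof (rule ccontr)
      assume "\<not> coprime c n"
      then obtain s where s: "coeffs_in \<int> s" "poly s \<zeta> = 0" "poly s (\<zeta> ^ c) \<noteq> 0"
        using vanishing_at_primitive_root[OF n_pos] by blast
      then obtain q where "s = f * q"
        using fmin coeffs_in_mono[OF s(1) K.Ints_subset] by blast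
      then show False
        using a s(3) by (simp add: c(2))
    qed
    \<comment> \<open>With \<open>x = poly r \<zeta>\<close>, the polynomial \<open>r - x\<close>
      over \<open>K\<close> vanishes at \<zeta>, so it is a multiple of \<open>f\<close> and
      vanishes at \<open>a\<close> too.\<close>
    moreover have "\<sigma> c x = x" if x: "x \<in> K" for x
    proof -
      obtain r where r: "coeffs_in \<rat> r" "x = poly r \<zeta>"
        using x K_subset_L by (auto elim: L_cases)
      have "coeffs_in K (r - [:x:])"
        using coeffs_in_mono[OF r(1) K.Rats_subset] x by (intro K.coeffs_in_diff) auto
      moreover have "poly (r - [:x:]) \<zeta> = 0"
        by (simp add: r(2))
      ultimately obtain q where "r - [:x:] = f * q"
        using fmin by blast
      from arg_cong[OF this, of "\<lambda>p. poly p a"] have "poly r a = x"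
        using a by simp
      moreover have "\<sigma> c x = poly r a"
        using sigma_poly[OF \<open>coprime c n\<close> r(1)] by (simp add: r(2) c(2))
      ultimately show ?thesis
        by simp
    qed
    ultimately show "a \<in> (\<lambda>c. \<zeta> ^ c) ` H"
      using c by (auto simp: H_def)
  qed
  moreover have "inj_on (\<lambda>c. \<zeta> ^ c) H"
    by (rule inj_on_zeta_H)
  ultimately have "degree f = card H"
    using roots(3) by (simp add: card_image)
  then show ?thesis
    using that f g by blast
qed

lemma L_power_basis:
  assumes "x \<in> L"
  obtains g where "coeffs_in K g" "degree g < card H" "x = poly g \<zeta>"
proof -
  obtain p where p: "coeffs_in \<rat> p" "x = poly p \<zeta>"
    using assms by (rule L_cases)
  obtain f where f: "coeffs_in K f" "lead_coeff f = 1" "poly f \<zeta> = 0" "degree f = card H"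
    by (rule minimal_polynomial_zeta)
  obtain q r where "coeffs_in K q" "coeffs_in K r" "p = f * q + r" "r = 0 \<or> degree r < degree f"
    using K.monic_division[OF f(1,2) coeffs_in_mono[OF p(1) K.Rats_subset]] by auto
  then show ?thesis
    using that[of r] p(2) f(3,4) card_H_pos by auto
qed

lemma power_basis_independent:
  assumes g: "coeffs_in K g" "degree g < card H" "poly g \<zeta> = 0"
  shows "g = 0"
proof (rule ccontr)
  assume "g \<noteq> 0"
  have "(\<lambda>c. \<zeta> ^ c) ` H \<subseteq> {a. poly g a = 0}"
    using sigma_poly_K[OF _ g(1)] sigma_rat[OF H_coprime, of _ 0] g(3) by auto
  then have "card ((\<lambda>c. \<zeta> ^ c) ` H) \<le> degree g"
    using poly_roots_degree[of g] poly_roots_finite[OF \<open>g \<noteq> 0\<close>] card_mono[of "{a. poly g a = 0}"] \<open>g \<noteq> 0\<close>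
    by (meson le_trans)
  moreover have "inj_on (\<lambda>c. \<zeta> ^ c) H"
    by (rule inj_on_zeta_H)
  ultimately show False
    using g(2) by (simp add: card_image)
qed

text \<open>The polynomial \<open>g - x\<close> vanishes at the \<open>card H\<close> conjugates of
  \<zeta> but has smaller degree. So \<open>g\<close> is the constant \<open>x\<close>, and its
  coefficients lie in \<open>K\<close>.\<close>

theorem fixed_field:
  assumes x: "x \<in> L" and fixed: "\<And>c. c \<in> H \<Longrightarrow> \<sigma> c x = x"
  shows "x \<in> K"
proof -
  obtain g where g: "coeffs_in K g" "degree g < card H" "x = poly g \<zeta>"
    using x by (rule L_power_basis)
  have "g - [:x:] = 0"
  proof (rule ccontr)
    assume nz: "g - [:x:] \<noteq> 0"
    have "(\<lambda>c. \<zeta> ^ c) ` H \<subseteq> {a. poly (g - [:x:]) a = 0}"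
      using sigma_poly_K[OF _ g(1)] fixed g(3) by auto
    then have "card ((\<lambda>c. \<zeta> ^ c) ` H) \<le> degree (g - [:x:])"
      using poly_roots_degree[OF nz] poly_roots_finite[OF nz] by (meson card_mono le_trans)
    moreover have "degree (g - [:x:]) \<le> degree g"
      by (rule degree_diff_le) auto
    moreover have "inj_on (\<lambda>c. \<zeta> ^ c) H"
      by (rule inj_on_zeta_H)
    ultimately show False
      using g(2) by (simp add: card_image)
  qed
  then have "coeff g 0 = x"
    by (metis coeff_pCons_0 eq_iff_diff_eq_0)
  then show ?thesis
    using g(1) by (auto simp: coeffs_in_def)
qed

end

section \<open>The ring of integers of a cyclotomic field\<close>

context complex_subring
begin

lemma image_mult_add: "x \<in> (*) a ` S \<Longrightarrow> y \<in> (*) a ` S \<Longrightarrow> x + y \<in> (*) a ` S"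
  by (elim imageE) (simp only: add_closed imageI flip: distrib_left)

lemma image_mult_uminus: "x \<in> (*) a ` S \<Longrightarrow> - x \<in> (*) a ` S"
  by (elim imageE) (simp only: uminus_closed imageI flip: mult_minus_right)

lemma image_mult_diff: "x \<in> (*) a ` S \<Longrightarrow> y \<in> (*) a ` S \<Longrightarrow> x - y \<in> (*) a ` S"
  using image_mult_add[OF _ image_mult_uminus, of x a y] by simp

lemma image_mult_mult: "x \<in> (*) a ` S \<Longrightarrow> y \<in> S \<Longrightarrow> x * y \<in> (*) a ` S"
  by (elim imageE) (simp only: mult_closed imageI mult.assoc)

lemma image_mult_mult': "x \<in> (*) a ` S \<Longrightarrow> y \<in> S \<Longrightarrow> y * x \<in> (*) a ` S"
  using image_mult_mult[of x a y] by (simp add: mult.commute)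

lemma image_mult_sum: "(\<And>i. i \<in> I \<Longrightarrow> f i \<in> (*) a ` S) \<Longrightarrow> sum f I \<in> (*) a ` S"
proof (induction I rule: infinite_finite_induct)
  case (insert x F)
  then show ?case
    by (simp add: image_mult_add)
qed (auto intro: image_eqI[of _ _ 0])

lemma image_mult_trans: "a \<in> (*) b ` S \<Longrightarrow> x \<in> (*) a ` S \<Longrightarrow> x \<in> (*) b ` S"
  by (elim imageE) (simp only: mult_closed imageI mult.assoc)

lemma poly_diff_factor:
  assumes "coeffs_in S g" and x: "x \<in> S" and y: "y \<in> S"
  shows "poly g x - poly g y \<in> (*) (x - y) ` S"
  using assms(1)
proof (induction g)
  case 0
  then show ?case
    by (auto intro: image_eqI[of _ _ 0])
next
  case (pCons a g)
  then have g: "coeffs_in S g"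
    by simp
  have "poly (pCons a g) x - poly (pCons a g) y = (x - y) * poly g x + y * (poly g x - poly g y)"
    by (simp add: algebra_simps)
  also have "\<dots> \<in> (*) (x - y) ` S"
    using pCons.IH[OF g] g x y by (intro image_mult_add[OF imageI image_mult_mult']) auto
  finally show ?case .
qed

definition integral :: "complex \<Rightarrow> bool" where
  "integral z \<longleftrightarrow> (\<exists>d c. (\<forall>i. c i \<in> S) \<and> z ^ d = (\<Sum>i<d. c i * z ^ i))"

lemma integral_mult:
  assumes "integral z" and a: "a \<in> S"
  shows "integral (a * z)"
proof -
  obtain d c where c: "\<And>i. c i \<in> S" and z: "z ^ d = (\<Sum>i<d. c i * z ^ i)"
    using assms(1) by (auto simp: integral_def)
  have "(a * z) ^ d = (\<Sum>i<d. a ^ d * (c i * z ^ i))"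
    by (simp add: power_mult_distrib z sum_distrib_left)
  also have "\<dots> = (\<Sum>i<d. (c i * a ^ (d - i)) * (a * z) ^ i)"
  proof (intro sum.cong refl)
    fix i assume "i \<in> {..<d}"
    then have "a ^ d = a ^ (d - i) * a ^ i"
      by (simp flip: power_add)
    then show "a ^ d * (c i * z ^ i) = (c i * a ^ (d - i)) * (a * z) ^ i"
      by (simp add: power_mult_distrib mult_ac)
  qed
  finally show ?thesis
    unfolding integral_def using c a by (intro exI[of _ d] exI[of _ "\<lambda>i. c i * a ^ (d - i)"]) auto
qed

lemma algebraic_int_imp_integral:
  assumes "algebraic_int z"
  shows "integral z"
proof -
  obtain p where p: "lead_coeff p = 1" "\<forall>i. coeff p i \<in> \<int>" "poly p z = 0"
    using assms by (auto elim: algebraic_int.cases)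
  have "(\<Sum>i<Suc (degree p). coeff p i * z ^ i) = 0"
    using p(3) by (simp only: poly_altdef lessThan_Suc_atMost)
  then have "z ^ degree p = (\<Sum>i<degree p. - coeff p i * z ^ i)"
    using p(1) by (simp add: sum_negf eq_neg_iff_add_eq_0 add.commute)
  moreover have "- coeff p i \<in> S" for i
    using p(2) Ints_subset by auto
  ultimately show ?thesis
    unfolding integral_def by (intro exI[of _ "degree p"] exI[of _ "\<lambda>i. - coeff p i"]) auto
qed

lemma iterated_frobenius:
  assumes q: "\<And>x. x \<in> S \<Longrightarrow> x ^ q - x \<in> (*) a ` S" and y: "y \<in> S"
  shows "y ^ (q ^ k) - y \<in> (*) a ` S"
proof (induction k)
  case 0
  then show ?case
    by (auto intro: image_eqI[of _ _ 0])
next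
  case (Suc k)
  have eq: "y ^ (q ^ Suc k) - y = ((y ^ (q ^ k)) ^ q - y ^ (q ^ k)) + (y ^ (q ^ k) - y)"
    by (simp flip: power_mult add: mult.commute)
  show ?case
    unfolding eq by (rule image_mult_add[OF q[OF power_closed[OF y]] Suc.IH])
qed

text \<open>Iteration gives \<open>y ^ (q ^ d) = y\<close> modulo \<open>a\<close>; since
  \<open>q ^ d > d\<close>, the left side is a multiple of \<open>y ^ d\<close>, hence of
  \<open>a\<close>.\<close>

lemma reduced:
  assumes q: "\<And>x. x \<in> S \<Longrightarrow> x ^ q - x \<in> (*) a ` S" "q \<ge> 2" and y: "y \<in> S"
    and d: "y ^ d \<in> (*) a ` S"
  shows "y \<in> (*) a ` S"
proof -
  have "d < q ^ d"
    using less_le_trans[OF less_exp[of d] power_mono[OF q(2), of d]] by simp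
  then have "y ^ (q ^ d) = y ^ d * y ^ (q ^ d - d)"
    by (simp flip: power_add)
  then have "y ^ (q ^ d) \<in> (*) a ` S"
    using image_mult_mult[OF d power_closed[OF y]] by simp
  moreover have "y ^ (q ^ d) - y \<in> (*) a ` S"
    using q(1) y by (rule iterated_frobenius)
  ultimately have "y ^ (q ^ d) - (y ^ (q ^ d) - y) \<in> (*) a ` S"
    by (rule image_mult_diff)
  then show ?thesis
    by simp
qed

text \<open>
  If \<open>a * z\<close> lies in the ring, multiplying an equation of integral dependence of degree \<open>d\<close> for \<open>z\<close>
  by \<open>a ^ d\<close> shows that \<open>(a * z) ^ d\<close> is divisible by \<open>a\<close>; but the ring has no nilpotents modulo \<open>a\<close>.
\<close>

lemma integral_closed_step:
  assumes a: "a \<in> S" "a \<noteq> 0" and q: "\<And>x. x \<in> S \<Longrightarrow> x ^ q - x \<in> (*) a ` S" "q \<ge> 2"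
    and z: "integral z" and az: "a * z \<in> S"
  shows "z \<in> S"
proof -
  obtain d c where c: "\<And>i. c i \<in> S" and zd: "z ^ d = (\<Sum>i<d. c i * z ^ i)"
    using z by (auto simp: integral_def)
  have "(a * z) ^ d = (\<Sum>i<d. a ^ d * (c i * z ^ i))"
    by (simp add: power_mult_distrib zd sum_distrib_left)
  also have "\<dots> = (\<Sum>i<d. a * (a ^ (d - Suc i) * c i * (a * z) ^ i))"
  proof (intro sum.cong refl)
    fix i assume "i \<in> {..<d}"
    then have "a ^ d = a * a ^ (d - Suc i) * a ^ i"
      by (simp flip: power_add power_Suc)
    then show "a ^ d * (c i * z ^ i) = a * (a ^ (d - Suc i) * c i * (a * z) ^ i)"
      by (simp add: power_mult_distrib mult_ac)
  qed
  also have "\<dots> \<in> (*) a ` S"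
    using a az c by (intro image_mult_sum imageI mult_closed[OF mult_closed[OF power_closed] power_closed])
  finally have "a * z \<in> (*) a ` S"
    using q az by (intro reduced[of q a "a * z" d]) auto
  then show ?thesis
    using a(2) by auto
qed

lemma integral_closed_power:
  assumes a: "a \<in> S" "a \<noteq> 0" and q: "\<And>x. x \<in> S \<Longrightarrow> x ^ q - x \<in> (*) a ` S" "q \<ge> 2"
    and z: "integral z" and az: "a ^ k * z \<in> S"
  shows "z \<in> S"
  using az
proof (induction k)
  case (Suc k)
  have "a * (a ^ k * z) \<in> S"
    using Suc.prems by (simp add: mult.assoc)
  moreover have "integral (a ^ k * z)"
    using z a(1) by (intro integral_mult) auto
  ultimately show ?case
    using Suc.IH integral_closed_step[OF a q] by blast
qed simp

end

text \<open>Evaluate \<open>(X ^ N - 1) / (X - 1) = 1 + X + ... + X ^ (N - 1)\<close>, split into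
  linear factors, at 1.\<close>

lemma prod_one_minus_zeta:
  assumes N: "N > 0"
  shows "(\<Prod>k\<in>{1..<N}. 1 - zeta N ^ k) = of_nat N"
proof -
  define lin where "lin = [:0, 1 :: complex:]"
  have "monom 1 N - 1 = (\<Prod>a | poly (monom 1 N - 1) a = 0. [:- a, 1 :: complex:])"
    by (rule monic_divisor_of_root_polynomial(1)[OF N, of _ 1]) (simp_all add: monic_root_polynomial[OF N] N)
  also have "{a. poly (monom 1 N - 1) a = 0} = {a::complex. a ^ N = 1}"
    by (simp add: poly_monom)
  also have "(\<Prod>a\<in>\<dots>. [:- a, 1 :: complex:]) = (\<Prod>k<N. [:- (zeta N ^ k), 1:])"
    unfolding roots_of_unity_eq[OF N] using inj_on_zeta_power[OF N] by (simp add: prod.reindex)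
  also have "{..<N} = insert 0 {1..<N}"
    using N by auto
  also have "(\<Prod>k\<in>\<dots>. [:- (zeta N ^ k), 1:]) = (lin - 1) * (\<Prod>k\<in>{1..<N}. [:- (zeta N ^ k), 1:])"
    by (simp add: lin_def one_pCons)
  finally have "(lin - 1) * (\<Prod>k\<in>{1..<N}. [:- (zeta N ^ k), 1:]) = monom 1 N - 1" ..
  also have "monom 1 N - 1 = (lin - 1) * (\<Sum>i<N. lin ^ i)"
    using power_diff_1_eq[of lin N] by (simp add: lin_def monom_altdef)
  finally have "(lin - 1) * (\<Prod>k\<in>{1..<N}. [:- (zeta N ^ k), 1:]) = (lin - 1) * (\<Sum>i<N. lin ^ i)" .
  moreover have "lin - 1 \<noteq> 0"
    by (simp add: lin_def one_pCons)
  ultimately have "(\<Prod>k\<in>{1..<N}. [:- (zeta N ^ k), 1:]) = (\<Sum>i<N. lin ^ i)"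
    using mult_left_cancel by blast
  from arg_cong[OF this, of "\<lambda>p. poly p 1"] show ?thesis
    by (simp add: poly_prod poly_sum lin_def)
qed

text \<open>The exponents divisible by \<open>p\<close> contribute the full product of level
  \<open>p ^ (a - 1)\<close>; dividing \<open>p ^ a\<close> by \<open>p ^ (a - 1)\<close> leaves
  \<open>p\<close>.\<close>

lemma prod_one_minus_zeta_prime_power:
  assumes p: "prime (p::nat)" and a: "a > 0"
  shows "(\<Prod>k\<in>{k\<in>{1..<p ^ a}. \<not> p dvd k}. 1 - zeta (p ^ a) ^ k) = of_nat p"
proof -
  have p0: "p > 0"
    using p by (rule prime_gt_0_nat)
  define N where "N = p ^ (a - 1)"
  have N: "N > 0" "p ^ a = N * p"
    using p0 a power_minus_mult[OF a, of p] by (auto simp: N_def)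
  have eq: "{1..<N * p} = {k\<in>{1..<N * p}. \<not> p dvd k} \<union> (\<lambda>k. p * k) ` {1..<N}"
  proof (intro equalityI subsetI)
    fix k assume k: "k \<in> {1..<N * p}"
    show "k \<in> {k\<in>{1..<N * p}. \<not> p dvd k} \<union> (\<lambda>k. p * k) ` {1..<N}"
    proof (cases "p dvd k")
      case True
      then obtain l where l: "k = p * l"
        by (rule dvdE)
      then have "l \<in> {1..<N}"
        using k p0 by (auto simp: mult.commute)
      then show ?thesis
        using l by auto
    qed (use k in auto)
  next
    fix k assume "k \<in> {k\<in>{1..<N * p}. \<not> p dvd k} \<union> (\<lambda>k. p * k) ` {1..<N}"
    then show "k \<in> {1..<N * p}"
      using p0 by (auto simp: mult.commute)
  qed
  have "of_nat (N * p) = (\<Prod>k\<in>{1..<N * p}. 1 - zeta (N * p) ^ k)"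
    using prod_one_minus_zeta[of "N * p"] N(1) p0 by simp
  also have "\<dots> = (\<Prod>k\<in>{k\<in>{1..<N * p}. \<not> p dvd k}. 1 - zeta (N * p) ^ k) *
      (\<Prod>k\<in>(\<lambda>k. p * k) ` {1..<N}. 1 - zeta (N * p) ^ k)"
    by (subst eq, subst prod.union_disjoint) auto
  also have "(\<Prod>k\<in>(\<lambda>k. p * k) ` {1..<N}. 1 - zeta (N * p) ^ k) = (\<Prod>k\<in>{1..<N}. 1 - zeta N ^ k)"
    using p0 by (subst prod.reindex) (auto simp: inj_on_def power_mult zeta_divisor N(1))
  also have "\<dots> = of_nat N"
    using prod_one_minus_zeta[OF N(1)] .
  finally show ?thesis
    using N by (simp add: mult.commute)
qed

lemma zeta_neq_1: "N > 1 \<Longrightarrow> zeta N \<noteq> 1"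
  using zeta_power_eq_1_iff[of N 1] by simp

lemma one_minus_power_factor: "1 - (x::complex) ^ k = (1 - x) * (\<Sum>i<k. x ^ i)"
  using power_diff_1_eq[of x k] by (simp add: algebra_simps)

section \<open>The radical of a rational prime\<close>

context cyclotomic
begin

text \<open>\<open>unif p\<close> generates the radical of \<open>p A\<close>, the product of the primes above \<open>p\<close>.\<close>

definition unif :: "nat \<Rightarrow> complex" where
  "unif p = (if p dvd n then 1 - zeta (p ^ multiplicity p n) else of_nat p)"

context
  fixes p assumes p: "prime (p::nat)"
begin

lemma ppow_dvd: "p ^ multiplicity p n dvd n"
  by (rule multiplicity_dvd)

lemma unif_in_A: "unif p \<in> A"
  using zeta_divisor_in_A[OF ppow_dvd, of 1] by (auto simp: unif_def)

lemma multiplicity_pos: "p dvd n \<Longrightarrow> multiplicity p n > 0"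
  using p n_pos by (simp add: prime_multiplicity_gt_zero_iff)

lemma ppow_gt_1: "p dvd n \<Longrightarrow> p ^ multiplicity p n > 1"
  using one_less_power[OF prime_gt_1_nat[OF p] multiplicity_pos] .

lemma unif_nonzero: "unif p \<noteq> 0"
proof (cases "p dvd n")
  case True
  then show ?thesis
    using zeta_neq_1[OF ppow_gt_1] by (simp add: unif_def)
qed (use prime_gt_0_nat[OF p] in \<open>simp add: unif_def\<close>)

text \<open>Each of \<open>z\<close> and \<open>z ^ k\<close> is a power of the other, so
  \<open>1 - z\<close> and \<open>1 - z ^ k\<close> divide each other with geometric sums as
  quotients. These quotients are the cyclotomic units.\<close>

lemma unit_one_minus_zeta:
  assumes "p dvd n" "\<not> p dvd k"
  obtains u v where "u \<in> A" "v \<in> A" "u * v = 1" "1 - zeta (p ^ multiplicity p n) ^ k = unif p * u"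
proof -
  define N where "N = p ^ multiplicity p n"
  define z where "z = zeta N"
  have z: "z ^ i \<in> A" for i
    unfolding z_def N_def by (rule zeta_divisor_in_A[OF ppow_dvd])
  have "coprime k N"
    using assms(2) p unfolding N_def by (metis coprime_commute coprime_power_right_iff prime_imp_coprime)
  then obtain l where l: "[k * l = 1] (mod N)"
    using coprime_iff_invertible_nat by auto
  have N0: "N > 0"
    using prime_gt_0_nat[OF p] by (simp add: N_def)
  have zkl: "(z ^ k) ^ l = z"
    using zeta_power_eq_iff[OF N0, of "k * l" 1] l by (simp add: z_def power_mult)
  define u where "u = (\<Sum>i<k. z ^ i)"
  define v where "v = (\<Sum>i<l. (z ^ k) ^ i)"
  have pi: "unif p = 1 - z"
    using assms(1) by (simp add: unif_def z_def N_def)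
  have u: "1 - z ^ k = unif p * u"
    unfolding pi u_def by (rule one_minus_power_factor)
  have "unif p = (1 - z ^ k) * v"
    unfolding pi v_def using one_minus_power_factor[of "z ^ k" l] by (simp add: zkl)
  then have "unif p * (u * v) = unif p * 1"
    by (simp add: u mult_ac)
  then have "u * v = 1"
    using mult_left_cancel[OF unif_nonzero] by blast
  moreover have "u \<in> A" "v \<in> A"
    using z by (auto simp: u_def v_def simp flip: power_mult intro!: A.sum_closed)
  ultimately show ?thesis
    using that u by (simp add: z_def N_def)
qed

text \<open>If \<open>p\<close> divides \<open>n\<close>, the product formula writes
  \<open>p\<close> as a product of differences \<open>1 - z ^ k\<close>, all associated to
  \<open>unif p\<close>; otherwise \<open>unif p\<close> is \<open>p\<close> itself.\<close>

lemma prime_eq_unit_unif_power: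
  obtains e u v where "e > 0" "u \<in> A" "v \<in> A" "u * v = 1" "of_nat p = u * unif p ^ e"
proof (cases "p dvd n")
  case False
  then have "of_nat p = 1 * unif p ^ 1"
    by (simp add: unif_def)
  then show ?thesis
    using that[of 1 1 1] by auto
next
  case True
  define N where "N = p ^ multiplicity p n"
  define U where "U = {k\<in>{1..<N}. \<not> p dvd k}"
  have "\<exists>u v. u \<in> A \<and> v \<in> A \<and> u * v = 1 \<and> 1 - zeta N ^ k = unif p * u" if "k \<in> U" for k
    using unit_one_minus_zeta[OF True, of k] that unfolding U_def N_def by blast
  then obtain u v where uv: "\<And>k. k \<in> U \<Longrightarrow> u k \<in> A \<and> v k \<in> A \<and> u k * v k = 1 \<and> 1 - zeta N ^ k = unif p * u k"
    by metis
  have "of_nat p = (\<Prod>k\<in>U. 1 - zeta N ^ k)"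
    using prod_one_minus_zeta_prime_power[OF p multiplicity_pos[OF True]] by (simp add: U_def N_def)
  also have "\<dots> = (\<Prod>k\<in>U. unif p * u k)"
    using uv by (intro prod.cong) auto
  also have "\<dots> = prod u U * unif p ^ card U"
    by (simp add: prod.distrib)
  finally have "of_nat p = prod u U * unif p ^ card U" .
  moreover have "prod u U * prod v U = 1"
    using uv by (simp flip: prod.distrib)
  moreover have "prod u U \<in> A" "prod v U \<in> A"
    using uv by (auto intro!: A.prod_closed)
  moreover have "1 \<in> U"
    using ppow_gt_1[OF True] prime_gt_1_nat[OF p] by (auto simp: U_def N_def)
  then have "card U > 0"
    by (auto simp: card_gt_0_iff U_def)
  ultimately show ?thesis
    using that by blast
qed

lemma prime_in_unif: "of_nat p \<in> (*) (unif p) ` A"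
proof -
  obtain e u v where *: "e > 0" "u \<in> A" "of_nat p = u * unif p ^ e"
    by (rule prime_eq_unit_unif_power)
  then have "of_nat p = unif p * (u * unif p ^ (e - 1))"
    using power_minus_mult[of e "unif p"] by (simp add: mult_ac)
  then show ?thesis
    using *(2) unif_in_A by (intro image_eqI[of _ _ "u * unif p ^ (e - 1)"]) auto
qed

lemma frobenius_iterate:
  assumes g: "coeffs_in \<int> g"
  shows "poly g \<zeta> ^ (p ^ k) - poly g (\<zeta> ^ (p ^ k)) \<in> (*) (of_nat p) ` A"
proof (induction k)
  case 0
  then show ?case
    by (auto intro: image_eqI[of _ _ 0])
next
  case (Suc k)
  then obtain w where w: "w \<in> A" "poly g \<zeta> ^ (p ^ k) = poly g (\<zeta> ^ (p ^ k)) + of_nat p * w"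
    by (auto simp: algebra_simps)
  have gA: "poly g (\<zeta> ^ (p ^ k)) \<in> A"
    using coeffs_in_mono[OF g A.Ints_subset] by auto
  obtain w1 where w1: "w1 \<in> A" "(poly g (\<zeta> ^ (p ^ k)) + of_nat p * w) ^ p =
      poly g (\<zeta> ^ (p ^ k)) ^ p + (of_nat p * w) ^ p + of_nat p * w1"
    using A.freshmans_dream[OF p gA, of "of_nat p * w"] w(1) by blast
  obtain w2 where w2: "w2 \<in> A" "poly g (\<zeta> ^ (p ^ k)) ^ p = poly g ((\<zeta> ^ (p ^ k)) ^ p) + of_nat p * w2"
    using A.frobenius_poly[OF p g, of "\<zeta> ^ (p ^ k)"] by blast
  have pp: "(of_nat p * w) ^ p = of_nat p * (w * (of_nat p * w) ^ (p - 1))"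
    using prime_gt_0_nat[OF p] by (simp add: power_eq_if)
  have "poly g \<zeta> ^ (p ^ Suc k) = (poly g \<zeta> ^ (p ^ k)) ^ p"
    by (simp add: mult.commute flip: power_mult)
  also have "\<dots> = poly g ((\<zeta> ^ (p ^ k)) ^ p) + of_nat p * (w2 + w * (of_nat p * w) ^ (p - 1) + w1)"
    by (simp only: w(2) w1(2) w2(2) pp) (simp add: algebra_simps)
  also have "(\<zeta> ^ (p ^ k)) ^ p = \<zeta> ^ (p ^ Suc k)"
    by (simp add: mult.commute flip: power_mult)
  finally show ?case
    using w(1) w1(1) w2(1)
    by (intro image_eqI[of _ _ "w2 + w * (of_nat p * w) ^ (p - 1) + w1"] A.add_closed A.mult_closed A.power_closed) auto
qed

text \<open>Take \<open>q = p ^ totient m\<close>, which is 1 modulo \<open>m\<close> by Euler. Then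
  \<open>\<zeta> ^ q\<close> is \<zeta> times a power of \<open>zeta N\<close>, and
  \<open>zeta N\<close> is 1 modulo \<open>unif p\<close>. Iterated Frobenius carries this from
  \<zeta> to all integer polynomials in \<zeta>.\<close>

lemma unif_frobenius:
  obtains q where "q \<ge> 2" "\<And>y. y \<in> A \<Longrightarrow> y ^ q - y \<in> (*) (unif p) ` A"
proof -
  define N where "N = p ^ multiplicity p n"
  define m where "m = n div N"
  have nm: "n = N * m"
    using ppow_dvd by (simp add: m_def N_def)
  then have m0: "m > 0" and N0: "N > 0"
    using n_pos by auto
  have "\<not> p dvd m"
    using multiplicity_decompose[of n p] n_pos prime_gt_1_nat[OF p] by (auto simp: m_def N_def)
  then have "[p ^ totient m = 1] (mod m)"
    using p by (intro euler_theorem) (simp add: prime_imp_coprime)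
  moreover have "p ^ totient m \<ge> 1"
    using prime_gt_0_nat[OF p] by simp
  ultimately obtain l where l: "p ^ totient m = 1 + m * l"
    using cong_le_nat[of 1 "p ^ totient m" m] by (auto simp: mult.commute)
  define q where "q = p ^ totient m"
  have "totient m > 0"
    using m0 by simp
  then have q2: "q \<ge> 2"
    using prime_ge_2_nat[OF p] self_le_power[of p "totient m"] prime_gt_0_nat[OF p] by (simp add: q_def)
  have root: "\<zeta> ^ q - \<zeta> \<in> (*) (unif p) ` A"
  proof -
    have "\<zeta> ^ q = \<zeta> * zeta N ^ l"
      using zeta_divisor[OF N0 m0] by (simp add: q_def l power_add power_mult nm)
    then have *: "\<zeta> ^ q - \<zeta> = (1 - zeta N ^ l) * (- \<zeta>)"
      by (simp add: algebra_simps)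
    have "1 - zeta N ^ l \<in> (*) (unif p) ` A"
    proof (cases "p dvd n")
      case True
      then show ?thesis
        using zeta_divisor_in_A[OF ppow_dvd] one_minus_power_factor[of "zeta N" l]
        by (auto simp: unif_def N_def intro!: imageI A.sum_closed)
    next
      case False
      then have "N = 1"
        using p by (simp add: N_def not_dvd_imp_multiplicity_0)
      then show ?thesis
        using zeta_power_self[of 1] by (auto intro: image_eqI[of _ _ 0])
    qed
    then show ?thesis
      unfolding * using zeta_in_A by (intro A.image_mult_mult) auto
  qed
  have "y ^ q - y \<in> (*) (unif p) ` A" if y: "y \<in> A" for y
  proof -
    obtain g where g: "coeffs_in \<int> g" "y = poly g \<zeta>"
      using y by (rule A_cases)
    have 1: "y ^ q - poly g (\<zeta> ^ q) \<in> (*) (unif p) ` A"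
      using frobenius_iterate[OF g(1), of "totient m"] prime_in_unif
      unfolding g(2) q_def by (rule A.image_mult_trans[rotated])
    have "poly g (\<zeta> ^ q) - poly g \<zeta> \<in> (*) (\<zeta> ^ q - \<zeta>) ` A"
      using coeffs_in_mono[OF g(1) A.Ints_subset] zeta_in_A by (intro A.poly_diff_factor) auto
    then have 2: "poly g (\<zeta> ^ q) - y \<in> (*) (unif p) ` A"
      unfolding g(2) using root by (rule A.image_mult_trans[rotated])
    show ?thesis
      using A.image_mult_add[OF 1 2] by simp
  qed
  then show ?thesis
    using that q2 by blast
qed

end

text \<open>Some positive multiple \<open>d * x\<close> lies in \<open>A\<close>, and the prime
  factors of \<open>d\<close> are removed one at a time: \<open>p\<close> is a unit times a power of
  \<open>unif p\<close>, and this power cancels by \<open>integral_closed_power\<close>.\<close>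

theorem integers_eq_A: "{x \<in> L. algebraic_int x} = A"
proof (intro equalityI subsetI)
  fix x assume "x \<in> A"
  then show "x \<in> {x \<in> L. algebraic_int x}"
    using A_subset_L algebraic_int_A by auto
next
  fix x assume "x \<in> {x \<in> L. algebraic_int x}"
  then have x: "x \<in> L" "A.integral x"
    using A.algebraic_int_imp_integral by auto
  have *: "z \<in> A" if p: "prime p" and z: "A.integral z" "of_nat p * z \<in> A" for p :: nat and z
  proof -
    obtain e u v where e: "u \<in> A" "v \<in> A" "u * v = 1" "of_nat p = u * unif p ^ e"
      by (rule prime_eq_unit_unif_power[OF p])
    obtain q where q: "q \<ge> 2" "\<And>y. y \<in> A \<Longrightarrow> y ^ q - y \<in> (*) (unif p) ` A"
      using unif_frobenius[OF p] by metis
    have "v * (of_nat p * z) \<in> A"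
      using e z(2) by blast
    also have "v * (of_nat p * z) = (u * v) * (unif p ^ e * z)"
      by (simp only: e(4) mult_ac)
    finally have "unif p ^ e * z \<in> A"
      by (simp add: e(3))
    then show ?thesis
      using A.integral_closed_power[OF unif_in_A[OF p] unif_nonzero[OF p] q(2) q(1) z(1)] by blast
  qed
  have "x \<in> A" if "d > 0" "of_nat d * x \<in> A" for d :: nat
    using that
  proof (induction d rule: prime_divisors_induct)
    case (factor p d)
    have "of_nat p * (of_nat d * x) \<in> A"
      using factor.prems(2) by (simp add: mult.assoc)
    then have "of_nat d * x \<in> A"
      using *[OF factor.hyps] A.integral_mult[OF x(2)] by blast
    then show ?case
      using factor by simp
  qed auto
  moreover obtain d where "d > 0" "of_nat d * x \<in> A"
    using x(1) unfolding L_def A_def by (rule adjoin_Rats_denominator)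
  ultimately show "x \<in> A"
    by blast
qed

end

section \<open>The field trace\<close>

lemma complex_ring_simps:
  "carrier complex_ring = UNIV" "monoid.mult complex_ring = (*)" "add complex_ring = (+)"
  "one complex_ring = 1" "ring.zero complex_ring = 0"
  by (simp_all add: ring_of_type_algebra_def)

lemma combine_complex:
  "ring.combine complex_ring Ks Us = (\<Sum>i<min (length Ks) (length Us). Ks ! i * Us ! i)"
proof -
  interpret C: field complex_ring
    by (rule field_from_type_algebra)
  show ?thesis
    by (induction Ks Us rule: C.combine.induct)
      (simp_all add: complex_ring_simps sum.lessThan_Suc_shift del: sum.lessThan_Suc)
qed

context complex_subfield
begin

lemma subfield_complex_ring: "subfield S complex_ring"
  by (simp add: complex_subfield_iff complex_subfield_axioms)

lemma Span_complex:
  "ring.Span complex_ring S Us = {\<Sum>i<length Us. c i * Us ! i | c. \<forall>i<length Us. c i \<in> S}"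
proof -
  interpret C: field complex_ring
    by (rule field_from_type_algebra)
  have "C.Span S Us = {C.combine Ks Us | Ks. length Ks = length Us \<and> set Ks \<subseteq> S}"
    by (rule C.Span_eq_combine_set_length_version[OF subfield_complex_ring]) (simp add: complex_ring_simps)
  also have "\<dots> = {\<Sum>i<length Us. c i * Us ! i | c. \<forall>i<length Us. c i \<in> S}"
  proof (intro equalityI subsetI)
    fix x assume "x \<in> {C.combine Ks Us | Ks. length Ks = length Us \<and> set Ks \<subseteq> S}"
    then obtain Ks where "length Ks = length Us" "set Ks \<subseteq> S" "x = C.combine Ks Us"
      by auto
    then show "x \<in> {\<Sum>i<length Us. c i * Us ! i | c. \<forall>i<length Us. c i \<in> S}"
      by (auto simp: combine_complex intro!: exI[of _ "(!) Ks"])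
  next
    fix x assume "x \<in> {\<Sum>i<length Us. c i * Us ! i | c. \<forall>i<length Us. c i \<in> S}"
    then obtain c where "\<forall>i<length Us. c i \<in> S" "x = (\<Sum>i<length Us. c i * Us ! i)"
      by auto
    then show "x \<in> {C.combine Ks Us | Ks. length Ks = length Us \<and> set Ks \<subseteq> S}"
      by (auto simp: combine_complex intro!: exI[of _ "map c [0..<length Us]"])
  qed
  finally show ?thesis .
qed

lemma independent_complex:
  "ring.independent complex_ring S Us \<longleftrightarrow>
    (\<forall>c. (\<forall>i<length Us. c i \<in> S) \<and> (\<Sum>i<length Us. c i * Us ! i) = 0 \<longrightarrow> (\<forall>i<length Us. c i = 0))"
  (is "_ \<longleftrightarrow> ?R")
proof
  interpret C: field complex_ring
    by (rule field_from_type_algebra)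
  {
    assume ind: "C.independent S Us"
    show ?R
    proof (intro allI impI)
      fix c i assume c: "(\<forall>i<length Us. c i \<in> S) \<and> (\<Sum>i<length Us. c i * Us ! i) = 0"
        and i: "i < length Us"
      have "set (take (length Us) (map c [0..<length Us])) \<subseteq> {ring.zero complex_ring}"
        using c by (intro C.independent_imp_trivial_combine[OF subfield_complex_ring ind])
          (auto simp: combine_complex complex_ring_simps)
      then show "c i = 0"
        using i by (auto simp: complex_ring_simps image_subset_iff)
    qed
  }
  {
    assume R: ?R
    show "C.independent S Us"
    proof (rule C.trivial_combine_imp_independent[OF subfield_complex_ring])
      show "set Us \<subseteq> carrier complex_ring"
        by (simp add: complex_ring_simps)
      fix Ks assume Ks: "set Ks \<subseteq> S" "C.combine Ks Us = ring.zero complex_ring"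
      define c where "c i = (if i < length Ks then Ks ! i else 0)" for i
      have Sc: "\<forall>i<length Us. c i \<in> S"
        using Ks(1) by (auto simp: c_def)
      have "(\<Sum>i<length Us. c i * Us ! i) = (\<Sum>i<min (length Ks) (length Us). Ks ! i * Us ! i)"
        by (rule sum.mono_neutral_cong_right) (auto simp: c_def)
      also have "\<dots> = 0"
        using Ks(2) by (simp add: combine_complex complex_ring_simps)
      finally have sum0: "(\<Sum>i<length Us. c i * Us ! i) = 0" .
      have c0: "\<forall>i<length Us. c i = 0"
        by (rule R[THEN spec, of c, THEN mp, OF conjI[OF Sc sum0]])
      show "set (take (length Us) Ks) \<subseteq> {ring.zero complex_ring}"
      proof
        fix x assume "x \<in> set (take (length Us) Ks)"
        then obtain i where i: "i < length Ks" "i < length Us" "x = Ks ! i"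
          by (auto simp: in_set_conv_nth)
        then have "x = c i"
          by (simp add: c_def)
        then show "x \<in> {ring.zero complex_ring}"
          using c0 i(2) by (simp add: complex_ring_simps)
      qed
    qed
  }
qed

lemma SpanE_complex:
  assumes "y \<in> ring.Span complex_ring S Us"
  obtains c where "\<And>i. i < length Us \<Longrightarrow> c i \<in> S" "y = (\<Sum>i<length Us. c i * Us ! i)"
proof -
  from assms have "\<exists>c. y = (\<Sum>i<length Us. c i * Us ! i) \<and> (\<forall>i<length Us. c i \<in> S)"
    unfolding Span_complex by simp
  then show ?thesis
    using that by auto
qed

lemma SpanI_complex:
  assumes "\<And>i. i < length Us \<Longrightarrow> c i \<in> S" "y = (\<Sum>i<length Us. c i * Us ! i)"
  shows "y \<in> ring.Span complex_ring S Us"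
  unfolding Span_complex using assms by (intro CollectI exI[of _ c]) simp

lemma independentD_complex:
  assumes "ring.independent complex_ring S Us"
    and "\<And>i. i < length Us \<Longrightarrow> c i \<in> S" "(\<Sum>i<length Us. c i * Us ! i) = 0" "i < length Us"
  shows "c i = 0"
  using assms(1)[unfolded independent_complex, THEN spec, of c] assms(2-4) by simp

end

text \<open>\<open>W\<close> is the inverse Vandermonde matrix of the points \<open>S\<close>:
  \<open>W k s\<close> is the coefficient at \<open>X ^ k\<close> of the Lagrange polynomial of
  \<open>s\<close>.\<close>

lemma lagrange_interpolation:
  fixes S :: "complex set"
  assumes "finite S"
  obtains W :: "nat \<Rightarrow> complex \<Rightarrow> complex" where
    "\<And>g k. degree g < card S \<Longrightarrow> coeff g k = (\<Sum>s\<in>S. W k s * poly g s)"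
    "\<And>s t. s \<in> S \<Longrightarrow> t \<in> S \<Longrightarrow> (\<Sum>k<card S. W k s * t ^ k) = (if s = t then 1 else 0)"
proof -
  define l where "l s = smult (inverse (\<Prod>t\<in>S - {s}. s - t)) (\<Prod>t\<in>S - {s}. [:- t, 1:])" for s
  have l: "poly (l s) t = (if s = t then 1 else 0)" if "s \<in> S" "t \<in> S" for s t
    using that assms by (auto simp: l_def poly_prod prod_zero_iff)
  have deg: "degree (l s) < card S" if "s \<in> S" for s
  proof -
    have "degree (\<Prod>t\<in>S - {s}. [:- t, 1:]) \<le> card (S - {s})"
      using degree_prod_sum_le[of "S - {s}" "\<lambda>t. [:- t, 1:]"] assms by simp
    also have "\<dots> < card S"
      using that assms by (intro psubset_card_mono) auto
    finally show ?thesis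
      by (auto simp: l_def intro: le_less_trans[OF degree_smult_le])
  qed
  show ?thesis
  proof (rule that[of "\<lambda>k s. coeff (l s) k"])
    fix g :: "complex poly" and k assume g: "degree g < card S"
    have "g = (\<Sum>s\<in>S. smult (poly g s) (l s))"
    proof (rule poly_eqI_degree[of S])
      fix t assume "t \<in> S"
      then show "poly g t = poly (\<Sum>s\<in>S. smult (poly g s) (l s)) t"
        using assms by (simp add: poly_sum l if_distrib sum.delta cong: if_cong)

    next
      have "degree (\<Sum>s\<in>S. smult (poly g s) (l s)) \<le> card S - 1"
        using deg by (intro degree_sum_le assms le_trans[OF degree_smult_le]) fastforce
      then show "degree (\<Sum>s\<in>S. smult (poly g s) (l s)) < card S"
        using g by linarith
    qed (use g in auto)
    then have "coeff g k = coeff (\<Sum>s\<in>S. smult (poly g s) (l s)) k"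
      by simp
    then show "coeff g k = (\<Sum>s\<in>S. coeff (l s) k * poly g s)"
      by (simp add: coeff_sum mult.commute)
  next
    fix s t assume st: "s \<in> S" "t \<in> S"
    have "(\<Sum>k<card S. coeff (l s) k * t ^ k) = poly (l s) t"
      unfolding poly_altdef using deg[OF st(1)]
      by (intro sum.mono_neutral_right) (auto simp: coeff_eq_0)
    then show "(\<Sum>k<card S. coeff (l s) k * t ^ k) = (if s = t then 1 else 0)"
      using l[OF st] by simp
  qed
qed

section \<open>The trace as a sum of conjugates\<close>

context cyclotomic_subfield
begin

text \<open>Passing through the power basis of \<zeta> and interpolating, the \<open>i\<close>-th
  coordinate of any \<open>y\<close> becomes a fixed combination of its conjugates
  \<open>\<sigma> c y\<close>. In the diagonal sum the factor \<open>\<sigma> c x\<close> splits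
  off, and what remains for each \<open>c\<close> is 1. The length of \<open>Us\<close> is never
  compared with \<open>card H\<close>.\<close>

lemma matrix_trace_eq_sum_sigma:
  assumes x: "x \<in> L"
    and ind: "ring.independent complex_ring K Us" and span: "ring.Span complex_ring K Us = L"
    and A: "\<And>i j. i < length Us \<Longrightarrow> j < length Us \<Longrightarrow> M i j \<in> K"
      "\<And>j. j < length Us \<Longrightarrow> x * Us ! j = (\<Sum>i<length Us. M i j * Us ! i)"
  shows "(\<Sum>i<length Us. M i i) = (\<Sum>c\<in>H. \<sigma> c x)"
proof -
  define d where "d = length Us"
  define h where "h = card H"
  have Us: "Us ! i \<in> L" if "i < d" for i
  proof -
    have "Us ! i = (\<Sum>j<length Us. (if j = i then 1 else 0) * Us ! j)"
      using that by (simp add: d_def if_distrib[of "\<lambda>x. x * _"] cong: if_cong)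
    then have "Us ! i \<in> ring.Span complex_ring K Us"
      by (intro K.SpanI_complex[of _ "\<lambda>j. if j = i then 1 else 0"]) auto
    then show ?thesis
      by (simp add: span)
  qed
  have "\<exists>b. (\<forall>i<d. b i \<in> K) \<and> \<zeta> ^ k = (\<Sum>i<d. b i * Us ! i)" for k
  proof -
    have "\<zeta> ^ k \<in> ring.Span complex_ring K Us"
      using zeta_in_L by (auto simp: span)
    then show ?thesis
      by (rule K.SpanE_complex) (auto simp: d_def)
  qed
  then obtain B where B: "\<And>k i. i < d \<Longrightarrow> B k i \<in> K" "\<And>k. \<zeta> ^ k = (\<Sum>i<d. B k i * Us ! i)"
    by metis
  obtain W where W: "\<And>g k. degree g < card ((\<lambda>c. \<zeta> ^ c) ` H) \<Longrightarrow>
        coeff g k = (\<Sum>s\<in>(\<lambda>c. \<zeta> ^ c) ` H. W k s * poly g s)"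
      "\<And>s t. s \<in> (\<lambda>c. \<zeta> ^ c) ` H \<Longrightarrow> t \<in> (\<lambda>c. \<zeta> ^ c) ` H \<Longrightarrow>
        (\<Sum>k<card ((\<lambda>c. \<zeta> ^ c) ` H). W k s * t ^ k) = (if s = t then 1 else 0)"
    using lagrange_interpolation[of "(\<lambda>c. \<zeta> ^ c) ` H"] by blast
  have ch: "card ((\<lambda>c. \<zeta> ^ c) ` H) = h"
    using inj_on_zeta_H by (simp add: card_image h_def)
  have W1: "coeff g k = (\<Sum>c\<in>H. W k (\<zeta> ^ c) * poly g (\<zeta> ^ c))" if "degree g < h" for g k
    using W(1)[of g k] that inj_on_zeta_H by (simp add: ch sum.reindex)
  have W2: "(\<Sum>k<h. W k (\<zeta> ^ c) * (\<zeta> ^ c') ^ k) = (if c = c' then 1 else 0)" if "c \<in> H" "c' \<in> H" for c c'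
    using W(2)[of "\<zeta> ^ c" "\<zeta> ^ c'"] that inj_on_zeta_H by (simp add: ch inj_on_eq_iff)
  \<comment> \<open>\<open>N i c\<close> plays the part of the conjugates of the trace-dual
    basis.\<close>
  define N where "N i c = (\<Sum>k<h. B k i * W k (\<zeta> ^ c))" for i c
  have coord: "a i = (\<Sum>c\<in>H. N i c * \<sigma> c y)"
    if i: "i < d" and y: "y \<in> L" and a: "\<And>i. i < d \<Longrightarrow> a i \<in> K" "y = (\<Sum>i<d. a i * Us ! i)" for a i y
  proof -
    obtain g where g: "coeffs_in K g" "degree g < h" "y = poly g \<zeta>"
      using y unfolding h_def by (rule L_power_basis)
    have "y = (\<Sum>k<h. coeff g k * \<zeta> ^ k)"
      unfolding g(3) poly_altdef using g(2) by (intro sum.mono_neutral_left) (auto simp: coeff_eq_0)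
    also have "\<dots> = (\<Sum>k<h. \<Sum>i<d. coeff g k * B k i * Us ! i)"
      by (intro sum.cong refl, subst B(2)) (simp add: sum_distrib_left mult_ac)
    also have "\<dots> = (\<Sum>i<d. (\<Sum>k<h. coeff g k * B k i) * Us ! i)"
      by (subst sum.swap) (simp add: sum_distrib_right)
    finally have "(\<Sum>i<d. (a i - (\<Sum>k<h. coeff g k * B k i)) * Us ! i) = 0"
      using a(2) by (simp add: left_diff_distrib sum_subtractf)
    moreover have "a i - (\<Sum>k<h. coeff g k * B k i) \<in> K" if "i < d" for i
      using that a(1) B(1) g(1) by (intro K.diff_closed K.sum_closed K.mult_closed) (auto simp: coeffs_in_def)
    ultimately have "a i - (\<Sum>k<h. coeff g k * B k i) = 0"
      using i K.independentD_complex[OF ind, of "\<lambda>i. a i - (\<Sum>k<h. coeff g k * B k i)" i] by (simp add: d_def)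
    then have "a i = (\<Sum>k<h. coeff g k * B k i)"
      by simp
    also have "\<dots> = (\<Sum>k<h. \<Sum>c\<in>H. B k i * W k (\<zeta> ^ c) * poly g (\<zeta> ^ c))"
      using W1[OF g(2)] by (simp add: sum_distrib_left sum_distrib_right mult_ac)
    also have "\<dots> = (\<Sum>c\<in>H. N i c * poly g (\<zeta> ^ c))"
      by (subst sum.swap) (simp add: N_def sum_distrib_right)
    also have "\<dots> = (\<Sum>c\<in>H. N i c * \<sigma> c y)"
      using sigma_poly_K[OF _ g(1)] by (simp add: g(3))
    finally show ?thesis .
  qed
  have delta: "(\<Sum>i<d. N i c * \<sigma> c (Us ! i)) = 1" if c: "c \<in> H" for c
  proof -
    have "(\<Sum>i<d. N i c * \<sigma> c (Us ! i)) = (\<Sum>i<d. \<Sum>k<h. W k (\<zeta> ^ c) * (B k i * \<sigma> c (Us ! i)))"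
      by (simp add: N_def sum_distrib_left sum_distrib_right mult_ac)
    also have "\<dots> = (\<Sum>k<h. \<Sum>i<d. W k (\<zeta> ^ c) * (B k i * \<sigma> c (Us ! i)))"
      by (rule sum.swap)
    also have "\<dots> = (\<Sum>k<h. W k (\<zeta> ^ c) * (\<Sum>i<d. B k i * \<sigma> c (Us ! i)))"
      by (simp add: sum_distrib_left)
    also have "\<dots> = (\<Sum>k<h. W k (\<zeta> ^ c) * (\<zeta> ^ c) ^ k)"
    proof (intro sum.cong refl arg_cong2[of _ _ _ _ "(*)"])
      fix k
      have BL: "B k i \<in> L" if "i < d" for i
        using B(1)[OF that] K_subset_L by auto
      have "\<sigma> c (\<zeta> ^ k) = (\<Sum>i<d. \<sigma> c (B k i * Us ! i))"
        unfolding B(2)[of k] using BL Us by (intro sigma_sum H_coprime[OF c]) auto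
      also have "\<dots> = (\<Sum>i<d. B k i * \<sigma> c (Us ! i))"
        using BL Us B(1) H_fixes[OF c] by (intro sum.cong) (auto simp: sigma_mult H_coprime[OF c])
      finally show "(\<Sum>i<d. B k i * \<sigma> c (Us ! i)) = (\<zeta> ^ c) ^ k"
        by (simp add: sigma_zeta_power[OF H_coprime[OF c]] power_mult)
    qed
    also have "\<dots> = 1"
      using W2[OF c c] by simp
    finally show ?thesis .
  qed
  have "(\<Sum>i<d. M i i) = (\<Sum>i<d. \<Sum>c\<in>H. N i c * \<sigma> c (x * Us ! i))"
  proof (intro sum.cong refl)
    fix i assume "i \<in> {..<d}"
    then have i: "i < d"
      by simp
    show "M i i = (\<Sum>c\<in>H. N i c * \<sigma> c (x * Us ! i))"
    proof (rule coord[of i _ "\<lambda>j. M j i", OF i L.mult_closed[OF x Us[OF i]]])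
      show "M j i \<in> K" if "j < d" for j
        using that i A(1) unfolding d_def by blast
      show "x * Us ! i = (\<Sum>j<d. M j i * Us ! j)"
        using i A(2) unfolding d_def by blast
    qed
  qed
  also have "\<dots> = (\<Sum>c\<in>H. \<Sum>i<d. N i c * \<sigma> c (x * Us ! i))"
    by (rule sum.swap)
  also have "\<dots> = (\<Sum>c\<in>H. \<sigma> c x * (\<Sum>i<d. N i c * \<sigma> c (Us ! i)))"
    using x Us by (intro sum.cong refl) (auto simp: sum_distrib_left sigma_mult H_coprime mult_ac)
  also have "\<dots> = (\<Sum>c\<in>H. \<sigma> c x)"
    by (simp add: delta)
  finally show ?thesis
    by (simp add: d_def)
qed

text \<open>The power basis of \<zeta> shows that an admissible matrix exists, and the preceding
  lemma that all of them have the same trace, as the \<open>THE\<close> in the definition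
  demands.\<close>

theorem field_trace_eq_sum_sigma:
  assumes x: "x \<in> L"
  shows "field_trace L K x = (\<Sum>c\<in>H. \<sigma> c x)"
proof -
  define Us where "Us = map (\<lambda>k. \<zeta> ^ k) [0..<card H]"
  have Us: "length Us = card H" "\<And>i. i < card H \<Longrightarrow> Us ! i = \<zeta> ^ i"
    by (auto simp: Us_def)
  have coeff: "coeff (\<Sum>k<card H. monom (c k) k) i = (if i < card H then c i else 0)" for c :: "nat \<Rightarrow> complex" and i
    by (simp add: coeff_sum)
  have deg: "degree (\<Sum>k<card H. monom (c k) k) < card H" for c :: "nat \<Rightarrow> complex"
  proof -
    have "degree (\<Sum>k<card H. monom (c k) k) \<le> card H - 1"
      by (intro degree_le) (use coeff[of c] in auto)
    then show ?thesis
      using card_H_pos by linarith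
  qed
  have ind: "ring.independent complex_ring K Us"
    unfolding K.independent_complex Us(1)
  proof (intro allI impI)
    fix c i assume c: "(\<forall>i<card H. c i \<in> K) \<and> (\<Sum>i<card H. c i * Us ! i) = 0" and i: "i < card H"
    have "(\<Sum>k<card H. monom (c k) k) = 0"
    proof (rule power_basis_independent[OF _ deg])
      show "coeffs_in K (\<Sum>k<card H. monom (c k) k)"
        using c by (auto simp: coeffs_in_def coeff)
      show "poly (\<Sum>k<card H. monom (c k) k) \<zeta> = 0"
        using c by (simp add: poly_sum poly_monom Us(2))
    qed
    then show "c i = 0"
      using coeff[of c i] i by simp
  qed
  have span: "ring.Span complex_ring K Us = L"
    unfolding K.Span_complex Us(1)
  proof (intro equalityI subsetI)
    fix y assume "y \<in> {\<Sum>i<card H. c i * Us ! i | c. \<forall>i<card H. c i \<in> K}"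
    then obtain c where "\<forall>i<card H. c i \<in> K" "y = (\<Sum>i<card H. c i * Us ! i)"
      by blast
    then show "y \<in> L"
      using K_subset_L zeta_in_L by (auto simp: Us(2) intro!: L.sum_closed)
  next
    fix y assume "y \<in> L"
    then obtain g where g: "coeffs_in K g" "degree g < card H" "y = poly g \<zeta>"
      by (rule L_power_basis)
    have "y = (\<Sum>i<card H. coeff g i * \<zeta> ^ i)"
      unfolding g(3) poly_altdef using g(2) by (intro sum.mono_neutral_left) (auto simp: coeff_eq_0)
    also have "\<dots> = (\<Sum>i<card H. coeff g i * Us ! i)"
      by (simp add: Us(2))
    finally show "y \<in> {\<Sum>i<card H. c i * Us ! i | c. \<forall>i<card H. c i \<in> K}"
      using g(1) unfolding coeffs_in_def by blast
  qed
  have "\<exists>a. (\<forall>i<length Us. a i \<in> K) \<and> x * Us ! j = (\<Sum>i<length Us. a i * Us ! i)" if "j < length Us" for j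
  proof -
    have "x * Us ! j \<in> ring.Span complex_ring K Us"
      using x zeta_in_L that unfolding span by (auto simp: Us)
    then show ?thesis
      by (rule K.SpanE_complex) auto
  qed
  then obtain a where a: "\<And>j i. j < length Us \<Longrightarrow> i < length Us \<Longrightarrow> a j i \<in> K"
    "\<And>j. j < length Us \<Longrightarrow> x * Us ! j = (\<Sum>i<length Us. a j i * Us ! i)"
    by metis
  show ?thesis
    unfolding field_trace_def
  proof (rule the_equality)
    have "(\<Sum>c\<in>H. \<sigma> c x) = (\<Sum>i<length Us. a i i)"
      using matrix_trace_eq_sum_sigma[OF x ind span, of "\<lambda>i j. a j i"] a by simp
    then show "\<exists>Us A. ring.independent complex_ring K Us \<and> ring.Span complex_ring K Us = L \<and>
        (\<forall>i<length Us. \<forall>j<length Us. A i j \<in> K) \<and>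
        (\<forall>j<length Us. x * Us ! j = (\<Sum>i<length Us. A i j * Us ! i)) \<and>
        (\<Sum>c\<in>H. \<sigma> c x) = (\<Sum>i<length Us. A i i)"
      using ind span a by (intro exI[of _ Us] exI[of _ "\<lambda>i j. a j i"]) simp
  next
    fix t assume "\<exists>Us A. ring.independent complex_ring K Us \<and> ring.Span complex_ring K Us = L \<and>
        (\<forall>i<length Us. \<forall>j<length Us. A i j \<in> K) \<and>
        (\<forall>j<length Us. x * Us ! j = (\<Sum>i<length Us. A i j * Us ! i)) \<and>
        t = (\<Sum>i<length Us. A i i)"
    then show "t = (\<Sum>c\<in>H. \<sigma> c x)"
      using matrix_trace_eq_sum_sigma[OF x] by blast
  qed
qed

end

section \<open>The Galois group of the cyclotomic field over a field of given conductor\<close>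

text \<open>With \<open>c = 1 + p t\<close> the \<open>i\<close>-th term is \<open>1 + i p t\<close>
  modulo the square of \<open>p\<close>, and for odd \<open>p\<close> the sum of the
  \<open>i\<close> below \<open>p\<close> is a multiple of \<open>p\<close>. For
  \<open>p = 2\<close> the sum is \<open>1 + c\<close>, which needs \<open>c\<close> modulo
  4.\<close>

lemma not_prime_square_dvd_geometric_sum:
  fixes c :: int
  assumes p: "prime p" and c: "[c = 1] (mod int p)" and c2: "p = 2 \<Longrightarrow> [c = 1] (mod 4)"
  shows "[(\<Sum>i<p. c ^ i) = int p] (mod int p * int p)"
proof (cases "p = 2")
  case True
  have "(\<Sum>i<2. c ^ i) = 1 + c"
    by (simp add: numeral_2_eq_2)
  moreover have "[1 + c = 1 + 1] (mod 4)"
    using c2[OF True] by (intro cong_add) auto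
  ultimately show ?thesis
    using True by simp
next
  case False
  then have odd: "odd p"
    using p primes_dvd_imp_eq two_is_prime_nat by blast
  obtain t where t: "c = 1 + int p * t"
    using c cong_iff_lin[of 1 c "int p"] cong_sym by auto
  have "[c ^ i = 1 + int i * (int p * t)] (mod int p * int p)" for i
  proof (induction i)
    case (Suc i)
    have "[c * c ^ i = c * (1 + int i * (int p * t))] (mod int p * int p)"
      using Suc by (rule cong_scalar_left)
    moreover have "c * (1 + int i * (int p * t)) = 1 + int (Suc i) * (int p * t) + (int p * int p) * (int i * t * t)"
      by (simp add: t algebra_simps)
    ultimately show ?case
      by (simp add: cong_def)
  qed simp
  then have "[(\<Sum>i<p. c ^ i) = (\<Sum>i<p. 1 + int i * (int p * t))] (mod int p * int p)"
    by (rule cong_sum)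
  moreover have "(\<Sum>i<p. 1 + int i * (int p * t)) = int p + (\<Sum>i<p. int i) * (int p * t)"
    by (simp add: sum.distrib sum_distrib_right)
  moreover have "int p dvd (\<Sum>i<p. int i)"
  proof -
    have "2 * (\<Sum>i<p. i) = p * (p - 1)"
      using Sum_Ico_nat[of 0 p] odd by (simp add: lessThan_atLeast0)
    then have "p dvd 2 * (\<Sum>i<p. i)"
      by simp
    then have "p dvd (\<Sum>i<p. i)"
      using odd p by (metis coprime_dvd_mult_right_iff coprime_right_2_iff_odd)
    then have "int p dvd int (\<Sum>i<p. i)"
      by (simp only: int_dvd_int_iff)
    then show ?thesis
      by simp
  qed
  then have "[int p + (\<Sum>i<p. int i) * (int p * t) = int p + 0] (mod int p * int p)"
    by (intro cong_add cong_refl) (auto simp: cong_0_iff elim!: dvdE)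
  ultimately show ?thesis
    using cong_trans by (metis add.right_neutral)
qed

text \<open>In \<open>c ^ p - 1 = (c - 1) * (\<Sum>i<p. c ^ i)\<close> the second factor contains
  \<open>p\<close> exactly once, so only one power of \<open>p\<close> is lost in passing to
  \<open>c - 1\<close>.\<close>

lemma cong_1_of_power_prime_cong_1:
  fixes c :: int
  assumes p: "prime p" and s: "s > 0" "p = 2 \<Longrightarrow> s > 1"
    and c: "[c = 1] (mod int p ^ s)" and cp: "[c ^ p = 1] (mod int p ^ (s + 2))"
  shows "[c = 1] (mod int p ^ (s + 1))"
proof -
  have "[c = 1] (mod int p)"
    using c s(1) by (metis cong_dvd_modulus dvd_power)
  moreover have "[c = 1] (mod 4)" if "p = 2"
  proof -
    have "(2::int) ^ 2 dvd int p ^ s"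
      using s(2)[OF that] that by (intro le_imp_power_dvd[of 2 s 2, THEN dvd_trans]) auto
    then show ?thesis
      using c by (simp add: cong_dvd_modulus)
  qed
  ultimately have "[(\<Sum>i<p. c ^ i) = int p] (mod int p * int p)"
    using not_prime_square_dvd_geometric_sum[OF p] by blast
  then obtain t where t: "(\<Sum>i<p. c ^ i) = int p * (1 + int p * t)"
    using cong_iff_lin[of "int p" "\<Sum>i<p. c ^ i" "int p * int p"] cong_sym by (auto simp: algebra_simps)
  have "int p * int p ^ (s + 1) dvd c ^ p - 1"
    using cp by (simp add: cong_iff_dvd_diff)
  also have "c ^ p - 1 = (c - 1) * (\<Sum>i<p. c ^ i)"
    by (rule power_diff_1_eq)
  also have "\<dots> = int p * ((1 + int p * t) * (c - 1))"
    by (simp add: t)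
  finally have "int p ^ (s + 1) dvd (1 + int p * t) * (c - 1)"
    using prime_gt_0_nat[OF p] by simp
  moreover have "coprime (int p) (1 + int p * t)"
    by (metis add.commute coprime_1_right coprime_mod_right_iff mod_mult_self2 mult.commute
      coprime_iff_gcd_eq_1 gcd_add_mult)
  then have "coprime (int p ^ (s + 1)) (1 + int p * t)"
    by simp
  ultimately have "int p ^ (s + 1) dvd c - 1"
    by (simp add: coprime_dvd_mult_right_iff)
  then show ?thesis
    by (simp add: cong_iff_dvd_diff)
qed

section \<open>Consequences of the minimality of the conductor\<close>

locale conductor_subfield = cyclotomic_subfield +
  assumes minimal: "k > 0 \<Longrightarrow> K \<subseteq> adjoin \<rat> (zeta k) \<Longrightarrow> n \<le> k"

context cyclotomic_subfield
begin

lemma power_in_H: "c \<in> H \<Longrightarrow> c ^ j mod n \<in> H"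
proof (induction j)
  case 0
  then show ?case
    using one_in_H by simp
next
  case (Suc j)
  have "c * (c ^ j mod n) mod n \<in> H"
    using Suc by (intro mult_in_H) auto
  then show ?case
    by (simp add: mod_mult_right_eq)
qed

definition I :: "nat \<Rightarrow> nat set" where
  "I p = {c \<in> H. [c = 1] (mod n div p ^ multiplicity p n)}"

lemma finite_I [simp, intro]: "finite (I p)"
  by (simp add: I_def)

lemma one_in_I: "Suc 0 mod n \<in> I p"
proof -
  have "n div p ^ multiplicity p n dvd n"
    by (metis dvd_div_mult_self dvd_triv_left multiplicity_dvd)
  then have "[Suc 0 mod n = 1] (mod n div p ^ multiplicity p n)"
    using cong_dvd_modulus_nat[of "Suc 0 mod n" 1 n] by (simp add: cong_def)
  then show ?thesis
    using one_in_H by (simp add: I_def)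
qed

end

context conductor_subfield
begin

text \<open>Otherwise all elements of \<open>K\<close> would be fixed by the group belonging to the
  field of level \<open>n div p\<close>, hence lie in that field by \<open>fixed_field\<close>,
  against the minimality of \<open>n\<close>.\<close>

lemma kernel_not_subset_H:
  assumes p: "prime p" "p dvd n"
  obtains c where "coprime c n" "[c = 1] (mod n div p)" "c mod n \<notin> H"
proof -
  define N where "N = n div p"
  have nN: "n = N * p"
    using p(2) by (simp add: N_def)
  then have N0: "N > 0"
    using n_pos by auto
  define K' where "K' = adjoin \<rat> (zeta N)"
  have zN: "zeta N = \<zeta> ^ p"
    unfolding nN using N0 prime_gt_0_nat[OF p(1)] by (simp add: zeta_divisor)
  interpret K': complex_subfield K'
    unfolding K'_def by (rule complex_subfield_adjoin_root_of_unity[OF N0]) (simp add: N0)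
  have zK': "zeta N \<in> K'"
    unfolding K'_def by (rule complex_subring.adjoin_generator[OF complex_subring_Rats])
  have "K' \<subseteq> L"
    unfolding K'_def using zeta_in_L L.Rats_subset zN by (intro adjoin_subset) (auto intro: L.complex_subring_axioms)
  then interpret C: cyclotomic_subfield n K'
    by unfold_locales
  have "\<not> C.H \<subseteq> H"
  proof
    assume sub: "C.H \<subseteq> H"
    have "K \<subseteq> K'"
    proof
      fix x assume x: "x \<in> K"
      show "x \<in> K'"
        using x K_subset_L sub H_fixes by (intro C.fixed_field) auto
    qed
    then have "n \<le> N"
      using minimal[OF N0] by (simp add: K'_def)
    then show False
      using nN N0 prime_gt_1_nat[OF p(1)] by simp
  qed
  then obtain c where c: "c \<in> C.H" "c \<notin> H"
    by auto
  have "\<zeta> ^ (c * p) = zeta N"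
    using C.H_fixes[OF c(1) zK'] sigma_zeta_power[OF C.H_coprime[OF c(1)], of p] zN by simp
  then have "zeta N ^ c = zeta N ^ 1"
    by (simp add: zN mult.commute flip: power_mult)
  then have "[c = 1] (mod N)"
    using zeta_power_eq_iff[OF N0] by blast
  then show ?thesis
    using that[of c] c C.H_coprime[OF c(1)] C.H_less[OF c(1)] by (simp add: N_def)
qed

text \<open>
  The kernel of the reduction modulo \<open>n / p\<close> is cyclic of prime order if \<open>p\<close> divides \<open>n / p\<close>, so
  it meets \<open>H\<close> trivially.
\<close>

lemma kernel_Int_H:
  assumes p: "prime p" and pp: "p dvd n div p" "p dvd n"
    and c: "c \<in> H" "[c = 1] (mod n div p)"
  shows "[c = 1] (mod n)"
proof (rule ccontr)
  assume neq: "\<not> [c = 1] (mod n)"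
  define N where "N = n div p"
  have nN: "n = N * p"
    using pp(2) by (simp add: N_def)
  have NN: "n dvd N * N"
  proof -
    obtain t where "N = p * t"
      using pp(1) unfolding N_def by (rule dvdE)
    then have "N * N = n * t"
      unfolding nN by simp
    then show ?thesis
      by (rule dvdI)
  qed
  have pos: "d \<ge> 1" if "coprime d n" for d
  proof (rule ccontr)
    assume "\<not> d \<ge> 1"
    then have "d = 0"
      by simp
    then have "n = 1"
      using that by simp
    then show False
      using pp(2) prime_gt_1_nat[OF p] by simp
  qed
  obtain k where "c = k * N + 1"
    using c(2) cong_le_nat[OF pos[OF H_coprime[OF c(1)]], of N] unfolding N_def by blast
  then have k: "c = 1 + k * N"
    by simp
  have "\<not> p dvd k"
  proof
    assume "p dvd k"
    then obtain k2 where "k = p * k2"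
      by (rule dvdE)
    then have "k * N = n * k2"
      unfolding nN by simp
    then have "n dvd k * N"
      by (rule dvdI)
    then have "[1 + k * N = 1 + 0] (mod n)"
      by (intro cong_add cong_refl) (simp add: cong_0_iff)
    then show False
      using neq k by simp
  qed
  then have "coprime k p"
    using prime_imp_coprime[OF p] coprime_commute by blast
  then obtain k' where k': "[k * k' = 1] (mod p)"
    using coprime_iff_invertible_nat by auto
  \<comment> \<open>As \<open>n\<close> divides \<open>N * N\<close>, powers act linearly on the
    coefficient of \<open>N\<close>. With \<open>k'\<close> inverse to \<open>k\<close> modulo
    \<open>p\<close>, the exponent \<open>k' * l\<close> therefore turns \<open>c\<close> into any
    prescribed \<open>1 + l * N\<close>.\<close>
  have pow: "[c ^ j = 1 + j * k * N] (mod n)" for j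
  proof (induction j)
    case (Suc j)
    have "[c * c ^ j = c * (1 + j * k * N)] (mod n)"
      using Suc by (rule cong_scalar_left)
    moreover have "c * (1 + j * k * N) = 1 + Suc j * k * N + N * N * (j * k * k)"
      by (simp add: k algebra_simps)
    moreover have "[1 + Suc j * k * N + N * N * (j * k * k) = 1 + Suc j * k * N + 0] (mod n)"
      using NN by (intro cong_add cong_refl) (simp add: cong_0_iff)
    ultimately show ?case
      using cong_trans by (metis add.right_neutral power_Suc)
  qed simp
  obtain d where d: "coprime d n" "[d = 1] (mod N)" "d mod n \<notin> H"
    using kernel_not_subset_H[OF p pp(2)] by (auto simp: N_def)
  obtain l where "d = l * N + 1"
    using d(2) cong_le_nat[OF pos[OF d(1)], of N] by blast
  then have l: "d = 1 + l * N"
    by simp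
  have "[k' * l * k = l] (mod p)"
    using cong_scalar_left[OF k', of l] by (simp add: mult_ac)
  then have "[k' * l * k * N = l * N] (mod n)"
    unfolding nN cong_def by (metis mult.commute mult_mod_right)
  then have "[1 + k' * l * k * N = 1 + l * N] (mod n)"
    by (intro cong_add cong_refl)
  then have "[c ^ (k' * l) = d] (mod n)"
    using pow[of "k' * l"] unfolding l by (rule cong_trans[rotated])
  then have "d mod n \<in> H"
    using power_in_H[OF c(1), of "k' * l"] by (simp add: cong_def)
  then show False
    using d(3) by simp
qed

text \<open>Descending induction on \<open>s\<close>. At \<open>s + 1 = a\<close> the element lies
  in the kernel of reduction modulo \<open>n div p\<close>, which meets \<open>H\<close> trivially.
  Below that, \<open>c ^ p\<close> is 1 modulo \<open>p ^ (s + 1)\<close>, hence trivial by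
  induction; then \<open>c\<close> itself is 1 modulo \<open>p ^ (s + 1)\<close>, and induction
  applies again.\<close>

lemma higher_ramification_trivial:
  assumes p: "prime p" and s: "s > 0" "p = 2 \<Longrightarrow> s > 1" "s \<le> multiplicity p n"
    and c: "c \<in> H" "[c = 1] (mod p ^ s)" "[c = 1] (mod n div p ^ multiplicity p n)"
  shows "[c = 1] (mod n)"
proof -
  define a where "a = multiplicity p n"
  define m where "m = n div p ^ a"
  have nm: "n = p ^ a * m"
    using multiplicity_dvd[of p n] by (simp add: m_def a_def)
  have "\<not> p dvd m"
    using multiplicity_decompose[of n p] n_pos prime_gt_1_nat[OF p] by (auto simp: m_def a_def)
  then have cop: "coprime (p ^ k) m" for k
    using p by (simp add: prime_imp_coprime)
  show ?thesis
    using s c unfolding a_def[symmetric] m_def[symmetric]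
  proof (induction "a - s" arbitrary: s c rule: less_induct)
    case less
    show ?case
    proof (cases "s = a")
      case True
      then show ?thesis
        using coprime_cong_mult_nat[OF _ less.prems(6) cop, of a] less.prems(5) by (simp flip: nm)
    next
      case False
      then have sa: "s < a"
        using less.prems by simp
      show ?thesis
      proof (cases "s + 1 = a")
        case True
        have n1: "n = p * (p ^ s * m)"
          by (simp add: nm True[symmetric] mult.assoc)
        then have div: "n div p = p ^ s * m"
          using prime_gt_0_nat[OF p] by simp
        have "[c = 1] (mod p ^ s * m)"
          using less.prems coprime_cong_mult_nat[OF _ _ cop] by simp
        then show ?thesis
        proof (intro kernel_Int_H[OF p _ _ less.prems(4)])
          show "p dvd n div p"
            unfolding div using less.prems(1) by (intro dvd_mult2 dvd_power) simp
          show "p dvd n"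
            using n1 by (rule dvdI)
        qed (simp add: div)
      next
        case False
        then have sa2: "s + 2 \<le> a"
          using sa by simp
        define c' where "c' = c ^ p mod n"
        have c'H: "c' \<in> H"
          unfolding c'_def using less.prems by (intro power_in_H)
        have c'c: "[c' = c ^ p] (mod k)" if "k dvd n" for k
          using that by (simp add: c'_def cong_def mod_mod_cancel)
        have psn: "p ^ (s + 1) dvd n" "m dvd n" "p ^ (s + 2) dvd n"
          using sa2 unfolding nm by (auto intro!: dvd_mult2 le_imp_power_dvd simp del: power_Suc)
        have "[c ^ p = 1] (mod m)"
          using cong_pow[OF less.prems(6), of p] by simp
        then have m': "[c' = 1] (mod m)"
          using cong_trans[OF c'c[OF psn(2)]] by blast
        have "[c ^ p = 1] (mod p ^ (s + 1))"
        proof -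
          have "p ^ (s + 1) dvd (p ^ s) * p"
            by simp
          have int_c: "[int c = 1] (mod int p ^ s)"
            using less.prems(5) by (metis cong_int_iff of_nat_1 of_nat_power)
          then have "int p ^ s dvd int c - 1"
            by (simp add: cong_iff_dvd_diff)
          moreover have "[(\<Sum>i<p. int c ^ i) = (\<Sum>i<p. 1)] (mod int p)"
            using cong_dvd_modulus[OF int_c, of "int p"] less.prems(1)
            by (intro cong_sum) (metis cong_pow dvd_power power_one)
          then have "int p dvd (\<Sum>i<p. int c ^ i)"
            by (simp add: cong_def dvd_eq_mod_eq_0)
          ultimately have "int p ^ s * int p dvd (int c - 1) * (\<Sum>i<p. int c ^ i)"
            by (rule mult_dvd_mono)
          then have "int p ^ (s + 1) dvd int c ^ p - 1"
            by (simp add: power_diff_1_eq mult.commute)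
          then have "[int (c ^ p) = int 1] (mod int (p ^ (s + 1)))"
            by (simp add: cong_iff_dvd_diff)
          then show ?thesis
            by (simp only: cong_int_iff)
        qed
        then have "[c' = 1] (mod p ^ (s + 1))"
          using cong_trans[OF c'c[OF psn(1)]] by blast
        then have "[c' = 1] (mod n)"
          using less.hyps[of "s + 1" c'] less.prems sa2 c'H m' by auto
        then have "[c' = 1] (mod p ^ (s + 2))"
          using psn(3) by (rule cong_dvd_modulus_nat)
        then have "[c ^ p = 1] (mod p ^ (s + 2))"
          using cong_trans[OF cong_sym[OF c'c[OF psn(3)]]] by blast
        then have "[int c ^ p = 1] (mod int p ^ (s + 2))"
          by (metis cong_int_iff of_nat_1 of_nat_power)
        moreover have "[int c = 1] (mod int p ^ s)"
          using less.prems(5) by (metis cong_int_iff of_nat_1 of_nat_power)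
        ultimately have "[int c = 1] (mod int p ^ (s + 1))"
          using cong_1_of_power_prime_cong_1[OF p less.prems(1,2)] by blast
        then have "[c = 1] (mod p ^ (s + 1))"
          by (metis cong_int_iff of_nat_1 of_nat_power)
        then show ?thesis
          using less.hyps[of "s + 1" c] less.prems sa2 by auto
      qed
    qed
  qed
qed

end

context cyclotomic
begin

abbreviation (input) m :: "nat \<Rightarrow> nat" where "m p \<equiv> n div p ^ multiplicity p n"

lemma n_eq: "n = p ^ multiplicity p n * m p"
  using multiplicity_dvd[of p n] by simp

lemma m_dvd: "m p dvd n"
  by (rule dvdI[of _ _ "p ^ multiplicity p n"]) (simp add: multiplicity_dvd)

lemma m_pos: "m p > 0"
  using n_eq[of p] n_pos by (metis gr0I mult_0_right)

lemma not_dvd_m: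
  assumes "prime p"
  shows "\<not> p dvd m p"
  using multiplicity_decompose[of n p] n_pos prime_gt_1_nat[OF assms] by auto

lemma coprime_ppow_m: "prime p \<Longrightarrow> coprime (p ^ k) (m p)"
  using not_dvd_m[of p] by (simp add: prime_imp_coprime)

lemma multiplicity_0: "\<not> p dvd n \<Longrightarrow> multiplicity p n = 0"
  by (rule not_dvd_imp_multiplicity_0)

end

context cyclotomic_subfield
begin

lemma I_subset_H: "I p \<subseteq> H"
  by (auto simp: I_def)

lemma I_trivial:
  assumes "\<not> p dvd n"
  shows "I p = {Suc 0 mod n}"
proof -
  have "c = Suc 0 mod n" if "c \<in> I p" for c
    using that H_less[of c] by (simp add: I_def multiplicity_0[OF assms] cong_def)
  then show ?thesis
    using one_in_I[of p] by blast
qed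

end

context conductor_subfield
begin

text \<open>The quotient \<open>e\<close> of \<open>c\<close> by \<open>d\<close> in
  \<open>H\<close> is 1 modulo \<open>p ^ s\<close> and modulo \<open>m p\<close>, hence trivial.
  With \<open>s = 1\<close> for odd \<open>p\<close> and \<open>s = 2\<close> for
  \<open>p = 2\<close> this embeds \<open>I p\<close> into the units modulo \<open>p\<close> or
  4.\<close>

lemma I_cong_imp_eq:
  assumes p: "prime p" and s: "s > 0" "p = 2 \<Longrightarrow> s > 1" "s \<le> multiplicity p n"
    and cd: "c \<in> I p" "d \<in> I p" "[c = d] (mod p ^ s)"
  shows "c = d"
proof -
  have H: "c \<in> H" "d \<in> H"
    using cd I_subset_H by auto
  then have "c \<in> (\<lambda>e. d * e mod n) ` H"
    using bij_betw_mult_H[of d] by (simp add: bij_betw_def)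
  then obtain e where e: "e \<in> H" "c = d * e mod n"
    by auto
  then have de: "[d * e = c] (mod n)"
    by (simp add: cong_def)
  have psn: "p ^ s dvd n"
    using s(3) by (rule multiplicity_dvd')
  have "[d * e = d * 1] (mod p ^ s)"
    using cong_trans[OF cong_dvd_modulus_nat[OF de psn] cd(3)] by simp
  moreover have "coprime d (p ^ s)"
    using H_coprime[OF H(2)] psn by (meson coprime_divisors dvd_refl)
  ultimately have 1: "[e = 1] (mod p ^ s)"
    by (simp only: cong_mult_lcancel_nat)
  have d1: "[d = 1] (mod m p)" and c1: "[c = 1] (mod m p)"
    using cd by (simp_all add: I_def)
  have "[d * e = 1 * e] (mod m p)"
    using d1 by (rule cong_scalar_right)
  then have "[e = d * e] (mod m p)"
    by (simp add: cong_sym)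
  also have "[d * e = c] (mod m p)"
    using de m_dvd by (rule cong_dvd_modulus_nat)
  also note c1
  finally have "[e = 1] (mod m p)" .
  then have "[e = 1] (mod n)"
    using higher_ramification_trivial[OF p s e(1) 1] by blast
  then have "[d * e = d * 1] (mod n)"
    by (rule cong_scalar_left)
  then have "[c = d] (mod n)"
    using de by (metis cong_sym cong_trans mult.right_neutral)
  then show ?thesis
    using H_less[OF H(1)] H_less[OF H(2)] by (simp add: cong_def)
qed

text \<open>For odd \<open>N\<close> a unit modulo \<open>2 * N\<close> is determined by its residue
  modulo \<open>N\<close>, so the kernel that must not lie in \<open>H\<close> would be
  trivial.\<close>

lemma four_dvd_n:
  assumes "2 dvd n"
  shows "4 dvd n"
proof (rule ccontr)
  assume n4: "\<not> 4 dvd n"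
  obtain N where N: "n = 2 * N"
    using assms by (rule dvdE)
  have "odd N"
    using n4 N by (auto elim!: evenE)
  obtain c where c: "coprime c n" "[c = 1] (mod n div 2)" "c mod n \<notin> H"
    using kernel_not_subset_H[OF two_is_prime_nat assms] by blast
  have "odd c"
    using c(1) N by (auto simp: coprime_right_2_iff_odd)
  then have "[c = 1] (mod 2)"
    by (simp add: cong_def mod_2_eq_odd)
  moreover have "[c = 1] (mod N)"
    using c(2) N by simp
  moreover have "coprime 2 N"
    using \<open>odd N\<close> by simp
  ultimately have "[c = 1] (mod 2 * N)"
    by (rule coprime_cong_mult_nat)
  then have "c mod n = Suc 0 mod n"
    by (simp add: N cong_def)
  then show False
    using c(3) one_in_H by simp
qed

lemma two_le_multiplicity_2: "2 dvd n \<Longrightarrow> 2 \<le> multiplicity 2 n"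
  using four_dvd_n power_dvd_iff_le_multiplicity[of n 2 2] n_pos by simp

lemma odd_H: "2 dvd n \<Longrightarrow> c \<in> H \<Longrightarrow> odd c"
  using H_coprime[of c] by (metis coprime_common_divisor_nat even_Suc odd_one dvd_refl One_nat_def)

text \<open>The embedding into the nonzero residues modulo \<open>p\<close> gives
  \<open>0 < card (I p) < p\<close>.\<close>

lemma prime_not_dvd_card_I:
  assumes p: "prime p" "p \<noteq> 2"
  shows "\<not> p dvd card (I p)"
proof (cases "p dvd n")
  case False
  then show ?thesis
    using prime_gt_1_nat[OF p(1)] by (simp add: I_trivial)
next
  case True
  have mult: "1 \<le> multiplicity p n"
    using multiplicity_pos[OF p(1) True] by simp
  have "inj_on (\<lambda>c. c mod p) (I p)"
    using I_cong_imp_eq[OF p(1), of 1] mult p(2) by (intro inj_onI) (simp add: cong_def)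
  moreover have "(\<lambda>c. c mod p) ` I p \<subseteq> {1..<p}"
  proof
    fix r assume "r \<in> (\<lambda>c. c mod p) ` I p"
    then obtain c where c: "c \<in> H" "r = c mod p"
      using I_subset_H by auto
    have "\<not> p dvd c"
      using H_coprime[OF c(1)] True p(1) by (meson coprime_common_divisor not_prime_unit)
    then show "r \<in> {1..<p}"
      using c(2) prime_gt_0_nat[OF p(1)] by (auto simp: dvd_eq_mod_eq_0 Suc_le_eq)
  qed
  ultimately have "card (I p) \<le> card {1..<p}"
    by (metis card_image card_mono finite_atLeastLessThan)
  then have "card (I p) < p"
    using prime_gt_0_nat[OF p(1)] by simp
  moreover have "card (I p) > 0"
    using one_in_I[of p] by (auto simp: card_gt_0_iff)
  ultimately show ?thesis
    by (auto dest: dvd_imp_le)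
qed

text \<open>\<open>I 2\<close> embeds into the residues 1 and 3 modulo 4, so it has even order only
  if it contains a single further element \<open>s\<close>, with residue 3; its square is then the
  identity.\<close>

lemma I_2_cases:
  assumes "even (card (I 2))"
  obtains s where "s \<in> H" "s \<noteq> Suc 0 mod n" "I 2 = {Suc 0 mod n, s}" "[s = 1] (mod m 2)"
    "[s * s = 1] (mod n)" "3 \<le> multiplicity 2 n" "[s + 1 = 0] (mod 2 ^ (multiplicity 2 n - 1))"
proof -
  have two: "prime (2::nat)"
    by simp
  have "2 dvd n"
    using assms I_trivial[of 2] by (rule_tac ccontr) simp
  note e2 = two_le_multiplicity_2[OF this] and odd = odd_H[OF this]
  have I4: "c = d" if "c \<in> I 2" "d \<in> I 2" "c mod 4 = d mod 4" for c d
    using I_cong_imp_eq[OF two, of 2 c d] that e2 by (simp add: cong_def)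
  have mod4: "c mod 4 = 1 \<or> c mod 4 = 3" if "c \<in> H" for c
    using odd[OF that] by presburger
  have "\<exists>s\<in>I 2. s \<noteq> Suc 0 mod n"
  proof (rule ccontr)
    assume "\<not> (\<exists>s\<in>I 2. s \<noteq> Suc 0 mod n)"
    then have "I 2 = {Suc 0 mod n}"
      using one_in_I[of 2] by blast
    then have "card (I 2) = 1"
      by simp
    then show False
      using assms by simp
  qed
  then obtain s where s: "s \<in> I 2" "s \<noteq> Suc 0 mod n"
    by blast
  have sH: "s \<in> H" and sm: "[s = 1] (mod m 2)"
    using s by (auto simp: I_def)
  have n4: "4 dvd n"
    using four_dvd_n[OF \<open>2 dvd n\<close>] .
  have one4: "Suc 0 mod n mod 4 = 1"
    by (subst mod_mod_cancel[OF n4]) simp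
  have s4: "s mod 4 = 3"
    using mod4[OF sH] I4[OF s(1) one_in_I] s(2) one4 by auto
  have I_eq: "I 2 = {Suc 0 mod n, s}"
  proof -
    have "c = Suc 0 mod n \<or> c = s" if "c \<in> I 2" for c
      using mod4[of c] I4[OF that one_in_I] I4[OF that s(1)] one4 s4 that I_subset_H by auto
    then show ?thesis
      using s(1) one_in_I[of 2] by blast
  qed
  have ss: "[s * s = 1] (mod n)"
  proof -
    have "s * s mod n \<in> I 2"
    proof -
      have "[s * s = 1 * 1] (mod m 2)"
        using sm by (intro cong_mult)
      then have "[s * s mod n = 1] (mod m 2)"
        using m_dvd[of 2] by (simp add: cong_def mod_mod_cancel)
      then show ?thesis
        using mult_in_H[OF sH sH] by (simp add: I_def)
    qed
    moreover have "s * s mod n mod 4 = Suc 0 mod n mod 4"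
    proof -
      have "s * s mod 4 = (s mod 4) * (s mod 4) mod 4"
        by (simp add: mod_mult_eq)
      then show ?thesis
        unfolding mod_mod_cancel[OF n4] s4 by simp
    qed
    ultimately have "s * s mod n = Suc 0 mod n"
      using I4 one_in_I by blast
    then show ?thesis
      by (simp add: cong_def)
  qed
  define e where "e = multiplicity 2 n"
  \<comment> \<open>If \<open>e = 2\<close>, an element of the kernel modulo \<open>n div 2\<close>
    is 1 modulo \<open>m 2\<close> and agrees modulo 4 with 1 or \<open>s\<close>. It would
    therefore lie in \<open>H\<close>, which does not contain this kernel.\<close>
  have e3: "3 \<le> e"
  proof (rule ccontr)
    assume "\<not> 3 \<le> e"
    then have e: "e = 2"
      using e2 by (simp add: e_def)
    then have n_m: "n = 4 * m 2"
      using n_eq[of 2] by (simp add: e_def)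
    obtain c where c: "coprime c n" "[c = 1] (mod n div 2)" "c mod n \<notin> H"
      using kernel_not_subset_H[OF two \<open>2 dvd n\<close>] by blast
    have "M dvd N div 2" if "N = 4 * M" for M N :: nat
    proof -
      have "N div 2 = M * 2"
        using that by linarith
      then show ?thesis
        by simp
    qed
    then have "m 2 dvd n div 2"
      using n_m by blast
    then have cm: "[c = 1] (mod m 2)"
      using c(2) by (rule cong_dvd_modulus_nat[rotated])
    have cop: "coprime 4 (m 2)"
      using coprime_ppow_m[OF two, of 2] by simp
    have "odd c"
      using c(1) \<open>2 dvd n\<close> by (metis coprime_common_divisor_nat even_Suc odd_one dvd_refl One_nat_def)
    then have "c mod 4 = 1 \<or> c mod 4 = 3"
      by presburger
    then consider "[c = 1] (mod 4)" | "[c = s] (mod 4)"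
      using s4 by (auto simp: cong_def)
    then show False
    proof cases
      case 1
      have "[c = 1] (mod 4 * m 2)"
        using 1 cm cop by (rule coprime_cong_mult_nat)
      then have "c mod n = Suc 0 mod n"
        by (simp add: cong_def flip: n_m)
      then show False
        using c(3) one_in_H by simp
    next
      case 2
      have "[c = s] (mod 4 * m 2)"
        using 2 cong_trans[OF cm cong_sym[OF sm]] cop by (rule coprime_cong_mult_nat)
      then have "c mod n = s mod n"
        by (simp add: cong_def flip: n_m)
      then show False
        using c(3) sH H_less[OF sH] by simp
    qed
  qed
  \<comment> \<open>\<open>2 ^ e\<close> divides \<open>(s - 1) * (s + 1)\<close>, and
    \<open>s - 1\<close> is twice an odd number because \<open>s\<close> is 3 modulo 4.\<close>
  have "[s + 1 = 0] (mod 2 ^ (e - 1))"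
  proof -
    have s1: "s \<ge> 1"
      using s4 by (cases s) auto
    obtain t where t: "s - 1 = 2 * t"
    proof -
      have "2 dvd s - 1"
        using s4 by presburger
      then show ?thesis
        using that by (rule dvdE)
    qed
    have "2 ^ e dvd n"
      unfolding e_def by (rule multiplicity_dvd)
    then have "[s * s = 1] (mod 2 ^ e)"
      using ss by (rule cong_dvd_modulus_nat[rotated])
    moreover have "s * s \<ge> 1"
      using s1 by simp
    ultimately have "2 ^ e dvd s * s - 1"
      using cong_altdef_nat[of 1 "s * s" "2 ^ e"] by blast
    moreover have "s * s - 1 = 2 * (t * (s + 1))"
    proof -
      obtain r where r: "s = Suc r"
        using s1 by (cases s) auto
      have "r = 2 * t"
        using r t by simp
      then show ?thesis
        by (simp add: r algebra_simps)
    qed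
    moreover have "(2::nat) ^ e = 2 * 2 ^ (e - 1)"
      using e3 by (simp add: power_eq_if)
    ultimately have "2 * 2 ^ (e - 1) dvd 2 * (t * (s + 1))"
      by simp
    then have "2 ^ (e - 1) dvd t * (s + 1)"
      unfolding nat_mult_dvd_cancel_disj by linarith
    moreover have "odd t"
      using s4 t by presburger
    then have "coprime (2 ^ (e - 1)) t"
      by simp
    ultimately have "2 ^ (e - 1) dvd s + 1"
      using coprime_dvd_mult_right_iff by blast
    then show ?thesis
      by (simp add: cong_0_iff)
  qed
  then show ?thesis
    using that[OF sH s(2) I_eq sm ss] e3 by (simp add: e_def)
qed

end

section \<open>Surjectivity of traces\<close>

context cyclotomic
begin

text \<open>Up to a root of unity the difference is \<open>1 - zeta M ^ k\<close> with
  \<open>k\<close> not divisible by \<open>M\<close>, one of the factors in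
  \<open>prod_one_minus_zeta\<close>.\<close>

lemma of_nat_m_in_image:
  assumes r: "\<not> [r = 1] (mod m p)"
  shows "of_nat (m p) \<in> (*) (zeta (m p) - zeta (m p) ^ r) ` A"
proof -
  define M where "M = m p"
  have M0: "M > 0" and Mn: "M dvd n"
    unfolding M_def by (rule m_pos, rule m_dvd)
  \<comment> \<open>This is \<open>r - 1\<close> modulo \<open>M\<close>, written without truncated
    subtraction.\<close>
  define k where "k = (r + (M - 1)) mod M"
  have zA: "zeta M ^ i \<in> A" for i
    using Mn by (rule zeta_divisor_in_A)
  have "k \<noteq> 0"
  proof
    assume "k = 0"
    then have "[r + (M - 1) = 0] (mod M)"
      by (simp add: k_def cong_def)
    then have "[r + (M - 1) + 1 = 0 + 1] (mod M)"
      by (intro cong_add cong_refl)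
    then show False
      using r M0 by (simp add: M_def cong_def)
  qed
  then have kM: "k \<in> {1..<M}"
    using M0 by (simp add: k_def)
  have "zeta M * zeta M ^ k = zeta M * (zeta M ^ r * zeta M ^ (M - 1))"
    by (simp add: k_def zeta_power_mod[OF M0] power_add)
  also have "\<dots> = zeta M ^ r * zeta M ^ M"
    using M0 by (simp add: power_eq_if mult_ac)
  finally have "zeta M * zeta M ^ k = zeta M ^ r"
    using M0 by simp
  then have eq: "zeta M - zeta M ^ r = zeta M * (1 - zeta M ^ k)"
    by (simp add: algebra_simps)
  define v where "v = zeta M ^ (M - 1) * (\<Prod>j\<in>{1..<M} - {k}. 1 - zeta M ^ j)"
  have "(zeta M - zeta M ^ r) * v = (zeta M * zeta M ^ (M - 1)) * ((1 - zeta M ^ k) * (\<Prod>j\<in>{1..<M} - {k}. 1 - zeta M ^ j))"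
    by (simp add: eq v_def mult_ac)
  also have "(1 - zeta M ^ k) * (\<Prod>j\<in>{1..<M} - {k}. 1 - zeta M ^ j) = of_nat M"
    using prod.remove[OF _ kM, of "\<lambda>j. 1 - zeta M ^ j"] prod_one_minus_zeta[OF M0] by simp
  also have "zeta M * zeta M ^ (M - 1) = 1"
    using power_minus_mult[OF M0, of "zeta M"] M0 by (simp add: mult.commute)
  finally have "of_nat M = (zeta M - zeta M ^ r) * v"
    by simp
  moreover have "v \<in> A"
    unfolding v_def using zA by (intro A.mult_closed A.prod_closed A.diff_closed) auto
  ultimately show ?thesis
    by (auto simp: M_def)
qed

end

context cyclotomic_subfield
begin

text \<open>
  A polynomial separating the residue class of \<open>1\<close> from the other classes of \<open>H\<close> modulo the part of
  \<open>n\<close> prime to \<open>p\<close>; its value at the corresponding root of unity is a unit at \<open>p\<close>.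
\<close>

lemma separating_polynomial:
  obtains f v k where "coeffs_in A f" "v \<in> A" "poly f (zeta (m p)) * v = of_nat (m p ^ k)"
    "\<And>c. c \<in> H \<Longrightarrow> \<not> [c = 1] (mod m p) \<Longrightarrow> poly f (zeta (m p) ^ c) = 0"
proof -
  define C where "C = {c \<in> H. \<not> [c = 1] (mod m p)}"
  define f where "f = (\<Prod>c\<in>C. [:- (zeta (m p) ^ c), 1:])"
  have "\<exists>w. w \<in> A \<and> of_nat (m p) = (zeta (m p) - zeta (m p) ^ c) * w" if "c \<in> C" for c
    using of_nat_m_in_image[of c p] that unfolding C_def by blast
  then obtain w where w: "\<And>c. c \<in> C \<Longrightarrow> w c \<in> A \<and> of_nat (m p) = (zeta (m p) - zeta (m p) ^ c) * w c"
    by metis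
  have fin: "finite C"
    by (simp add: C_def)
  show ?thesis
  proof (rule that[of f "prod w C" "card C"])
    show "coeffs_in A f"
      unfolding f_def using zeta_divisor_in_A[OF m_dvd]
      by (intro A.coeffs_in_prod) (auto intro!: A.uminus_closed)
    show "prod w C \<in> A"
      using w by (intro A.prod_closed) blast
    have "poly f (zeta (m p)) * prod w C = (\<Prod>c\<in>C. (zeta (m p) - zeta (m p) ^ c) * w c)"
      by (simp add: f_def poly_prod prod.distrib)
    also have "\<dots> = (\<Prod>c\<in>C. of_nat (m p))"
      using w by (intro prod.cong) auto
    finally show "poly f (zeta (m p)) * prod w C = of_nat (m p ^ card C)"
      by simp
    show "poly f (zeta (m p) ^ c) = 0" if "c \<in> H" "\<not> [c = 1] (mod m p)" for c
      using that fin by (auto simp: f_def poly_prod C_def)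
  qed
qed

definition T :: "complex \<Rightarrow> complex" where
  "T x = (\<Sum>c\<in>H. \<sigma> c x)"

lemma T_add: "x \<in> L \<Longrightarrow> y \<in> L \<Longrightarrow> T (x + y) = T x + T y"
  by (simp add: T_def sigma_add H_coprime sum.distrib)

lemma T_sum: "(\<And>i. i \<in> U \<Longrightarrow> f i \<in> L) \<Longrightarrow> T (sum f U) = (\<Sum>i\<in>U. T (f i))"
  unfolding T_def by (subst sum.swap) (simp add: sigma_sum H_coprime)

lemma T_mult: "a \<in> K \<Longrightarrow> x \<in> L \<Longrightarrow> T (a * x) = a * T x"
  using K_subset_L by (auto simp: T_def sigma_mult H_coprime H_fixes sum_distrib_left subset_iff)

lemma T_in_A: "x \<in> A \<Longrightarrow> T x \<in> A"
  unfolding T_def by (intro A.sum_closed sigma_in_A H_coprime)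

lemma T_sigma:
  assumes d: "d \<in> H" and x: "x \<in> L"
  shows "T (\<sigma> d x) = T x"
proof -
  have "T (\<sigma> d x) = (\<Sum>c\<in>H. \<sigma> (d * c mod n) x)"
    unfolding T_def using x
    by (intro sum.cong) (auto simp: sigma_sigma H_coprime d mult.commute intro!: sigma_cong)
  also have "\<dots> = T x"
    unfolding T_def using bij_betw_mult_H[OF d] by (rule sum.reindex_bij_betw)
  finally show ?thesis .
qed

lemma T_in_K:
  assumes x: "x \<in> L"
  shows "T x \<in> K"
proof (rule fixed_field)
  show "T x \<in> L"
    unfolding T_def using x by (intro L.sum_closed sigma_in_L H_coprime)
  fix d assume d: "d \<in> H"
  have "\<sigma> d (T x) = (\<Sum>c\<in>H. \<sigma> d (\<sigma> c x))"
    unfolding T_def using x by (intro sigma_sum H_coprime[OF d] sigma_in_L H_coprime)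
  also have "\<dots> = (\<Sum>c\<in>H. \<sigma> (d * c mod n) x)"
    using x by (intro sum.cong) (auto simp: sigma_sigma H_coprime d intro!: sigma_cong)
  also have "\<dots> = T x"
    unfolding T_def using bij_betw_mult_H[OF d] by (rule sum.reindex_bij_betw)
  finally show "\<sigma> d (T x) = T x" .
qed

lemma T_rat: "x \<in> \<rat> \<Longrightarrow> T x = of_nat (card H) * x"
  by (simp add: T_def sigma_rat H_coprime)

section \<open>Ideals of the ring of integers of K\<close>

definition ideal_K :: "complex set \<Rightarrow> bool" where
  "ideal_K J \<longleftrightarrow> 0 \<in> J \<and> J \<subseteq> K \<inter> A \<and> (\<forall>x\<in>J. \<forall>y\<in>J. x + y \<in> J) \<and> (\<forall>x\<in>J. \<forall>a\<in>K \<inter> A. a * x \<in> J)"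

sublocale KA: complex_subring "K \<inter> A"
  by unfold_locales auto

lemma ideal_K_one_plus_prod:
  assumes J: "ideal_K J" and f: "\<And>i. i \<in> U \<Longrightarrow> 1 - f i \<in> J"
  shows "1 - prod f U \<in> J"
  using f
proof (induction U rule: infinite_finite_induct)
  case (insert x F)
  have 1: "1 - f x \<in> J" and 2: "1 - prod f F \<in> J"
    using insert by auto
  have "f x \<in> K \<inter> A"
    using 1 J KA.diff_closed[OF KA.one_closed, of "1 - f x"] by (auto simp: ideal_K_def)
  then have "(1 - f x) + f x * (1 - prod f F) \<in> J"
    using 1 2 J by (simp add: ideal_K_def)
  also have "(1 - f x) + f x * (1 - prod f F) = 1 - prod f (insert x F)"
    using insert by (simp add: algebra_simps)
  finally show ?case .
qed (use J in \<open>simp_all add: ideal_K_def\<close>)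

text \<open>
  If elements \<open>j i\<close> of \<open>J\<close> generate an ideal of \<open>A\<close> prime to \<open>p\<close>, then \<open>w = \<Prod>i. 1 - j i ^ (q - 1)\<close>
  is congruent to \<open>1\<close> modulo \<open>J\<close> and annihilates that ideal modulo the radical of \<open>p\<close>.
\<close>

lemma ideal_K_plus_prime:
  assumes J: "ideal_K J" and p: "prime (p::nat)"
    and j: "\<And>i. i \<in> U \<Longrightarrow> j i \<in> J" "\<And>i. i \<in> U \<Longrightarrow> a i \<in> A" "finite U"
    and u: "(\<Sum>i\<in>U. j i * a i) = of_int u" "\<not> int p dvd u"
  shows "\<exists>y\<in>K \<inter> A. 1 - of_nat p * y \<in> J"
proof -
  obtain q where q: "q \<ge> 2" "\<And>y. y \<in> A \<Longrightarrow> y ^ q - y \<in> (*) (unif p) ` A"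
    using unif_frobenius[OF p] by metis
  define w where "w = (\<Prod>i\<in>U. 1 - j i ^ (q - 1))"
  have jKA: "j i \<in> K \<inter> A" if "i \<in> U" for i
    using j(1)[OF that] J by (auto simp: ideal_K_def)
  have "1 - (1 - j i ^ (q - 1)) \<in> J" if "i \<in> U" for i
  proof -
    have "j i ^ (q - 1) = j i ^ (q - 2) * j i"
      using q(1) by (metis Suc_diff_Suc Suc_1 Suc_le_eq diff_Suc_1 mult.commute power_Suc numeral_2_eq_2 diff_Suc_Suc minus_nat.diff_0)
    then show ?thesis
      using J j(1)[OF that] KA.power_closed[OF jKA[OF that]] by (simp add: ideal_K_def)
  qed
  then have w1: "1 - w \<in> J"
    unfolding w_def by (rule ideal_K_one_plus_prod[OF J])
  then have "1 - w \<in> K \<inter> A"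
    using J by (auto simp: ideal_K_def)
  then have wKA: "w \<in> K \<inter> A"
    using KA.diff_closed[OF KA.one_closed, of "1 - w"] by simp
  have "w * j i \<in> (*) (unif p) ` A" if i: "i \<in> U" for i
  proof -
    define R where "R = (\<Prod>i\<in>U - {i}. 1 - j i ^ (q - 1))"
    have wR: "w = (1 - j i ^ (q - 1)) * R"
      unfolding w_def R_def by (rule prod.remove[OF j(3) i])
    have "j i ^ (q - 1) * j i = j i ^ q"
      using q(1) by (intro power_minus_mult) simp
    then have "w * j i = R * - (j i ^ q - j i)"
      unfolding wR by (simp add: algebra_simps)
    moreover have "R \<in> A"
      unfolding R_def using jKA by (intro A.prod_closed A.diff_closed A.power_closed) auto
    ultimately show ?thesis
      using q(2)[of "j i"] jKA[OF i] by (simp only: A.image_mult_mult' A.image_mult_uminus IntD2)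
  qed
  then have "(\<Sum>i\<in>U. w * j i * a i) \<in> (*) (unif p) ` A"
    using j(2) by (intro A.image_mult_sum) (rule A.image_mult_mult)
  also have "(\<Sum>i\<in>U. w * j i * a i) = w * of_int u"
    by (simp add: u(1)[symmetric] sum_distrib_left mult.assoc)
  finally have wu: "w * of_int u \<in> (*) (unif p) ` A" .
  have "coprime (int p) u"
    using u(2) p by (simp add: prime_imp_coprime)
  then obtain x y where xy: "x * int p + y * u = 1"
    using bezout_int[of "int p" u] by (auto simp: coprime_iff_gcd_eq_1)
  have "w = w * of_int (x * int p + y * u)"
    by (simp add: xy)
  also have "\<dots> = of_nat p * (w * of_int x) + (w * of_int u) * of_int y"
    by (simp add: algebra_simps)
  also have "\<dots> \<in> (*) (unif p) ` A"
    by (rule A.image_mult_add[OF A.image_mult_mult[OF prime_in_unif[OF p]] A.image_mult_mult[OF wu]])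
      (use wKA in auto)
  finally have "w \<in> (*) (unif p) ` A" .
  then obtain w' where w': "w' \<in> A" "w = unif p * w'"
    by auto
  obtain e u' v' where e: "e > 0" "u' \<in> A" "v' \<in> A" "u' * v' = 1" "of_nat p = u' * unif p ^ e"
    by (rule prime_eq_unit_unif_power[OF p])
  have "w ^ e = (u' * v') * unif p ^ e * w' ^ e"
    by (simp add: w' power_mult_distrib e(4))
  also have "\<dots> = of_nat p * (v' * w' ^ e)"
    by (simp only: e(5) mult_ac)
  finally have we: "w ^ e = of_nat p * (v' * w' ^ e)" .
  \<comment> \<open>Divisibility by \<open>p\<close> has been obtained in \<open>A\<close> only; the
    quotient lies in \<open>K\<close> because \<open>w\<close> does. This is the descent from
    \<open>A\<close> to \<open>K \<inter> A\<close>.\<close>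
  have "v' * w' ^ e = w ^ e / of_nat p"
    using we prime_gt_0_nat[OF p] by (simp add: field_simps)
  then have "v' * w' ^ e \<in> K"
    using wKA by auto
  moreover have "v' * w' ^ e \<in> A"
    using w'(1) e(3) by auto
  moreover have "1 - (\<Prod>i<e. w) \<in> J"
    using w1 by (intro ideal_K_one_plus_prod[OF J])
  then have "1 - of_nat p * (v' * w' ^ e) \<in> J"
    by (simp add: we)
  ultimately show ?thesis
    by blast
qed

text \<open>If 1 lies in \<open>J + p (K \<inter> A)\<close> for every prime \<open>p\<close>,
  multiplying such relations gives the same for every \<open>k > 0\<close>. For
  \<open>k = d\<close>, which lies in \<open>J\<close>, it follows that 1 is in \<open>J\<close>.
  The hypothesis involves coefficients in \<open>A\<close>, where roots of unity are
  available.\<close>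

lemma ideal_K_eq_integers:
  assumes J: "ideal_K J" and d: "d > 0" "of_nat d \<in> J"
    and *: "\<And>p. prime (p::nat) \<Longrightarrow> \<exists>U j a u. finite (U :: nat set) \<and>
      (\<forall>i\<in>U. j i \<in> J \<and> a i \<in> A) \<and> (\<Sum>i\<in>U. j i * a i) = of_int u \<and> \<not> int p dvd u"
  shows "J = K \<inter> A"
proof -
  have prime: "\<exists>y\<in>K \<inter> A. 1 - of_nat p * y \<in> J" if "prime p" for p :: nat
  proof -
    obtain U :: "nat set" and j a u where "finite U" "\<forall>i\<in>U. j i \<in> J \<and> a i \<in> A"
      "(\<Sum>i\<in>U. j i * a i) = of_int u" "\<not> int p dvd u"
      using *[OF \<open>prime p\<close>] by blast
    then show ?thesis
      by (intro ideal_K_plus_prime[OF J that, of U j a u]) auto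
  qed
  have "\<exists>y\<in>K \<inter> A. 1 - of_nat k * y \<in> J" if "k > 0" for k :: nat
    using that
  proof (induction k rule: prime_divisors_induct)
    case (unit k)
    then have "1 - of_nat k * 1 \<in> J"
      using J by (simp add: ideal_K_def)
    then show ?case
      using KA.one_closed by blast
  next
    case (factor p k)
    obtain y where y: "y \<in> K \<inter> A" "1 - of_nat p * y \<in> J"
      using prime[OF factor.hyps] by blast
    obtain z where z: "z \<in> K \<inter> A" "1 - of_nat k * z \<in> J"
      using factor.IH factor.prems by auto
    have "(1 - of_nat p * y) + (of_nat p * y) * (1 - of_nat k * z) \<in> J"
    proof -
      have "of_nat p * y \<in> K \<inter> A"
        using y(1) by (intro KA.mult_closed) auto
      then show ?thesis
        using J y(2) z(2) unfolding ideal_K_def by blast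
    qed
    moreover have "(1 - of_nat p * y) + (of_nat p * y) * (1 - of_nat k * z) = 1 - of_nat (p * k) * (y * z)"
      by (simp add: algebra_simps)
    moreover have "y * z \<in> K \<inter> A"
      using y(1) z(1) by (rule KA.mult_closed)
    ultimately show ?case
      by metis
  qed simp
  then obtain y where y: "y \<in> K \<inter> A" "1 - of_nat d * y \<in> J"
    using d(1) by blast
  have "(1 - of_nat d * y) + y * of_nat d \<in> J"
    using J y d(2) unfolding ideal_K_def by blast
  then have "1 \<in> J"
    by simp
  then have "x * 1 \<in> J" if "x \<in> K \<inter> A" for x
    using J that unfolding ideal_K_def by blast
  then show ?thesis
    using J by (auto simp: ideal_K_def)
qed

text \<open>This is the Vandermonde argument. Exchanging the sums gives
  \<open>\<sigma> c y * poly f (zeta (m p) ^ c)\<close> summed over \<open>H\<close>;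
  \<open>f\<close> removes the terms outside \<open>I p\<close>, and on \<open>I p\<close> its
  argument is \<open>zeta (m p)\<close>.\<close>

lemma T_separating:
  assumes f: "coeffs_in A f" and y: "y \<in> A"
    and fH: "\<And>c. c \<in> H \<Longrightarrow> \<not> [c = 1] (mod m p) \<Longrightarrow> poly f (zeta (m p) ^ c) = 0"
  shows "(\<Sum>j\<le>degree f. coeff f j * T (y * zeta (m p) ^ j)) = poly f (zeta (m p)) * (\<Sum>c\<in>I p. \<sigma> c y)"
proof -
  have zA: "zeta (m p) ^ i \<in> A" for i
    by (rule zeta_divisor_in_A[OF m_dvd])
  have sg: "\<sigma> c (y * zeta (m p) ^ j) = \<sigma> c y * (zeta (m p) ^ c) ^ j" if "c \<in> H" for c j
    using sigma_mult[OF H_coprime[OF that], of y "zeta (m p) ^ j"]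
      sigma_zeta_divisor[OF H_coprime[OF that] m_dvd[of p], of j] y zA[of j] A_subset_L
    by (auto simp: power_mult)
  have "(\<Sum>j\<le>degree f. coeff f j * T (y * zeta (m p) ^ j)) =
      (\<Sum>j\<le>degree f. \<Sum>c\<in>H. \<sigma> c y * (coeff f j * (zeta (m p) ^ c) ^ j))"
    unfolding T_def sum_distrib_left by (intro sum.cong refl) (simp add: sg)
  also have "\<dots> = (\<Sum>c\<in>H. \<sigma> c y * poly f (zeta (m p) ^ c))"
    by (subst sum.swap) (simp add: poly_altdef sum_distrib_left)
  also have "\<dots> = (\<Sum>c\<in>I p. \<sigma> c y * poly f (zeta (m p) ^ c))"
    using fH by (intro sum.mono_neutral_right) (auto simp: I_def)
  also have "\<dots> = (\<Sum>c\<in>I p. \<sigma> c y * poly f (zeta (m p)))"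
  proof (intro sum.cong refl)
    fix c assume "c \<in> I p"
    then have "zeta (m p) ^ c = zeta (m p) ^ 1"
      unfolding zeta_power_eq_iff[OF m_pos] by (simp add: I_def)
    then show "\<sigma> c y * poly f (zeta (m p) ^ c) = \<sigma> c y * poly f (zeta (m p))"
      by simp
  qed
  finally show ?thesis
    by (simp add: sum_distrib_right mult.commute)
qed

lemma T_separating_unit:
  assumes p: "prime (p::nat)"
  obtains f v k where "coeffs_in A f" "v \<in> A" "\<not> p dvd k"
    "(\<Sum>j\<le>degree f. T (zeta (m p) ^ j) * (coeff f j * v)) = of_nat (card (I p)) * of_nat k"
proof -
  obtain f v k where f: "coeffs_in A f" "v \<in> A" "poly f (zeta (m p)) * v = of_nat (m p ^ k)"
    "\<And>c. c \<in> H \<Longrightarrow> \<not> [c = 1] (mod m p) \<Longrightarrow> poly f (zeta (m p) ^ c) = 0"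
    using separating_polynomial[of p] by metis
  have "(\<Sum>j\<le>degree f. T (zeta (m p) ^ j) * (coeff f j * v)) =
      (\<Sum>j\<le>degree f. coeff f j * T (1 * zeta (m p) ^ j)) * v"
    by (simp add: sum_distrib_left sum_distrib_right mult_ac)
  also have "(\<Sum>j\<le>degree f. coeff f j * T (1 * zeta (m p) ^ j)) = poly f (zeta (m p)) * (\<Sum>c\<in>I p. \<sigma> c 1)"
    using f by (intro T_separating) auto
  also have "(\<Sum>c\<in>I p. \<sigma> c 1) = of_nat (card (I p))"
    using I_subset_H[of p] by (simp add: sigma_rat H_coprime subset_iff)
  also have "poly f (zeta (m p)) * of_nat (card (I p)) * v = of_nat (card (I p)) * of_nat (m p ^ k)"
    unfolding f(3)[symmetric] by (simp add: mult_ac)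
  finally show ?thesis
    using that[of f v "m p ^ k"] f(1,2) not_dvd_m[OF p] prime_dvd_power[OF p, of "m p" k] by blast
qed

text \<open>The image is an ideal of \<open>K \<inter> A\<close> containing
  \<open>T 1 = card H\<close>, and at \<open>p\<close> the traces of the powers of
  \<open>zeta (m p)\<close> combine to \<open>card (I p)\<close> times an integer prime to
  \<open>p\<close>.\<close>

theorem trace_surjective:
  assumes "\<And>p. prime (p::nat) \<Longrightarrow> \<not> p dvd card (I p)"
  shows "T ` A = K \<inter> A"
proof (rule ideal_K_eq_integers)
  show "ideal_K (T ` A)"
    unfolding ideal_K_def
  proof (intro conjI ballI)
    show "0 \<in> T ` A"
      using T_rat[of 0] by (intro image_eqI[of _ _ 0]) auto
    show "T ` A \<subseteq> K \<inter> A"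
      using T_in_K T_in_A A_subset_L by auto
    fix x assume "x \<in> T ` A"
    then obtain x' where x': "x' \<in> A" "x = T x'"
      by auto
    show "x + y \<in> T ` A" if y: "y \<in> T ` A" for y
    proof -
      obtain y' where "y' \<in> A" "y = T y'"
        using y by auto
      then show ?thesis
        using x' T_add[of x' y'] A_subset_L A.add_closed[of x' y']
        by (intro image_eqI[of _ T "x' + y'"]) (simp_all add: subset_iff)
    qed
    show "a * x \<in> T ` A" if "a \<in> K \<inter> A" for a
      using that x' T_mult[of a x'] A_subset_L A.mult_closed[of a x'] by (intro image_eqI[of _ T "a * x'"]) (simp_all add: subset_iff)
  qed
  show "card H > 0"
    by (rule card_H_pos)
  show "of_nat (card H) \<in> T ` A"
    using T_rat[of 1] by (intro image_eqI[of _ _ 1]) auto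
next
  fix p :: nat assume p: "prime p"
  obtain f v k where f: "coeffs_in A f" "v \<in> A" "\<not> p dvd k"
    "(\<Sum>j\<le>degree f. T (zeta (m p) ^ j) * (coeff f j * v)) = of_nat (card (I p)) * of_nat k"
    by (rule T_separating_unit[OF p])
  have "\<not> p dvd card (I p) * k"
    using assms[OF p] f(3) p prime_dvd_mult_nat by blast
  then have "\<not> int p dvd int (card (I p) * k)"
    unfolding int_dvd_int_iff .
  moreover have "(\<Sum>j\<le>degree f. T (zeta (m p) ^ j) * (coeff f j * v)) = of_int (int (card (I p) * k))"
    using f(4) by simp
  moreover have "\<forall>j\<in>{..degree f}. T (zeta (m p) ^ j) \<in> T ` A \<and> coeff f j * v \<in> A"
    using f(1,2) zeta_divisor_in_A[OF m_dvd] by (auto simp: coeffs_in_def)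
  ultimately show "\<exists>U j a u. finite (U :: nat set) \<and>
      (\<forall>i\<in>U. j i \<in> T ` A \<and> a i \<in> A) \<and> (\<Sum>i\<in>U. j i * a i) = of_int u \<and> \<not> int p dvd u"
    by (intro exI[of _ "{..degree f}"] exI[of _ "\<lambda>j. T (zeta (m p) ^ j)"] exI[of _ "\<lambda>j. coeff f j * v"]
      exI[of _ "int (card (I p) * k)"] conjI finite_atMost)
qed

end

section \<open>Decomposition of the ring of integers at the prime two\<close>

lemma card_units_less_eq_totient:
  assumes "k > 0"
  shows "card {c. c < k \<and> coprime c k} = totient k"
proof (cases "k = 1")
  case True
  then have "{c. c < k \<and> coprime c k} = {0}"
    by auto
  then show ?thesis
    using True by simp
next
  case False
  then have "k > 1"
    using assms by simp
  then have "{c. c < k \<and> coprime c k} = totatives k"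
    by (auto simp: totatives_def le_less intro!: gr0I)
  then show ?thesis
    by (simp add: totient_def)
qed

context cyclotomic
begin

text \<open>Take the remainder on division by the minimal polynomial of \<zeta> over
  \<open>\<rat>\<close>. That polynomial has integer coefficients, and its degree is
  \<open>totient n\<close> because the group belonging to \<open>\<rat>\<close> consists of all
  units modulo \<open>n\<close>.\<close>

lemma coords_exist:
  assumes y: "y \<in> A"
  obtains d :: "nat \<Rightarrow> int" where "y = (\<Sum>j<totient n. of_int (d j) * \<zeta> ^ j)"
proof -
  interpret Q: cyclotomic_subfield n \<rat>
    by (intro cyclotomic_subfield.intro cyclotomic_subfield_axioms.intro cyclotomic_axioms
      complex_subfield_Rats L.Rats_subset)
  interpret Z: complex_subring \<int>
    by (rule complex_subring_Ints)
  have "Q.H = {c. c < n \<and> coprime c n}"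
    unfolding Q.H_def using sigma_rat by auto
  then have cardH: "card Q.H = totient n"
    using card_units_less_eq_totient[OF n_pos] by simp
  obtain f g where f: "coeffs_in \<rat> f" "lead_coeff f = 1" "poly f \<zeta> = 0" "degree f = card Q.H"
    "f * g = monom 1 n - 1"
    by (rule Q.minimal_polynomial_zeta)
  have fZ: "coeffs_in \<int> f"
    using coeffs_in_Ints_of_Rats[OF n_pos f(5) f(2) f(1)] .
  obtain h where h: "coeffs_in \<int> h" "y = poly h \<zeta>"
    using y by (rule A_cases)
  obtain q r where r: "coeffs_in \<int> r" "h = f * q + r" "r = 0 \<or> degree r < degree f"
    using Z.monic_division[OF fZ f(2) h(1)] by blast
  have deg: "degree r < totient n"
    using r(3) f(4) cardH n_pos by auto
  have "y = poly r \<zeta>"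
    using h(2) r(2) f(3) by simp
  also have "\<dots> = (\<Sum>j<totient n. coeff r j * \<zeta> ^ j)"
    unfolding poly_altdef using deg by (intro sum.mono_neutral_left) (auto simp: coeff_eq_0)
  finally have y': "y = (\<Sum>j<totient n. coeff r j * \<zeta> ^ j)" .
  have "\<forall>j. \<exists>k. coeff r j = of_int k"
    using r(1) by (auto simp: coeffs_in_def elim!: Ints_cases)
  then obtain d where "\<And>j. coeff r j = of_int (d j)"
    by metis
  then show ?thesis
    using that[of d] y' by simp
qed

lemma sigma_poly_rat:
  assumes c: "coprime c n" and r: "coeffs_in \<rat> r" and x: "x \<in> L"
  shows "\<sigma> c (poly r x) = poly r (\<sigma> c x)"
  using r
proof (induction r)
  case 0
  then show ?case
    using sigma_rat[OF c, of 0] by simp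
next
  case (pCons a r)
  have a: "a \<in> \<rat>" and r: "coeffs_in \<rat> r"
    using pCons.prems complex_subring.coeffs_in_pCons_iff[OF complex_subring_Rats] by auto
  have "a \<in> L" "poly r x \<in> L"
    using a L.Rats_subset coeffs_in_mono[OF r L.Rats_subset] x by auto
  then show ?case
    using pCons.IH[OF r] x by (simp add: sigma_add[OF c] sigma_mult[OF c] sigma_rat[OF c a] L.mult_closed)
qed

end

section \<open>The integers of even level over those of odd level\<close>

locale even_cyclotomic = cyclotomic +
  fixes e M :: nat
  assumes n_decomp: "n = 2 ^ e * M" and odd_M: "odd M" and e_pos: "e > 0"
begin

abbreviation N :: nat where "N \<equiv> 2 ^ (e - 1)"
abbreviation z :: complex where "z \<equiv> zeta (2 ^ e)"
abbreviation w :: complex where "w \<equiv> zeta M"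

definition B :: "complex set" where "B = adjoin \<int> w"
definition F :: "complex set" where "F = adjoin \<rat> w"

lemma M_pos: "M > 0"
  using odd_M by (auto intro!: gr0I)

sublocale M: cyclotomic M
  by unfold_locales (rule M_pos)

lemma B_eq: "M.A = B" and F_eq: "M.L = F"
  by (simp_all add: M.A_def M.L_def B_def F_def)

sublocale B: complex_subring B
  unfolding B_def by (rule complex_subring.complex_subring_adjoin[OF complex_subring_Ints])

sublocale F: complex_subring F
  unfolding F_def by (rule complex_subring.complex_subring_adjoin[OF complex_subring_Rats])

lemma two_N: "2 ^ e = 2 * N"
  using e_pos by (simp add: power_eq_if)

lemma dvd_n: "2 ^ e dvd n" "M dvd n"
  unfolding n_decomp by simp_all

lemma z_in_A: "z ^ i \<in> A"
  using dvd_n(1) by (rule zeta_divisor_in_A)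

lemma w_in_A: "w ^ i \<in> A"
  using dvd_n(2) by (rule zeta_divisor_in_A)

lemma w_in_B: "w ^ i \<in> B"
  using B.power_closed[of w i] complex_subring.adjoin_generator[OF complex_subring_Ints, of w]
  unfolding B_def by blast

lemma B_subset_A: "B \<subseteq> A"
  unfolding B_def using w_in_A[of 1] A.Ints_subset A.complex_subring_axioms by (intro adjoin_subset) auto

lemma B_subset_F: "B \<subseteq> F"
  unfolding B_def F_def adjoin_def using coeffs_in_mono[OF _ Ints_subset_Rats] by auto

lemma F_subset_L: "F \<subseteq> L"
  unfolding F_def using w_in_A[of 1] A_subset_L L.Rats_subset L.complex_subring_axioms
  by (intro adjoin_subset) auto

lemma z_N: "z ^ N = -1"
proof -
  have "(z ^ N) ^ 2 = 1"
    using zeta_power_self[of "2 ^ e"] by (simp add: two_N mult.commute flip: power_mult)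
  moreover have "z ^ N \<noteq> 1"
  proof -
    have "\<not> 2 ^ e dvd N"
      unfolding two_N by (auto dest: dvd_imp_le)
    then show ?thesis
      by (simp add: zeta_power_eq_1_iff)
  qed
  ultimately show ?thesis
    by (simp add: power2_eq_1_iff)
qed

lemma z_reduce: "z ^ k = (-1) ^ (k div N) * z ^ (k mod N)"
proof -
  have "z ^ k = z ^ (N * (k div N) + k mod N)"
    by simp
  then show ?thesis
    by (simp only: power_add power_mult z_N)
qed

definition span_B :: "complex set" where
  "span_B = {\<Sum>i<N. a i * z ^ i | a. \<forall>i. a i \<in> B}"

lemma span_B_add: "x \<in> span_B \<Longrightarrow> y \<in> span_B \<Longrightarrow> x + y \<in> span_B"
proof -
  assume "x \<in> span_B" "y \<in> span_B"
  then obtain a b where "\<forall>i. a i \<in> B" "x = (\<Sum>i<N. a i * z ^ i)" "\<forall>i. b i \<in> B" "y = (\<Sum>i<N. b i * z ^ i)"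
    unfolding span_B_def by blast
  then show ?thesis
    unfolding span_B_def by (intro CollectI exI[of _ "\<lambda>i. a i + b i"])
      (simp add: sum.distrib distrib_right B.add_closed)
qed

lemma span_B_zero: "0 \<in> span_B"
  unfolding span_B_def by (intro CollectI exI[of _ "\<lambda>_. 0"]) simp

lemma span_B_sum: "(\<And>i. i \<in> I \<Longrightarrow> f i \<in> span_B) \<Longrightarrow> sum f I \<in> span_B"
  by (induction I rule: infinite_finite_induct) (simp_all add: span_B_zero span_B_add)

lemma span_B_z:
  assumes b: "b \<in> B"
  shows "b * z ^ k \<in> span_B"
proof -
  define a where "a i = (if i = k mod N then b * (-1) ^ (k div N) else 0)" for i
  have "(\<Sum>i<N. a i * z ^ i) = (\<Sum>i<N. if i = k mod N then b * (-1) ^ (k div N) * z ^ i else 0)"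
    by (intro sum.cong) (auto simp: a_def)
  also have "\<dots> = b * z ^ k"
    by (subst (2) z_reduce) simp
  finally have "b * z ^ k = (\<Sum>i<N. a i * z ^ i)" ..
  moreover have "\<forall>i. a i \<in> B"
    using b B.mult_closed[OF b B.power_closed[OF B.uminus_closed[OF B.one_closed]]] by (simp add: a_def)
  ultimately show ?thesis
    unfolding span_B_def by blast
qed

text \<open>The Chinese remainder theorem splits 1 as \<open>u + v\<close> modulo \<open>n\<close>,
  with \<open>u\<close> divisible by \<open>M\<close> and \<open>v\<close> by \<open>2 ^ e\<close>.
  Hence \<zeta> is a power of \<open>z\<close> times a power of \<open>w\<close>, and
  \<open>z ^ N = -1\<close> brings exponents of \<open>z\<close> below \<open>N\<close>.\<close>

lemma A_eq_span_B: "A = span_B"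
proof (intro equalityI subsetI)
  fix y assume "y \<in> span_B"
  then show "y \<in> A"
    unfolding span_B_def using z_in_A B_subset_A by (auto intro!: A.sum_closed A.mult_closed)
next
  have "coprime (2 ^ e) M"
    using odd_M by simp
  then obtain u v where uv: "[u = 1] (mod 2 ^ e)" "[u = 0] (mod M)" "[v = 0] (mod 2 ^ e)" "[v = 1] (mod M)"
    using binary_chinese_remainder_nat[of "2 ^ e" M] by metis
  have "[u + v = 1] (mod n)"
    unfolding n_decomp using \<open>coprime (2 ^ e) M\<close> cong_add[OF uv(1) uv(3)] cong_add[OF uv(2) uv(4)]
    by (intro coprime_cong_mult_nat) simp_all
  then have "\<zeta> ^ (u + v) = \<zeta> ^ 1"
    unfolding zeta_power_eq_iff[OF n_pos] .
  then have one: "\<zeta> = \<zeta> ^ (u + v)"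
    by simp
  obtain u' where u': "u = M * u'"
    using uv(2) by (auto simp: cong_0_iff)
  obtain v' where v': "v = 2 ^ e * v'"
    using uv(3) by (auto simp: cong_0_iff)
  have zM: "\<zeta> ^ M = z"
    unfolding n_decomp using zeta_divisor[of "2 ^ e" M] M_pos by simp
  have wE: "\<zeta> ^ (2 ^ e) = w"
    unfolding n_decomp using zeta_divisor[of M "2 ^ e"] M_pos by (simp add: mult.commute)
  have "\<zeta> ^ (u + v) = z ^ u' * w ^ v'"
    unfolding u' v' power_add power_mult zM wE ..
  with one have zeta: "\<zeta> = w ^ v' * z ^ u'"
    by (simp only: mult.commute)
  fix y assume "y \<in> A"
  then obtain g where g: "coeffs_in \<int> g" "y = poly g \<zeta>"
    by (rule A_cases)
  have "y = (\<Sum>k\<le>degree g. (coeff g k * w ^ (v' * k)) * z ^ (u' * k))"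
    unfolding g(2) poly_altdef by (intro sum.cong refl, subst zeta) (simp add: power_mult_distrib power_mult mult.assoc)
  also have "\<dots> \<in> span_B"
  proof (intro span_B_sum span_B_z B.mult_closed w_in_B)
    show "coeff g k \<in> B" for k
      using g(1) B.Ints_subset by (auto simp: coeffs_in_def)
  qed
  finally show "y \<in> span_B" .
qed

lemma sigma_F:
  assumes c: "coprime c n" "[c = 1] (mod M)" and a: "a \<in> F"
  shows "\<sigma> c a = a"
proof -
  obtain r where r: "coeffs_in \<rat> r" "a = poly r w"
    using a unfolding F_def by (rule adjoinE)
  have "\<sigma> c w = w ^ c"
    using sigma_zeta_divisor[OF c(1) dvd_n(2), of 1] by simp
  also have "\<dots> = w ^ 1"
    unfolding zeta_power_eq_iff[OF M_pos] by (rule c(2))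
  finally have "\<sigma> c w = w"
    by simp
  moreover have "w \<in> L"
    using w_in_A[of 1] A_subset_L by auto
  ultimately show ?thesis
    using sigma_poly_rat[OF c(1) r(1), of w] by (simp add: r(2))
qed

lemma sigma_z: "coprime c n \<Longrightarrow> \<sigma> c (z ^ i) = z ^ (c * i)"
  using sigma_zeta_divisor dvd_n(1) by blast

text \<open>The automorphisms fixing \<open>w\<close> turn a relation into a polynomial with too many roots.\<close>

lemma span_F_unique:
  assumes a: "\<And>i. a i \<in> F" and sum: "(\<Sum>i<N. a i * z ^ i) = 0" and i: "i < N"
  shows "a i = 0"
proof -
  define g where "g = (\<Sum>i<N. monom (a i) i)"
  have g: "coeff g i = (if i < N then a i else 0)" for i
    by (simp add: g_def coeff_sum)
  have "degree g \<le> N - 1"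
    by (intro degree_le) (use g in auto)
  then have deg: "degree g < N"
    by (rule le_less_trans) simp
  have root: "poly g (z ^ c) = 0" if "odd c" for c
  proof -
    have "coprime (2 ^ e) M"
      using odd_M by simp
    then obtain d where d: "[d = c] (mod 2 ^ e)" "[d = 1] (mod M)"
      using binary_chinese_remainder_nat[of "2 ^ e" M c 1] by blast
    have "coprime d (2 ^ e)"
    proof -
      have "[d = c] (mod 2)"
        using d(1) e_pos by (metis cong_dvd_modulus_nat dvd_power)
      then have "odd d"
        using that by (simp add: cong_def) presburger
      then show ?thesis
        by simp
    qed
    moreover have "coprime d M"
      using d(2) by (metis cong_imp_coprime cong_sym coprime_1_left)
    ultimately have cd: "coprime d n"
      by (simp add: n_decomp)
    have aL: "a i \<in> L" and zL: "z ^ i \<in> L" for i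
      using a F_subset_L z_in_A A_subset_L by auto
    have "0 = \<sigma> d (\<Sum>i<N. a i * z ^ i)"
      using sum sigma_rat[OF cd, of 0] by simp
    also have "\<dots> = (\<Sum>i<N. \<sigma> d (a i * z ^ i))"
      using aL zL by (intro sigma_sum[OF cd] L.mult_closed)
    also have "\<dots> = (\<Sum>i<N. a i * (z ^ c) ^ i)"
    proof (intro sum.cong refl)
      fix i
      have "z ^ d = z ^ c"
        using d(1) by (simp add: zeta_power_eq_iff)
      then show "\<sigma> d (a i * z ^ i) = a i * (z ^ c) ^ i"
        using sigma_mult[OF cd aL zL, of i i] sigma_F[OF cd d(2) a] sigma_z[OF cd, of i]
        by (simp add: power_mult)
    qed
    finally show ?thesis
      by (simp add: g_def poly_sum poly_monom)
  qed
  define R where "R = (\<lambda>j. z ^ (2 * j + 1)) ` {..<N}"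
  have "inj_on (\<lambda>j. z ^ (2 * j + 1)) {..<N}"
  proof (rule inj_onI)
    fix i j assume ij: "i \<in> {..<N}" "j \<in> {..<N}" "z ^ (2 * i + 1) = z ^ (2 * j + 1)"
    then have "[2 * i + 1 = 2 * j + 1] (mod 2 ^ e)"
      by (subst (asm) zeta_power_eq_iff) simp_all
    moreover have "2 * i + 1 < 2 ^ e" "2 * j + 1 < 2 ^ e"
      using ij unfolding two_N by auto
    ultimately have "2 * i + 1 = 2 * j + 1"
      unfolding cong_def by simp
    then show "i = j"
      by simp
  qed
  then have "card R = N"
    by (simp add: R_def card_image)
  then have "g = 0"
  proof (intro poly_eqI_degree[of R])
    fix t assume "t \<in> R"
    then obtain j where "t = z ^ (2 * j + 1)"
      unfolding R_def by blast
    then show "poly g t = poly 0 t"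
      using root[of "2 * j + 1"] by simp
  qed (use deg in simp_all)
  then show ?thesis
    using g[of i] i by simp
qed

end

section \<open>Prime ideals and ramification\<close>

lemma power_diff_1_eq_mult:
  assumes "q \<ge> 2"
  shows "(x :: complex) ^ (q - 1) = x * x ^ (q - 2)"
proof -
  obtain r where "q = 2 + r"
    using assms le_Suc_ex by blast
  then show ?thesis
    by simp
qed

context cyclotomic
begin

abbreviation R :: "complex ring" where "R \<equiv> complex_ring\<lparr>carrier := A\<rparr>"

lemma R_simps:
  "carrier R = A" "monoid.mult R = (*)" "add R = (+)" "one R = 1" "ring.zero R = 0"
  by (simp_all add: ring_of_type_algebra_def)

lemma cring_R: "cring R"
proof (rule cringI)
  show "abelian_group R"
    by (rule abelian_groupI) (auto simp: R_simps intro!: bexI[of _ "- _"])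
  show "comm_monoid R"
    by (rule comm_monoidI) (auto simp: R_simps)
qed (simp add: R_simps distrib_right)

sublocale R: cring R
  by (rule cring_R)

lemma R_uminus: "x \<in> A \<Longrightarrow> a_inv R x = - x"
  using R.minus_equality[of "- x" x] by (auto simp: R_simps)

lemma integer_ring_L: "integer_ring L = R"
  using integers_eq_A by (simp add: integer_ring_def ring_of_integers_def)

lemma ideal_R_iff:
  "ideal J R \<longleftrightarrow> 0 \<in> J \<and> J \<subseteq> A \<and> (\<forall>x\<in>J. \<forall>y\<in>J. x + y \<in> J) \<and> (\<forall>x\<in>J. \<forall>a\<in>A. a * x \<in> J)"
  (is "_ \<longleftrightarrow> ?P")
proof
  assume "ideal J R"
  then interpret J: ideal J R .
  show ?P
    using J.zero_closed J.a_subset J.a_closed J.I_l_closed by (auto simp: R_simps)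
next
  assume P: ?P
  show "ideal J R"
  proof (rule idealI[OF R.ring_axioms])
    show "subgroup J (add_monoid R)"
    proof (rule R.add.subgroupI)
      show "J \<subseteq> carrier R"
        using P by (simp add: R_simps)
      show "J \<noteq> {}"
        using P by auto
      show "a_inv R a \<in> J" if "a \<in> J" for a
      proof -
        have "(-1) * a \<in> J"
          using P that A.uminus_closed[OF A.one_closed] by blast
        then show ?thesis
          using P that R_uminus[of a] by auto
      qed
      show "add R a b \<in> J" if "a \<in> J" "b \<in> J" for a b
        using P that by (simp add: R_simps)
    qed
    show "monoid.mult R x a \<in> J" "monoid.mult R a x \<in> J" if "a \<in> J" "x \<in> carrier R" for a x
      using P that by (simp_all add: R_simps mult.commute)
  qed
qed

text \<open>Zorn's lemma for the ideals that contain \<open>p\<close> but not 1. The ideal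
  \<open>p A\<close> is one of them because \<open>1 / p\<close> is not an algebraic integer, and a
  maximal one is a maximal ideal of \<open>A\<close>.\<close>

lemma exists_prime_ideal:
  assumes p: "prime (p::nat)"
  obtains P where "primeideal P R" "of_nat p \<in> P"
proof -
  define S where "S = {J. ideal J R \<and> of_nat p \<in> J \<and> 1 \<notin> J}"
  have p0: "(of_nat p :: complex) \<noteq> 0"
    using prime_gt_0_nat[OF p] by simp
  have "(*) (of_nat p) ` A \<in> S"
  proof -
    have "ideal ((*) (of_nat p) ` A) R"
      unfolding ideal_R_iff
      using A.image_mult_add A.image_mult_mult' by (auto intro: image_eqI[of _ _ 0])
    moreover have "of_nat p \<in> (*) (of_nat p) ` A"
      by (intro image_eqI[of _ _ 1]) auto
    moreover have "1 \<notin> (*) (of_nat p) ` A"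
    proof
      assume "1 \<in> (*) (of_nat p) ` A"
      then obtain y where y: "y \<in> A" "1 = of_nat p * y"
        by auto
      then have "y = 1 / of_nat p"
        using p0 by (simp add: field_simps)
      then have "y \<in> \<rat>"
        by simp
      then have "y \<in> \<int>"
        using algebraic_int_A[OF y(1)] rational_algebraic_int_is_int by blast
      then obtain k where "y = of_int k"
        by (rule Ints_cases)
      then have "(of_int 1 :: complex) = of_int (int p * k)"
        using y(2) by simp
      then have "1 = int p * k"
        unfolding of_int_eq_iff .
      then have "int p dvd 1"
        by (rule dvdI)
      then show False
        using prime_gt_1_nat[OF p] by simp
    qed
    ultimately show ?thesis
      by (simp add: S_def)
  qed
  then have "S \<noteq> {}"
    by auto
  moreover have "\<Union>C \<in> S" if C: "C \<noteq> {}" "subset.chain S C" for C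
  proof -
    have "subset.chain {I. ideal I R} C"
      using C(2) by (auto simp: subset.chain_def S_def)
    then have "ideal (\<Union>C) R"
      using R.chain_Union_is_ideal[of C] C(1) by simp
    moreover have "of_nat p \<in> \<Union>C" "1 \<notin> \<Union>C"
      using C by (auto simp: subset.chain_def S_def)
    ultimately show ?thesis
      by (simp add: S_def)
  qed
  ultimately obtain P where P: "P \<in> S" "\<And>J. J \<in> S \<Longrightarrow> P \<subseteq> J \<Longrightarrow> J = P"
    using subset_Zorn_nonempty[of S] by metis
  have "maximalideal P R"
  proof (rule maximalidealI)
    show "ideal P R"
      using P(1) by (simp add: S_def)
    show "carrier R \<noteq> P"
      using P(1) A.one_closed unfolding R_simps S_def by blast
    fix J assume J: "ideal J R" "P \<subseteq> J" "J \<subseteq> carrier R"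
    show "J = P \<or> J = carrier R"
    proof (cases "1 \<in> J")
      case True
      have "x \<in> J" if "x \<in> A" for x
      proof -
        have "x * 1 \<in> J"
          using J(1) True that unfolding ideal_R_iff by blast
        then show ?thesis
          by simp
      qed
      then show ?thesis
        using J(3) by (auto simp: R_simps)
    next
      case False
      then have "J \<in> S"
        using J P(1) by (auto simp: S_def)
      then show ?thesis
        using P(2) J(2) by blast
    qed
  qed
  then have "primeideal P R"
    by (rule R.maximalideal_prime)
  then show ?thesis
    using that P(1) by (simp add: S_def)
qed

end

section \<open>The valuation at a prime ideal\<close>

locale cyclotomic_prime = cyclotomic +
  fixes P :: "complex set" and p :: nat
  assumes P_prime: "primeideal P R" and p_prime: "prime p" and p_in_P: "of_nat p \<in> P"
begin

lemma ideal_P: "ideal P R"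
  using P_prime by (simp add: primeideal_def)

lemma P_subset_A: "P \<subseteq> A" and zero_in_P: "0 \<in> P"
  and P_add: "x \<in> P \<Longrightarrow> y \<in> P \<Longrightarrow> x + y \<in> P"
  and P_mult: "x \<in> P \<Longrightarrow> a \<in> A \<Longrightarrow> a * x \<in> P"
  using ideal_P unfolding ideal_R_iff by blast+

lemma P_mult': "x \<in> P \<Longrightarrow> a \<in> A \<Longrightarrow> x * a \<in> P"
  using P_mult[of x a] by (simp add: mult.commute)

lemma P_diff: "x \<in> P \<Longrightarrow> y \<in> P \<Longrightarrow> x - y \<in> P"
  using P_add[of x "(-1) * y"] P_mult[of y "-1"] by auto

lemma P_prod: "a \<in> A \<Longrightarrow> b \<in> A \<Longrightarrow> a * b \<in> P \<Longrightarrow> a \<in> P \<or> b \<in> P"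
  using primeideal.I_prime[OF P_prime, of a b] by (simp add: R_simps)

lemma one_notin_P: "1 \<notin> P"
proof
  assume "1 \<in> P"
  then have "P = A"
    using P_mult[of 1] P_subset_A by auto
  then show False
    using primeideal.I_notcarr[OF P_prime] by (simp add: R_simps)
qed

lemma P_power: "a \<in> A \<Longrightarrow> a ^ k \<in> P \<Longrightarrow> a \<in> P"
proof (induction k)
  case 0
  then show ?case
    using one_notin_P by simp
next
  case (Suc k)
  then show ?case
    using P_prod[of a "a ^ k"] by auto
qed

lemma unit_notin_P: "u \<in> A \<Longrightarrow> v \<in> A \<Longrightarrow> u * v = 1 \<Longrightarrow> u \<notin> P"
  using P_mult'[of u v] one_notin_P by auto

lemma of_int_notin_P:
  assumes "\<not> int p dvd k"
  shows "of_int k \<notin> P"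
proof
  assume k: "of_int k \<in> P"
  have "coprime (int p) k"
    using assms p_prime by (simp add: prime_imp_coprime)
  then obtain x y where xy: "x * int p + y * k = 1"
    using bezout_int[of "int p" k] by (auto simp: coprime_iff_gcd_eq_1)
  have "of_int x * of_nat p + of_int y * of_int k \<in> P"
    using k p_in_P by (intro P_add P_mult) auto
  also have "of_int x * of_nat p + of_int y * of_int k = (of_int (x * int p + y * k) :: complex)"
    by simp
  finally show False
    using one_notin_P by (simp add: xy)
qed

lemma of_nat_notin_P: "\<not> p dvd k \<Longrightarrow> of_nat k \<notin> P"
  using of_int_notin_P[of "int k"] by simp

lemma unif_in_P: "unif p \<in> P"
proof -
  obtain e u v where e: "e > 0" "u \<in> A" "v \<in> A" "u * v = 1" "of_nat p = u * unif p ^ e"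
    by (rule prime_eq_unit_unif_power[OF p_prime])
  have "v * of_nat p = (u * v) * unif p ^ e"
    by (simp add: e(5) mult_ac)
  then have "unif p ^ e \<in> P"
    using P_mult[OF p_in_P e(3)] by (simp add: e(4))
  then show ?thesis
    using P_power[OF unif_in_A[OF p_prime]] by blast
qed

lemma image_unif_subset_P: "x \<in> (*) (unif p) ` A \<Longrightarrow> x \<in> P"
  using P_mult'[OF unif_in_P] by auto

text \<open>The filtration by the valuation at \<open>P\<close>, without localising: the denominators \<open>t\<close> are units at \<open>P\<close>.\<close>

definition V :: "nat \<Rightarrow> complex set" where
  "V k = {x \<in> A. \<exists>t\<in>A - P. t * x \<in> (*) (unif p ^ k) ` A}"

lemma notin_P_mult: "s \<in> A - P \<Longrightarrow> t \<in> A - P \<Longrightarrow> s * t \<in> A - P"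
  using P_prod by auto

lemma V_add: "x \<in> V k \<Longrightarrow> y \<in> V k \<Longrightarrow> x + y \<in> V k"
proof -
  assume "x \<in> V k" "y \<in> V k"
  then obtain s t where x: "x \<in> A" "s \<in> A - P" "s * x \<in> (*) (unif p ^ k) ` A"
    and y: "y \<in> A" "t \<in> A - P" "t * y \<in> (*) (unif p ^ k) ` A"
    unfolding V_def by blast
  have "t * (s * x) + s * (t * y) \<in> (*) (unif p ^ k) ` A"
    by (rule A.image_mult_add[OF A.image_mult_mult'[OF x(3)] A.image_mult_mult'[OF y(3)]]) (use x y in auto)
  then have "(s * t) * (x + y) \<in> (*) (unif p ^ k) ` A"
    by (simp add: algebra_simps)
  then show ?thesis
    unfolding V_def using notin_P_mult[OF x(2) y(2)] x(1) y(1) by blast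
qed

lemma V_mult: "x \<in> V k \<Longrightarrow> a \<in> A \<Longrightarrow> a * x \<in> V k"
proof -
  assume "x \<in> V k" and a: "a \<in> A"
  then obtain t where x: "x \<in> A" "t \<in> A - P" "t * x \<in> (*) (unif p ^ k) ` A"
    unfolding V_def by blast
  have "a * (t * x) \<in> (*) (unif p ^ k) ` A"
    using x(3) a by (rule A.image_mult_mult')
  then have "t * (a * x) \<in> (*) (unif p ^ k) ` A"
    by (simp add: mult_ac)
  then show ?thesis
    unfolding V_def using x a by blast
qed

lemma V_zero: "0 \<in> V k"
  unfolding V_def using one_notin_P by (auto intro!: bexI[of _ 1] image_eqI[of _ _ 0])

lemma V_sum: "(\<And>i. i \<in> I \<Longrightarrow> f i \<in> V k) \<Longrightarrow> sum f I \<in> V k"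
  by (induction I rule: infinite_finite_induct) (simp_all add: V_zero V_add)

text \<open>Upper bounds for valuations come from here: with \<open>s\<close> outside
  \<open>P\<close>, the valuation of \<open>unif p ^ j * s\<close> does not exceed
  \<open>j\<close>.\<close>

lemma unif_power_notin_V:
  assumes s: "s \<in> A - P" and jk: "j < k"
  shows "unif p ^ j * s \<notin> V k"
proof
  assume "unif p ^ j * s \<in> V k"
  then obtain t y where t: "t \<in> A - P" "y \<in> A" "t * (unif p ^ j * s) = unif p ^ k * y"
    unfolding V_def by blast
  have "unif p ^ k = unif p ^ j * (unif p * unif p ^ (k - Suc j))"
    using jk by (simp flip: power_add power_Suc)
  then have "unif p ^ j * (t * s) = unif p ^ j * (unif p * (unif p ^ (k - Suc j) * y))"
    using t(3) by (simp add: mult_ac)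
  then have "t * s = unif p * (unif p ^ (k - Suc j) * y)"
    using mult_left_cancel[of "unif p ^ j"] unif_nonzero[OF p_prime] by (metis power_not_zero)
  moreover have "unif p ^ (k - Suc j) * y \<in> A"
    using t(2) unif_in_A[OF p_prime] by (intro A.mult_closed A.power_closed)
  ultimately have "t * s \<in> P"
    using P_mult'[OF unif_in_P] by simp
  then show False
    using notin_P_mult[OF t(1) s] by simp
qed

text \<open>For \<open>x \<in> P\<close> the factor \<open>t = 1 - x ^ (q - 1)\<close> lies outside
  \<open>P\<close>, and \<open>t * x = - (x ^ q - x)\<close> is a multiple of
  \<open>unif p\<close>.\<close>

lemma P_subset_V_1: "P \<subseteq> V 1"
proof
  fix x assume x: "x \<in> P"
  then have xA: "x \<in> A"
    using P_subset_A by blast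
  obtain q where q: "q \<ge> 2" "\<And>y. y \<in> A \<Longrightarrow> y ^ q - y \<in> (*) (unif p) ` A"
    using unif_frobenius[OF p_prime] by metis
  have "x ^ (q - 1) = x * x ^ (q - 2)"
    using q(1) by (rule power_diff_1_eq_mult)
  then have "x ^ (q - 1) \<in> P"
    using P_mult'[OF x, of "x ^ (q - 2)"] xA by auto
  then have "1 - x ^ (q - 1) \<notin> P"
    using P_add[of "1 - x ^ (q - 1)" "x ^ (q - 1)"] one_notin_P by auto
  moreover have "x ^ (q - 1) * x = x ^ q"
    using q(1) by (intro power_minus_mult) simp
  then have "(1 - x ^ (q - 1)) * x = - (x ^ q - x)"
    by (simp add: algebra_simps)
  then have "(1 - x ^ (q - 1)) * x \<in> (*) (unif p ^ 1) ` A"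
    using A.image_mult_uminus[OF q(2)[OF xA]] by simp
  moreover have "1 - x ^ (q - 1) \<in> A"
    using xA by auto
  ultimately show "x \<in> V 1"
    unfolding V_def using xA by blast
qed

abbreviation P_power_ideal :: "nat \<Rightarrow> complex set" where
  "P_power_ideal k \<equiv> P [^]\<^bsub>ideals_set R\<^esub> k"

lemma P_power_ideal_simps:
  "P_power_ideal 0 = A" "P_power_ideal (Suc k) = ideal_prod R (P_power_ideal k) P"
  by (simp_all add: nat_pow_def ideals_set_def R_simps)

lemma ideal_P_power: "ideal (P_power_ideal k) R"
proof (induction k)
  case 0
  then show ?case
    unfolding P_power_ideal_simps(1) using R.oneideal by (simp add: R_simps)
next
  case (Suc k)
  then show ?case
    unfolding P_power_ideal_simps(2) using ideal_P by (rule R.ideal_prod_is_ideal)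
qed

lemma power_in_P_power: "x \<in> P \<Longrightarrow> x ^ k \<in> P_power_ideal k"
proof (induction k)
  case 0
  then show ?case
    unfolding P_power_ideal_simps(1) by simp
next
  case (Suc k)
  then have "monoid.mult R (x ^ k) x \<in> P_power_ideal (Suc k)"
    unfolding P_power_ideal_simps(2) by (intro ideal_prod.prod)
  then show ?case
    by (simp add: R_simps mult.commute)
qed

lemma ideal_power_subset_V: "P_power_ideal k \<subseteq> V k"
proof (induction k)
  case 0
  show ?case
    unfolding P_power_ideal_simps V_def using one_notin_P by (auto intro!: bexI[of _ 1])
next
  case (Suc k)
  show ?case
  proof
    fix x assume "x \<in> P_power_ideal (Suc k)"
    then show "x \<in> V (Suc k)"
      unfolding P_power_ideal_simps(2)
    proof (induction rule: ideal_prod.induct)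
      case (prod i j)
      obtain s y where s: "i \<in> A" "s \<in> A - P" "y \<in> A" "s * i = unif p ^ k * y"
        using prod(1) Suc unfolding V_def by blast
      obtain t y' where t: "j \<in> A" "t \<in> A - P" "y' \<in> A" "t * j = unif p ^ 1 * y'"
        using prod(2) P_subset_V_1 unfolding V_def by blast
      have "(s * t) * (i * j) = (s * i) * (t * j)"
        by (simp add: mult_ac)
      also have "\<dots> = unif p ^ Suc k * (y * y')"
        unfolding s(4) t(4) by (simp add: mult_ac)
      finally have "(s * t) * (i * j) \<in> (*) (unif p ^ Suc k) ` A"
        using s(3) t(3) by auto
      then have "i * j \<in> V (Suc k)"
        unfolding V_def using notin_P_mult[OF s(2) t(2)] s(1) t(1) by blast
      then show ?case
        by (simp add: R_simps)
    next
      case (sum s1 s2)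
      then show ?case
        using V_add by (simp add: R_simps)
    qed
  qed
qed

text \<open>For the converse inclusion let \<open>t * x\<close> be a multiple of
  \<open>unif p ^ k\<close> with \<open>t\<close> outside \<open>P\<close>. Then
  \<open>s = 1 - t ^ (q - 1)\<close> lies in \<open>P\<close>, and \<open>1 - s ^ k\<close> is a
  multiple of \<open>t\<close>. In \<open>x = x * (1 - s ^ k) + x * s ^ k\<close> both terms belong
  to the \<open>k\<close>-th power of \<open>P\<close>.\<close>

lemma ideal_power_eq: "P_power_ideal k = V k"
proof
  show "P_power_ideal k \<subseteq> V k"
    by (rule ideal_power_subset_V)
  show "V k \<subseteq> P_power_ideal k"
  proof
    fix x assume "x \<in> V k"
    then obtain t y where x: "x \<in> A" and t: "t \<in> A" "t \<notin> P" and y: "y \<in> A" "t * x = unif p ^ k * y"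
      unfolding V_def by blast
    note I = ideal_P_power[of k, unfolded ideal_R_iff]
    obtain q where q: "q \<ge> 2" "\<And>y. y \<in> A \<Longrightarrow> y ^ q - y \<in> (*) (unif p) ` A"
      using unif_frobenius[OF p_prime] by metis
    have tq: "t ^ (q - 1) = t * t ^ (q - 2)"
      using q(1) by (rule power_diff_1_eq_mult)
    define s where "s = 1 - t ^ (q - 1)"
    have sA: "s \<in> A"
      unfolding s_def using t by auto
    have "t ^ (q - 1) * t = t ^ q"
      using q(1) by (intro power_minus_mult) simp
    then have "t * s = - (t ^ q - t)"
      by (simp add: s_def algebra_simps)
    then have "t * s \<in> P"
      using A.image_mult_uminus[OF q(2)[OF t(1)]] image_unif_subset_P by simp
    then have "s \<in> P"
      using P_prod[OF t(1) sA] t(2) by blast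
    then have "s ^ k \<in> P_power_ideal k"
      by (rule power_in_P_power)
    then have 1: "x * s ^ k \<in> P_power_ideal k"
      using I x by blast
    define r where "r = t ^ (q - 2) * (\<Sum>i<k. s ^ i)"
    have "1 - s = t * t ^ (q - 2)"
      unfolding s_def tq[symmetric] by simp
    then have "1 - s ^ k = t * r"
      unfolding r_def one_minus_power_factor[of s k] by simp
    then have "x * (1 - s ^ k) = (t * x) * r"
      by (simp add: mult_ac)
    then have "x * (1 - s ^ k) = r * y * unif p ^ k"
      unfolding y(2) by (simp add: mult_ac)
    moreover have "x = x * (1 - s ^ k) + x * s ^ k"
      by (simp add: algebra_simps)
    ultimately have "x = r * y * unif p ^ k + x * s ^ k"
      by simp
    moreover have "unif p ^ k \<in> P_power_ideal k"
      using unif_in_P by (rule power_in_P_power)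
    moreover have "r * y \<in> A"
      unfolding r_def using t(1) sA y(1) by (intro A.mult_closed A.sum_closed A.power_closed)
    ultimately show "x \<in> P_power_ideal k"
      using I 1 by metis
  qed
qed

lemma ramification_index_eq:
  "ramification_index L K P = (GREATEST k. P \<inter> K \<subseteq> V k)"
proof -
  have "genideal R (P \<inter> K) \<subseteq> V k \<longleftrightarrow> P \<inter> K \<subseteq> V k" for k
  proof -
    have "P \<inter> K \<subseteq> carrier R"
      using P_subset_A by (auto simp: R_simps)
    then have "P \<inter> K \<subseteq> genideal R (P \<inter> K)"
      by (rule R.genideal_self)
    moreover have "ideal (V k) R"
      using ideal_P_power[of k] by (simp add: ideal_power_eq)
    ultimately show ?thesis
      using R.genideal_minimal[of "V k" "P \<inter> K"] by blast
  qed
  then show ?thesis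
    unfolding ramification_index_def integer_ring_L by (simp add: ideal_power_eq)
qed

text \<open>The index is a \<open>GREATEST\<close>, so the admissible exponents must be bounded
  first; each application obtains \<open>b\<close> from explicit elements of
  \<open>P \<inter> K\<close>.\<close>

lemma ramification_index_props:
  assumes "\<And>k. P \<inter> K \<subseteq> V k \<Longrightarrow> k \<le> b"
  shows "P \<inter> K \<subseteq> V (ramification_index L K P)" "ramification_index L K P \<ge> 1"
    "ramification_index L K P \<le> b" "\<And>k. P \<inter> K \<subseteq> V k \<Longrightarrow> k \<le> ramification_index L K P"
proof -
  have 1: "P \<inter> K \<subseteq> V 1"
    using P_subset_V_1 by blast
  show *: "P \<inter> K \<subseteq> V (ramification_index L K P)"
    unfolding ramification_index_eq using GreatestI_nat[of "\<lambda>k. P \<inter> K \<subseteq> V k" 1 b] 1 assms by blast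
  show le: "k \<le> ramification_index L K P" if "P \<inter> K \<subseteq> V k" for k
    unfolding ramification_index_eq using Greatest_le_nat[of "\<lambda>k. P \<inter> K \<subseteq> V k" k b] that assms by blast
  show "ramification_index L K P \<ge> 1"
    using le[OF 1] .
  show "ramification_index L K P \<le> b"
    using assms * by blast
qed

end

context cyclotomic_prime
begin

lemma P_sum: "(\<And>i. i \<in> I \<Longrightarrow> f i \<in> P) \<Longrightarrow> sum f I \<in> P"
  by (induction I rule: infinite_finite_induct) (simp_all add: zero_in_P P_add)

lemma P_power_diff:
  assumes "a \<in> A" "b \<in> A" "a - b \<in> P"
  shows "a ^ k - b ^ k \<in> P"
proof (induction k)
  case (Suc k)
  have "a ^ Suc k - b ^ Suc k = a ^ k * (a - b) + b * (a ^ k - b ^ k)"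
    by (simp add: algebra_simps)
  also have "\<dots> \<in> P"
    using assms Suc by (intro P_add P_mult) auto
  finally show ?case .
qed (simp add: zero_in_P)

lemma V_subset_P:
  assumes "k > 0"
  shows "V k \<subseteq> P"
proof
  fix x assume "x \<in> V k"
  then obtain t y where t: "x \<in> A" "t \<in> A - P" "y \<in> A" "t * x = unif p ^ k * y"
    unfolding V_def by blast
  have "unif p ^ k = unif p * unif p ^ (k - 1)"
    using power_minus_mult[OF assms, of "unif p"] by (simp add: mult.commute)
  then have "t * x = unif p * (unif p ^ (k - 1) * y)"
    unfolding t(4) by (simp add: mult_ac)
  moreover have "unif p ^ (k - 1) * y \<in> A"
    using t(3) unif_in_A[OF p_prime] by (intro A.mult_closed A.power_closed)
  ultimately have "t * x \<in> P"
    using P_mult'[OF unif_in_P] by simp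
  then show "x \<in> P"
    using P_prod[of t x] t(1,2) by auto
qed

end

section \<open>Tame ramification\<close>

context cyclotomic_subfield
begin

text \<open>If \<open>p\<close> divides \<open>n\<close>, the traces of
  \<open>y * zeta (m p) ^ j\<close> lie in \<open>P \<inter> K\<close>, and a combination of them
  over \<open>A\<close> is \<open>unif p ^ (p - 1)\<close> times an element outside
  \<open>P\<close>. This bounds the index by \<open>p - 1\<close>.\<close>

lemma not_dvd_ramification_index:
  assumes P: "primeideal P R" and p: "prime (p::nat)" "of_nat p \<in> P"
    and I: "\<not> p dvd card (I p)"
  shows "\<not> p dvd ramification_index L K P"
proof -
  interpret Pr: cyclotomic_prime n P p
    by (intro cyclotomic_prime.intro cyclotomic_prime_axioms.intro cyclotomic_axioms P p)
  show ?thesis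
  proof (cases "p dvd n")
    case False
    \<comment> \<open>Here \<open>unif p\<close> is \<open>p\<close> itself, an element of
      \<open>P \<inter> K\<close>.\<close>
    have "k \<le> 1" if "P \<inter> K \<subseteq> Pr.V k" for k
    proof (rule ccontr)
      assume "\<not> k \<le> 1"
      then have "unif p ^ 1 * 1 \<notin> Pr.V k"
        using Pr.one_notin_P by (intro Pr.unif_power_notin_V) auto
      moreover have "of_nat p \<in> P \<inter> K"
        using p(2) by simp
      ultimately show False
        using that False by (auto simp: unif_def)
    qed
    then have "ramification_index L K P = 1"
      using Pr.ramification_index_props(2,3)[of K 1] by simp
    then show ?thesis
      using prime_gt_1_nat[OF p(1)] by simp
  next
    case True
    define z where "z = zeta (p ^ multiplicity p n)"
    have zA: "z ^ i \<in> A" for i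
      unfolding z_def by (rule zeta_divisor_in_A[OF ppow_dvd[OF p(1)]])
    have pi: "unif p = 1 - z"
      using True by (simp add: unif_def z_def)
    define u where "u c = (\<Sum>i<c. z ^ i)" for c
    have uA: "u c \<in> A" for c
      unfolding u_def using zA by (intro A.sum_closed)
    \<comment> \<open>The exponent removes the dependence on \<open>c\<close>:
      \<open>\<sigma> c (unif p) = unif p * u c\<close> with \<open>u c\<close> congruent to
      \<open>c\<close> modulo \<open>P\<close>, so \<open>u c ^ (p - 1)\<close> is congruent to 1 by
      Fermat. The sum of these powers over \<open>I p\<close> is then \<open>card (I p)\<close>
      modulo \<open>P\<close>.\<close>
    define y where "y = unif p ^ (p - 1)"
    have yA: "y \<in> A"
      unfolding y_def using unif_in_A[OF p(1)] by (intro A.power_closed)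
    have sigma_y: "\<sigma> c y = unif p ^ (p - 1) * u c ^ (p - 1)" if "c \<in> H" for c
    proof -
      have c: "coprime c n"
        using that by (rule H_coprime)
      have L: "1 \<in> L" "z \<in> L" "unif p \<in> L"
        using zA[of 1] A_subset_L unif_in_A[OF p(1)] by auto
      have "\<sigma> c (unif p) = 1 - z ^ c"
        using sigma_diff[OF c L(1,2)] sigma_zeta_divisor[OF c ppow_dvd[OF p(1)], of 1] sigma_rat[OF c, of 1]
        by (simp add: pi z_def)
      also have "\<dots> = unif p * u c"
        unfolding pi u_def by (rule one_minus_power_factor)
      finally show ?thesis
        unfolding y_def by (simp add: sigma_power[OF c L(3)] power_mult_distrib)
    qed
    have u1: "u c ^ (p - 1) - 1 \<in> P" if "c \<in> H" for c
    proof -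
      have "u c - of_nat c = (\<Sum>i<c. - (1 - z ^ i))"
        by (simp add: u_def sum_subtractf)
      also have "\<dots> \<in> P"
      proof (rule Pr.P_sum)
        fix i
        have "1 - z ^ i = unif p * (\<Sum>j<i. z ^ j)"
          unfolding pi by (rule one_minus_power_factor)
        moreover have "(\<Sum>j<i. z ^ j) \<in> A"
          using zA by (intro A.sum_closed)
        ultimately have "1 - z ^ i \<in> P"
          using Pr.P_mult'[OF Pr.unif_in_P] by simp
        then show "- (1 - z ^ i) \<in> P"
          using Pr.P_diff[OF Pr.zero_in_P] by fastforce
      qed
      finally have "u c ^ (p - 1) - of_nat c ^ (p - 1) \<in> P"
        using uA by (intro Pr.P_power_diff) auto
      moreover have "of_nat c ^ (p - 1) - 1 \<in> P"
      proof -
        have "\<not> p dvd c"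
          using H_coprime[OF that] True p(1) by (meson coprime_common_divisor not_prime_unit)
        then have "[c ^ (p - 1) = 1] (mod p)"
          by (rule fermat_theorem[OF p(1)])
        moreover have "1 \<le> c ^ (p - 1)"
          using \<open>\<not> p dvd c\<close> by (cases c) auto
        ultimately obtain l where l: "c ^ (p - 1) = l * p + 1"
          using cong_le_nat by blast
        have "(of_nat c ^ (p - 1) :: complex) = of_nat (l * p + 1)"
          by (simp only: of_nat_power[symmetric] l)
        then have "of_nat c ^ (p - 1) - 1 = of_nat l * (of_nat p :: complex)"
          by simp
        then show ?thesis
          using Pr.P_mult[OF p(2)] by simp
      qed
      ultimately have "(u c ^ (p - 1) - of_nat c ^ (p - 1)) + (of_nat c ^ (p - 1) - 1) \<in> P"
        by (rule Pr.P_add)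
      then show ?thesis
        by simp
    qed
    define g where "g = (\<Sum>c\<in>I p. u c ^ (p - 1))"
    have gA: "g \<in> A"
      unfolding g_def using uA by (intro A.sum_closed A.power_closed)
    have "g \<notin> P"
    proof
      assume "g \<in> P"
      have "g - of_nat (card (I p)) = (\<Sum>c\<in>I p. u c ^ (p - 1) - 1)"
        by (simp add: g_def sum_subtractf)
      also have "\<dots> \<in> P"
        using u1 I_subset_H by (intro Pr.P_sum) auto
      finally have "g - (g - of_nat (card (I p))) \<in> P"
        using \<open>g \<in> P\<close> Pr.P_diff by blast
      then show False
        using Pr.of_nat_notin_P[OF I] by simp
    qed
    obtain f v k' where f: "coeffs_in A f" "v \<in> A" "poly f (zeta (m p)) * v = of_nat (m p ^ k')"
      "\<And>c. c \<in> H \<Longrightarrow> \<not> [c = 1] (mod m p) \<Longrightarrow> poly f (zeta (m p) ^ c) = 0"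
      using separating_polynomial[of p] by metis
    have fA: "poly f (zeta (m p)) \<in> A"
      using f(1) zeta_divisor_in_A[OF m_dvd, of p 1] by auto
    have "poly f (zeta (m p)) \<notin> P"
    proof
      assume "poly f (zeta (m p)) \<in> P"
      then have "of_nat (m p ^ k') \<in> P"
        using Pr.P_mult'[OF _ f(2)] f(3) by metis
      moreover have "\<not> p dvd m p ^ k'"
        using not_dvd_m[OF p(1)] prime_dvd_power[OF p(1)] by blast
      ultimately show False
        using Pr.of_nat_notin_P by blast
    qed
    then have fg: "poly f (zeta (m p)) * g \<in> A - P"
      using \<open>g \<notin> P\<close> fA gA by (intro Pr.notin_P_mult) auto
    have sum: "(\<Sum>j\<le>degree f. coeff f j * T (y * zeta (m p) ^ j)) = unif p ^ (p - 1) * (poly f (zeta (m p)) * g)"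
    proof -
      have "(\<Sum>c\<in>I p. \<sigma> c y) = unif p ^ (p - 1) * g"
        unfolding g_def sum_distrib_left using sigma_y I_subset_H by (intro sum.cong) auto
      then show ?thesis
        using T_separating[OF f(1) yA f(4)] by (simp add: mult_ac)
    qed
    have TP: "T (y * zeta (m p) ^ j) \<in> P \<inter> K" for j
    proof
      have zmA: "zeta (m p) ^ j \<in> A"
        by (rule zeta_divisor_in_A[OF m_dvd])
      show "T (y * zeta (m p) ^ j) \<in> K"
        using T_in_K yA zmA A_subset_L by blast
      show "T (y * zeta (m p) ^ j) \<in> P"
        unfolding T_def
      proof (rule Pr.P_sum)
        fix c assume c: "c \<in> H"
        have "unif p ^ (p - 1) = unif p ^ (p - 2) * unif p"
          using power_diff_1_eq_mult[OF prime_ge_2_nat[OF p(1)], of "unif p"] by (simp add: mult.commute)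
        then have "unif p ^ (p - 1) \<in> P"
          using Pr.P_mult[OF Pr.unif_in_P] unif_in_A[OF p(1)] by auto
        then have "\<sigma> c y \<in> P"
          unfolding sigma_y[OF c] using uA by (intro Pr.P_mult' A.power_closed)
        have "\<sigma> c (zeta (m p) ^ j) \<in> A"
          using sigma_in_A[OF H_coprime[OF c] zmA] .
        show "\<sigma> c (y * zeta (m p) ^ j) \<in> P"
        proof -
          have "y \<in> L" "zeta (m p) ^ j \<in> L"
            using yA zmA A_subset_L by auto
          then have "\<sigma> c (y * zeta (m p) ^ j) = \<sigma> c y * \<sigma> c (zeta (m p) ^ j)"
            by (rule sigma_mult[OF H_coprime[OF c]])
          then show ?thesis
            using Pr.P_mult' \<open>\<sigma> c y \<in> P\<close> \<open>\<sigma> c (zeta (m p) ^ j) \<in> A\<close> by simp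
        qed
      qed
    qed
    have bound: "k \<le> p - 1" if "P \<inter> K \<subseteq> Pr.V k" for k
    proof (rule ccontr)
      assume "\<not> k \<le> p - 1"
      then have "unif p ^ (p - 1) * (poly f (zeta (m p)) * g) \<notin> Pr.V k"
        using fg by (intro Pr.unif_power_notin_V) auto
      moreover have "(\<Sum>j\<le>degree f. coeff f j * T (y * zeta (m p) ^ j)) \<in> Pr.V k"
        using TP that f(1) by (intro Pr.V_sum Pr.V_mult) (auto simp: coeffs_in_def)
      ultimately show False
        by (simp add: sum)
    qed
    have "0 < ramification_index L K P" "ramification_index L K P < p"
      using Pr.ramification_index_props(2,3)[of K "p - 1", OF bound] prime_gt_1_nat[OF p(1)] by auto
    then show ?thesis
      by (auto dest: dvd_imp_le)
  qed
qed

theorem tamely_ramified_if: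
  assumes "\<And>p. prime (p::nat) \<Longrightarrow> \<not> p dvd card (I p)"
  shows "tamely_ramified L K"
  unfolding tamely_ramified_def wildly_ramified_at_def integer_ring_L
  using not_dvd_ramification_index assms by blast

end

lemma sum_reflect: "(\<Sum>i\<in>{Suc k..<2 * k}. f i) = (\<Sum>i\<in>{1..<k}. f (2 * k - i))"
  by (rule sum.reindex_bij_witness[of _ "\<lambda>j. 2 * k - j" "\<lambda>j. 2 * k - j"]) auto

section \<open>The involution in the inertia group at two\<close>

locale wild_cyclotomic = even_cyclotomic n e M for n e M +
  fixes s :: nat
  assumes e3: "e \<ge> 3" and s_coprime: "coprime s n" and s_M: "[s = 1] (mod M)"
    and s_N: "[s + 1 = 0] (mod 2 ^ (e - 1))" and e_eq: "e = multiplicity 2 n"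
begin

text \<open>The sign of the involution, which maps \<open>z\<close> to
  \<open>\<epsilon> / z\<close>.\<close>

definition \<epsilon> :: complex where "\<epsilon> = z ^ (s + 1)"

lemma eps_cases: "\<epsilon> = 1 \<or> \<epsilon> = -1"
proof -
  obtain t where "s + 1 = N * t"
    using s_N unfolding cong_0_iff by (rule dvdE)
  then have "\<epsilon> = (-1) ^ t"
    unfolding \<epsilon>_def by (simp only: power_mult z_N)
  then show ?thesis
    using minus_one_power_iff[of t] by (auto split: if_splits)
qed

lemma eps_even: "even k \<Longrightarrow> \<epsilon> ^ k = 1"
  using eps_cases by auto

lemma eps_in_B: "\<epsilon> ^ k \<in> B"
  using eps_cases by (auto intro!: B.power_closed B.uminus_closed)

lemma sigma_z_mult: "\<sigma> s (z ^ i) * z ^ i = \<epsilon> ^ i"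
proof -
  have "\<sigma> s (z ^ i) * z ^ i = z ^ (s * i + i)"
    by (simp add: sigma_z[OF s_coprime] power_add)
  also have "s * i + i = (s + 1) * i"
    by simp
  finally show ?thesis
    by (simp only: \<epsilon>_def power_mult)
qed

lemma sigma_z_eq:
  assumes "i \<le> N"
  shows "\<sigma> s (z ^ i) = - (\<epsilon> ^ i * z ^ (N - i))"
proof -
  have "z ^ (N - i) * z ^ i = -1"
    using assms z_N by (simp flip: power_add)
  then have "- (\<epsilon> ^ i * z ^ (N - i)) * z ^ i = \<epsilon> ^ i"
    by (simp add: mult.assoc)
  then have "\<sigma> s (z ^ i) * z ^ i = - (\<epsilon> ^ i * z ^ (N - i)) * z ^ i"
    by (simp add: sigma_z_mult)
  moreover have "z ^ i \<noteq> 0"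
    by simp
  ultimately show ?thesis
    using mult_right_cancel by blast
qed

abbreviation h :: nat where "h \<equiv> 2 ^ (e - 2)"

lemma N_eq: "N = 2 * h" and even_h: "even h" and even_N: "even N" and h_pos: "h > 0"
proof -
  obtain d where d: "e = d + 3"
    using e3 by (metis add.commute le_Suc_ex)
  show "N = 2 * h" "even h" "even N" "h > 0"
    by (simp_all add: d)
qed

lemma sigma_B: "b \<in> B \<Longrightarrow> \<sigma> s b = b"
  using sigma_F[OF s_coprime s_M] B_subset_F by auto

lemma B_subset_L: "B \<subseteq> L"
  using B_subset_A A_subset_L by auto

lemma z_in_L: "z ^ i \<in> L"
  using z_in_A A_subset_L by auto

lemma sigma_B_z: "b \<in> B \<Longrightarrow> \<sigma> s (b * z ^ i) = b * \<sigma> s (z ^ i)"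
  using sigma_mult[OF s_coprime, of b "z ^ i"] sigma_B B_subset_L z_in_L by auto

text \<open>The involution sends \<open>z ^ i\<close> to \<open>z ^ (N - i)\<close> up to sign,
  hence reflects the coefficients; by \<open>span_F_unique\<close> the reflected expansion of a
  fixed \<open>y\<close> agrees with the original one.\<close>

lemma fixed_coefficients:
  assumes a: "\<And>i. a i \<in> B" and y: "y = (\<Sum>i<N. a i * z ^ i)" and fixed: "\<sigma> s y = y"
    and i: "0 < i" "i < N"
  shows "a (N - i) = - (\<epsilon> ^ i * a i)"
proof -
  have N0: "{..<N} = insert 0 {1..<N}"
    by auto
  have "\<sigma> s y = (\<Sum>i<N. \<sigma> s (a i * z ^ i))"
    unfolding y using a B_subset_L z_in_L by (intro sigma_sum[OF s_coprime] L.mult_closed) auto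
  also have "\<dots> = (\<Sum>i<N. a i * \<sigma> s (z ^ i))"
    using a by (simp add: sigma_B_z)
  also have "\<dots> = a 0 + (\<Sum>i\<in>{1..<N}. a i * \<sigma> s (z ^ i))"
    unfolding N0 using sigma_z_mult[of 0] by simp
  also have "(\<Sum>i\<in>{1..<N}. a i * \<sigma> s (z ^ i)) = (\<Sum>i\<in>{1..<N}. - (\<epsilon> ^ i * a i) * z ^ (N - i))"
    by (intro sum.cong) (simp_all add: sigma_z_eq)
  also have "\<dots> = (\<Sum>j\<in>{1..<N}. - (\<epsilon> ^ (N - j) * a (N - j)) * z ^ j)"
    by (rule sum.reindex_bij_witness[of _ "\<lambda>j. N - j" "\<lambda>j. N - j"]) auto
  finally have "\<sigma> s y = a 0 + (\<Sum>j\<in>{1..<N}. - (\<epsilon> ^ (N - j) * a (N - j)) * z ^ j)" .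
  moreover have "y = a 0 + (\<Sum>j\<in>{1..<N}. a j * z ^ j)"
    unfolding y N0 by simp
  ultimately have "a 0 + (\<Sum>j\<in>{1..<N}. a j * z ^ j) = a 0 + (\<Sum>j\<in>{1..<N}. - (\<epsilon> ^ (N - j) * a (N - j)) * z ^ j)"
    using fixed by simp
  then have eq: "(\<Sum>j\<in>{1..<N}. (a j + \<epsilon> ^ (N - j) * a (N - j)) * z ^ j) = 0"
    by (simp add: distrib_right sum.distrib sum_negf)
  \<comment> \<open>The term at 0 is fixed by the reflection and cancels, so its coefficient is set
    to 0 to obtain a relation over the whole range.\<close>
  define b where "b j = (if j = 0 then 0 else a j + \<epsilon> ^ (N - j) * a (N - j))" for j
  have "(\<Sum>j<N. b j * z ^ j) = (\<Sum>j\<in>{1..<N}. (a j + \<epsilon> ^ (N - j) * a (N - j)) * z ^ j)"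
    unfolding N0 by (simp add: b_def)
  then have b_sum: "(\<Sum>j<N. b j * z ^ j) = 0"
    by (simp only: eq)
  have b_F: "b j \<in> F" for j
  proof -
    have "a j + \<epsilon> ^ (N - j) * a (N - j) \<in> B"
      using a eps_in_B by (intro B.add_closed B.mult_closed)
    then show ?thesis
      using B_subset_F by (auto simp: b_def)
  qed
  have "N - i < N"
    using i by (intro diff_less) simp_all
  then have "b (N - i) = 0"
    by (rule span_F_unique[OF b_F b_sum])
  moreover have "N - (N - i) = i"
    using i(2) by (intro diff_diff_cancel less_imp_le)
  moreover have "N - i \<noteq> 0"
    using i(2) by (simp only: diff_is_0_eq not_le)
  ultimately have "a (N - i) + \<epsilon> ^ i * a i = 0"
    by (simp only: b_def if_False)
  then show ?thesis
    by (simp only: eq_neg_iff_add_eq_0)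
qed

lemma fixed_representation:
  assumes a: "\<And>i. a i \<in> B" and y: "y = (\<Sum>i<N. a i * z ^ i)" and fixed: "\<sigma> s y = y"
  shows "y = a 0 + (\<Sum>i\<in>{1..<h}. a i * (z ^ i + \<sigma> s (z ^ i)))"
proof -
  note coeff = fixed_coefficients[OF a y fixed]
  have hN: "0 < h" "h < N" "N - h = h"
    using N_eq h_pos by simp_all
  \<comment> \<open>The middle index \<open>h\<close> is its own reflection; it is even because
    \<open>e \<ge> 3\<close>, so the sign \<open>\<epsilon> ^ h\<close> is 1.\<close>
  have "a h = - a h"
    using coeff[OF hN(1,2)] eps_even[OF even_h] hN(3) by simp
  then have ah: "a h = 0"
    by simp
  have split: "{..<N} = insert 0 {1..<h} \<union> (insert h {Suc h..<N})"
    using hN by auto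
  have "y = a 0 + (\<Sum>i\<in>{1..<h}. a i * z ^ i) + (\<Sum>i\<in>{Suc h..<N}. a i * z ^ i)"
    unfolding y split using hN by (subst sum.union_disjoint) (auto simp: ah)
  also have "(\<Sum>i\<in>{Suc h..<N}. a i * z ^ i) = (\<Sum>i\<in>{1..<h}. a (N - i) * z ^ (N - i))"
    unfolding N_eq by (rule sum_reflect)
  also have "\<dots> = (\<Sum>i\<in>{1..<h}. a i * \<sigma> s (z ^ i))"
    using hN coeff by (intro sum.cong) (auto simp: sigma_z_eq)
  finally show ?thesis
    by (simp add: distrib_left sum.distrib add.assoc)
qed

end

text \<open>Modulo \<open>y\<close>, the map \<open>x * x - 2\<close> sends 2 and -2 to 2. It is the
  doubling rule for \<open>\<tau>\<close> at even indices.\<close>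

lemma square_minus_two_divisible:
  assumes "complex_subring S" "x \<in> S" "y \<in> S" "x - 2 * d \<in> (*) y ` S" "d = 1 \<or> d = -1"
  shows "(x * x - 2) - 2 * 1 \<in> (*) y ` S"
proof -
  interpret complex_subring S by fact
  obtain t where t: "t \<in> S" "x = 2 * d + y * t"
    using assms(4) by (auto simp: algebra_simps)
  have dS: "d \<in> S" and dd: "d * d = 1"
    using assms(5) by (auto intro: uminus_closed)
  have "(x * x - 2) - 2 * 1 = 4 * (d * d) - 4 + y * (4 * d * t + t * (y * t))"
    unfolding t(2) by (simp add: algebra_simps)
  then have "(x * x - 2) - 2 * 1 = y * (4 * d * t + t * (y * t))"
    by (simp add: dd)
  moreover have "4 * d * t + t * (y * t) \<in> S"
    using t(1) dS assms(3) by (intro add_closed mult_closed) auto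
  ultimately show ?thesis
    by blast
qed

section \<open>The fixed integers as polynomials in one element\<close>

context wild_cyclotomic
begin

definition \<tau> :: "nat \<Rightarrow> complex" where "\<tau> i = z ^ i + \<sigma> s (z ^ i)"

definition \<theta> :: complex where "\<theta> = \<tau> 1"

definition R0 :: "complex set" where "R0 = adjoin B \<theta>"

sublocale R0: complex_subring R0
  unfolding R0_def by (rule B.complex_subring_adjoin)

lemma tau_eq: "\<tau> i = z ^ i + z ^ (s * i)"
  by (simp add: \<tau>_def sigma_z[OF s_coprime])

lemma tau_in_A: "\<tau> i \<in> A"
  unfolding tau_eq using z_in_A by (intro A.add_closed)

lemma theta_in_R0: "\<theta> \<in> R0"
  unfolding R0_def by (rule B.adjoin_generator)

lemma B_subset_R0: "B \<subseteq> R0"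
  unfolding R0_def by (rule B.adjoin_base)

lemma R0_subset_A: "R0 \<subseteq> A"
  unfolding R0_def \<theta>_def using tau_in_A B_subset_A by (intro adjoin_subset A.complex_subring_axioms)

lemma eps_in_R0: "\<epsilon> ^ k \<in> R0"
  using eps_in_B B_subset_R0 by auto

text \<open>\<open>z\<close> and \<open>z ^ s\<close> are the roots of
  \<open>X ^ 2 - \<theta> X + \<epsilon>\<close>, and \<open>\<tau>\<close> lists their power sums.
  The recursion puts all of them into the ring generated by \<theta>.\<close>

lemma tau_rec: "\<tau> (i + 2) = \<theta> * \<tau> (i + 1) - \<epsilon> * \<tau> i"
proof -
  have 1: "\<theta> * \<tau> (i + 1) = z * z ^ (i + 1) + z ^ s * z ^ (s * (i + 1)) + (z * z ^ s * z ^ (s * i) + z ^ s * z * z ^ i)"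
    unfolding \<theta>_def tau_eq by (simp add: algebra_simps power_add)
  have zs: "z * z ^ s = \<epsilon>"
    by (simp add: \<epsilon>_def)
  have "z * z ^ s * z ^ (s * i) + z ^ s * z * z ^ i = \<epsilon> * \<tau> i"
    unfolding tau_eq zs[symmetric] by (simp add: algebra_simps)
  with 1 have "\<theta> * \<tau> (i + 1) = z * z ^ (i + 1) + z ^ s * z ^ (s * (i + 1)) + \<epsilon> * \<tau> i"
    by simp
  moreover have "z * z ^ (i + 1) + z ^ s * z ^ (s * (i + 1)) = \<tau> (i + 2)"
    unfolding tau_eq by (simp add: algebra_simps power_add power2_eq_square)
  ultimately show ?thesis
    by simp
qed

lemma tau_in_R0: "\<tau> i \<in> R0"
proof (induction i rule: less_induct)
  case (less i)
  consider "i = 0" | "i = 1" | j where "i = j + 2"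
    by (metis One_nat_def add_2_eq_Suc' not0_implies_Suc)
  then show ?case
  proof cases
    case 1
    then have "\<tau> i = 1 + 1"
      by (simp add: tau_eq)
    then show ?thesis
      using R0.add_closed[OF R0.one_closed R0.one_closed] by simp
  next
    case 2
    then show ?thesis
      using theta_in_R0 by (simp add: \<theta>_def)
  next
    case 3
    show ?thesis
      unfolding 3 tau_rec using less[of "j + 1"] less[of j] 3 theta_in_R0 eps_in_R0[of 1]
      by (intro R0.diff_closed R0.mult_closed) auto
  qed
qed

lemma fixed_in_R0:
  assumes y: "y \<in> A" "\<sigma> s y = y"
  shows "y \<in> R0"
proof -
  obtain a where a: "\<forall>i. a i \<in> B" "y = (\<Sum>i<N. a i * z ^ i)"
    using y(1) unfolding A_eq_span_B span_B_def by blast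
  have "y = a 0 + (\<Sum>i\<in>{1..<h}. a i * \<tau> i)"
    unfolding \<tau>_def using a y(2) by (intro fixed_representation) auto
  also have "\<dots> \<in> R0"
    using a(1) B_subset_R0 tau_in_R0 by (intro R0.add_closed R0.sum_closed R0.mult_closed) auto
  finally show ?thesis .
qed

lemma tau_double: "\<tau> (2 * k) = \<tau> k * \<tau> k - 2 * \<epsilon> ^ k"
proof -
  have "z ^ k * z ^ (s * k) = \<epsilon> ^ k"
  proof -
    have "k + s * k = (s + 1) * k"
      by simp
    then show ?thesis
      by (simp only: \<epsilon>_def power_add[symmetric] power_mult[symmetric])
  qed
  then have "\<tau> k * \<tau> k = z ^ k * z ^ k + z ^ (s * k) * z ^ (s * k) + 2 * \<epsilon> ^ k"
    unfolding tau_eq by (simp add: algebra_simps)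
  moreover have "z ^ k * z ^ k + z ^ (s * k) * z ^ (s * k) = \<tau> (2 * k)"
    unfolding tau_eq by (simp add: mult_2 distrib_left power_add)
  ultimately show ?thesis
    by simp
qed

text \<open>Modulo \<theta>, doubling gives \<open>\<tau> 2 = - 2 \<epsilon>\<close>, and then 2 for
  all higher powers of two as index. But \<open>\<tau> h = 0\<close> for
  \<open>h = 2 ^ (e - 2)\<close>, so 2 is a multiple of \<theta>.\<close>

lemma two_in_theta_R0: "2 \<in> (*) \<theta> ` R0"
proof -
  have *: "\<exists>d. (d = 1 \<or> d = -1) \<and> \<tau> (2 ^ Suc k) - 2 * d \<in> (*) \<theta> ` R0" for k
  proof (induction k)
    case 0
    have "\<tau> (2 * 1) - 2 * (- \<epsilon>) = \<theta> * \<theta>"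
      unfolding tau_double \<theta>_def by simp
    then have eq: "\<tau> (2 ^ Suc 0) - 2 * (- \<epsilon>) = \<theta> * \<theta>"
      by simp
    have "\<tau> (2 ^ Suc 0) - 2 * (- \<epsilon>) \<in> (*) \<theta> ` R0"
      unfolding eq using theta_in_R0 by (rule imageI)
    then show ?case
      using eps_cases by (intro exI[of _ "- \<epsilon>"]) auto
  next
    case (Suc k)
    then obtain d where d: "d = 1 \<or> d = -1" "\<tau> (2 ^ Suc k) - 2 * d \<in> (*) \<theta> ` R0"
      by blast
    have "\<tau> (2 ^ Suc (Suc k)) = \<tau> (2 ^ Suc k) * \<tau> (2 ^ Suc k) - 2"
      using tau_double[of "2 ^ Suc k"] eps_even[of "2 ^ Suc k"] by simp
    then show ?case
      using square_minus_two_divisible[OF R0.complex_subring_axioms tau_in_R0 theta_in_R0 d(2,1)]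
      by (intro exI[of _ 1]) simp
  qed
  have "\<tau> h = 0"
  proof -
    have "h \<le> N" and Nh: "N - h = h"
      unfolding N_eq by simp_all
    then have "\<sigma> s (z ^ h) = - (\<epsilon> ^ h * z ^ (N - h))"
      by (intro sigma_z_eq)
    then have "\<sigma> s (z ^ h) = - (z ^ h)"
      unfolding Nh eps_even[OF even_h] by simp
    then show ?thesis
      unfolding \<tau>_def by simp
  qed
  moreover have "Suc (e - 3) = e - 2"
    using e3 by simp
  ultimately obtain d where d: "d = 1 \<or> d = -1" "- (2 * d) \<in> (*) \<theta> ` R0"
    using *[of "e - 3"] by auto
  from d show ?thesis
    using R0.image_mult_uminus[OF d(2)] by auto
qed

lemma two_prime: "prime (2 :: nat)"
  by simp

lemma even_n: "2 dvd n"
  unfolding n_decomp using e_pos by simp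

text \<open>\<open>z * \<theta> = z * z + \<epsilon>\<close> factors, up to sign, as
  \<open>(1 - x) * (1 + x)\<close>, with \<open>x = z\<close> for \<open>\<epsilon> = -1\<close> and
  \<open>x = z ^ (1 + h)\<close> for \<open>\<epsilon> = 1\<close>. Since
  \<open>- 1 = z ^ N\<close>, both factors have the form \<open>1 - z ^ k\<close> with
  \<open>k\<close> odd and are associated to \<open>unif 2\<close>.\<close>

lemma theta_unif:
  obtains \<eta> \<eta>' where "\<eta> \<in> A" "\<eta>' \<in> A" "\<eta> * \<eta>' = 1" "\<theta> = unif 2 ^ 2 * \<eta>"
proof -
  have unit: "\<exists>u v. u \<in> A \<and> v \<in> A \<and> u * v = 1 \<and> 1 - z ^ k = unif 2 * u" if k: "odd k" for k
  proof -
    obtain u v where "u \<in> A" "v \<in> A" "u * v = 1" "1 - zeta (2 ^ multiplicity 2 n) ^ k = unif 2 * u"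
      by (rule unit_one_minus_zeta[OF two_prime even_n k])
    then show ?thesis
      unfolding e_eq by metis
  qed
  have "z * \<theta> = z * z + \<epsilon>"
    unfolding \<theta>_def tau_eq by (simp add: \<epsilon>_def algebra_simps)
  moreover have "\<exists>c a b. odd a \<and> odd b \<and> c * c = 1 \<and> c \<in> A \<and> z * z + \<epsilon> = c * ((1 - z ^ a) * (1 - z ^ b))"
    using eps_cases
  proof
    assume eps: "\<epsilon> = -1"
    have "z ^ (1 + N) = - z"
      using z_N by simp
    then have "z * z + \<epsilon> = (-1) * ((1 - z ^ 1) * (1 - z ^ (1 + N)))"
      by (simp add: eps algebra_simps)
    moreover have "odd (1 + N)"
      using even_N by simp
    moreover have "(-1 :: complex) \<in> A"
      using A.uminus_closed by auto
    ultimately show ?thesis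
      by (intro exI[of _ "-1"] exI[of _ "1::nat"] exI[of _ "1 + N"]) simp
  next
    assume eps: "\<epsilon> = 1"
    have 1: "z ^ (1 + h + N) = - (z ^ (1 + h))"
      unfolding power_add[of z "1 + h" N] z_N by simp
    have "z ^ (1 + h) * z ^ (1 + h) = z * z * z ^ (2 * h)"
      by (simp add: power_add mult_2 mult_ac)
    also have "z ^ (2 * h) = -1"
      using z_N unfolding N_eq .
    finally have 2: "z ^ (1 + h) * z ^ (1 + h) = - (z * z)"
      by simp
    have "z * z + \<epsilon> = 1 * ((1 - z ^ (1 + h)) * (1 - z ^ (1 + h + N)))"
      unfolding 1 eps using 2 by (simp only: algebra_simps) simp
    moreover have "odd (1 + h)" "odd (1 + h + N)"
      using even_N even_h by simp_all
    ultimately show ?thesis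
      by (intro exI[of _ "1::complex"] exI[of _ "1 + h"] exI[of _ "1 + h + N"]) simp
  qed
  ultimately obtain c a b where c: "odd a" "odd b" "c * c = 1" "c \<in> A"
    "z * \<theta> = c * ((1 - z ^ a) * (1 - z ^ b))"
    by metis
  obtain u u' where u: "u \<in> A" "u' \<in> A" "u * u' = 1" "1 - z ^ a = unif 2 * u"
    using unit[OF c(1)] by blast
  obtain v v' where v: "v \<in> A" "v' \<in> A" "v * v' = 1" "1 - z ^ b = unif 2 * v"
    using unit[OF c(2)] by blast
  define z' where "z' = z ^ (2 ^ e - 1)"
  have z': "z' \<in> A" "z * z' = 1"
    using z_in_A power_minus_mult[of "2 ^ e" z] by (simp_all add: z'_def mult.commute)
  have "\<theta> = (z * z') * \<theta>"
    by (simp add: z'(2))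
  also have "\<dots> = z' * (z * \<theta>)"
    by (simp add: mult_ac)
  also have "\<dots> = unif 2 ^ 2 * (z' * c * u * v)"
    unfolding c(5) u(4) v(4) by (simp add: power2_eq_square mult_ac)
  finally have "\<theta> = unif 2 ^ 2 * (z' * c * u * v)" .
  moreover have "(z' * c * u * v) * (z * c * u' * v') = (z * z') * (c * c) * (u * u') * (v * v')"
    by (simp add: mult_ac)
  then have "(z' * c * u * v) * (z * c * u' * v') = 1"
    by (simp only: z' c u v mult_1)
  moreover have "z' * c * u * v \<in> A" "z * c * u' * v' \<in> A"
    using z' c u v z_in_A[of 1] by (auto intro!: A.mult_closed)
  ultimately show ?thesis
    using that by blast
qed

end

section \<open>Even valuations on the fixed ring\<close>

locale wild_prime = wild_cyclotomic + cyclotomic_prime n P 2 for P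
begin

lemma theta_in_P: "\<theta> \<in> P"
proof -
  obtain \<eta> \<eta>' where "\<eta> \<in> A" "\<theta> = unif 2 ^ 2 * \<eta>"
    by (rule theta_unif)
  then show ?thesis
    using P_mult'[OF unif_in_P, of "unif 2 * \<eta>"] unif_in_A[OF two_prime] by (auto simp: power2_eq_square mult.assoc)
qed

text \<open>The constant term \<open>b\<close> of \<open>x\<close> as a polynomial in \<theta> lies
  in \<open>P\<close>. As \<open>M\<close> is odd, \<open>unif_frobenius\<close> at level
  \<open>M\<close> holds modulo 2, so \<open>t = 1 - b ^ (q - 1)\<close> is outside \<open>P\<close>
  and \<open>t * b\<close> is in \<open>2 B\<close>; and 2 is a multiple of \<theta> in
  \<open>R0\<close>.\<close>

lemma R0_divide_theta:
  assumes x: "x \<in> R0" "x \<in> P"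
  obtains t x' where "t \<in> A - P" "x' \<in> R0" "t * x = \<theta> * x'"
proof -
  obtain g where g: "coeffs_in B g" "x = poly g \<theta>"
    using x(1) unfolding R0_def by (rule adjoinE)
  obtain b g' where g': "g = pCons b g'"
    by (cases g)
  have b: "b \<in> B" and g'B: "coeffs_in B g'"
    using g(1) by (simp_all add: g')
  define x1 where "x1 = poly g' \<theta>"
  have x1: "x1 \<in> R0"
    unfolding x1_def R0_def using g'B by (rule adjoinI)
  have xb: "x = b + \<theta> * x1"
    by (simp add: g(2) g' x1_def)
  have "x - \<theta> * x1 \<in> P"
    using x(2) P_mult'[OF theta_in_P, of x1] x1 R0_subset_A by (intro P_diff) auto
  then have bP: "b \<in> P"
    by (simp add: xb)
  obtain q where q: "q \<ge> 2" "\<And>y. y \<in> B \<Longrightarrow> y ^ q - y \<in> (*) (M.unif 2) ` B"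
    using M.unif_frobenius[OF two_prime] unfolding B_eq by metis
  have "M.unif 2 = 2"
    using odd_M by (simp add: M.unif_def)
  then obtain c where c: "c \<in> B" "b ^ q - b = 2 * c"
    using q(2)[OF b] by auto
  obtain d where d: "d \<in> R0" "2 = \<theta> * d"
    using two_in_theta_R0 by auto
  define t where "t = 1 - b ^ (q - 1)"
  have tB: "t \<in> B"
    unfolding t_def using b by auto
  have "b ^ (q - 1) = b * b ^ (q - 2)"
    using q(1) by (rule power_diff_1_eq_mult)
  then have "b ^ (q - 1) \<in> P"
    using P_mult'[OF bP, of "b ^ (q - 2)"] b B_subset_A by auto
  then have tP: "t \<notin> P"
    using P_add[of t "b ^ (q - 1)"] one_notin_P by (auto simp: t_def)
  have "b ^ (q - 1) * b = b ^ q"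
    using q(1) by (intro power_minus_mult) simp
  then have "t * b = - (b ^ q - b)"
    by (simp add: t_def algebra_simps)
  also have "\<dots> = \<theta> * (- (d * c))"
    unfolding c(2) d(2) by simp
  finally have "t * x = \<theta> * (- (d * c) + t * x1)"
    unfolding xb by (simp add: algebra_simps)
  moreover have "- (d * c) + t * x1 \<in> R0"
    using d(1) c(1) tB x1 B_subset_R0 by (intro R0.add_closed R0.uminus_closed R0.mult_closed) auto
  ultimately show ?thesis
    using that[of t] tB tP B_subset_A by blast
qed

text \<open>\<theta> has valuation 2, and elements of \<open>R0\<close> in \<open>P\<close> are
  multiples of \<theta> up to factors outside \<open>P\<close>. Dividing by \<theta> lowers the
  exponent by 2, down to the case of exponent 1.\<close>

lemma V_odd_R0:
  assumes "x \<in> R0" "x \<in> V (2 * j + 1)"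
  shows "x \<in> V (2 * j + 2)"
  using assms
proof (induction j arbitrary: x)
  case (0 x)
  obtain \<eta> \<eta>' where \<eta>: "\<eta> \<in> A" "\<eta>' \<in> A" "\<eta> * \<eta>' = 1" "\<theta> = unif 2 ^ 2 * \<eta>"
    by (rule theta_unif)
  have "x \<in> P"
    using 0 V_subset_P[of 1] by auto
  then obtain t x' where t: "t \<in> A - P" "x' \<in> R0" "t * x = \<theta> * x'"
    using R0_divide_theta 0 by blast
  have "t * x = unif 2 ^ 2 * (\<eta> * x')"
    unfolding t(3) \<eta>(4) by (simp add: mult.assoc)
  moreover have "\<eta> * x' \<in> A"
    using \<eta>(1) t(2) R0_subset_A by blast
  ultimately have "x \<in> V 2"
    unfolding V_def using t(1) 0(1) R0_subset_A by blast
  then show ?case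
    by (simp add: numeral_2_eq_2)
next
  case (Suc j x)
  obtain \<eta> \<eta>' where \<eta>: "\<eta> \<in> A" "\<eta>' \<in> A" "\<eta> * \<eta>' = 1" "\<theta> = unif 2 ^ 2 * \<eta>"
    by (rule theta_unif)
  have "x \<in> P"
    using Suc.prems(2) V_subset_P[of "2 * Suc j + 1"] by auto
  then obtain t x' where t: "t \<in> A - P" "x' \<in> R0" "t * x = \<theta> * x'"
    using R0_divide_theta Suc.prems(1) by blast
  have "t * x \<in> V (2 * Suc j + 1)"
    using t(1) Suc.prems(2) by (intro V_mult) auto
  then obtain r y where r: "r \<in> A - P" "y \<in> A" "r * (t * x) = unif 2 ^ (2 * Suc j + 1) * y"
    unfolding V_def by blast
  have pi0: "unif 2 ^ 2 \<noteq> 0"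
    using unif_nonzero[OF two_prime] by simp
  have "unif 2 ^ 2 * ((r * \<eta>) * x') = unif 2 ^ (2 * Suc j + 1) * y"
    using r(3) unfolding t(3) \<eta>(4) by (simp only: mult_ac)
  also have "\<dots> = unif 2 ^ 2 * (unif 2 ^ (2 * j + 1) * y)"
    by (simp add: power_add mult_ac power2_eq_square)
  finally have "(r * \<eta>) * x' = unif 2 ^ (2 * j + 1) * y"
    using mult_left_cancel[OF pi0] by blast
  moreover have "r * \<eta> \<in> A - P"
    using r(1) \<eta>(1) unit_notin_P[OF \<eta>(1,2,3)] by (intro notin_P_mult) auto
  ultimately have "x' \<in> V (2 * j + 1)"
    unfolding V_def using t(2) r(2) R0_subset_A by blast
  then have "x' \<in> V (2 * j + 2)"
    by (rule Suc.IH[OF t(2)])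
  then obtain r' y' where r': "r' \<in> A - P" "y' \<in> A" "r' * x' = unif 2 ^ (2 * j + 2) * y'"
    unfolding V_def by blast
  have "(r' * t) * x = unif 2 ^ 2 * \<eta> * (r' * x')"
    using t(3) \<eta>(4) by (simp add: mult_ac)
  also have "\<dots> = unif 2 ^ (2 * Suc j + 2) * (\<eta> * y')"
    unfolding r'(3) by (simp add: power_add mult_ac power2_eq_square)
  finally have "(r' * t) * x = unif 2 ^ (2 * Suc j + 2) * (\<eta> * y')" .
  moreover have "\<eta> * y' \<in> A"
    using \<eta>(1) r'(2) by blast
  ultimately show ?case
    unfolding V_def using notin_P_mult[OF r'(1) t(1)] Suc.prems(1) R0_subset_A by blast
qed

text \<open>An odd index could be raised by one, since \<open>P \<inter> K\<close> consists of
  elements of \<open>R0\<close>. The bound that makes the index meaningful is the valuation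
  \<open>E\<close> of 2.\<close>

lemma even_ramification_index:
  assumes K: "0 \<in> K" "2 \<in> K" and fixed: "\<And>x. x \<in> K \<Longrightarrow> \<sigma> s x = x"
  shows "even (ramification_index L K P)"
proof (rule ccontr)
  obtain E u v where E: "E > 0" "u \<in> A" "v \<in> A" "u * v = 1" "of_nat 2 = u * unif 2 ^ E"
    by (rule prime_eq_unit_unif_power[OF two_prime])
  have bound: "k \<le> E" if "P \<inter> K \<subseteq> V k" for k
  proof (rule ccontr)
    assume "\<not> k \<le> E"
    then have "unif 2 ^ E * u \<notin> V k"
      using E(2) unit_notin_P[OF E(2,3,4)] by (intro unif_power_notin_V) auto
    moreover have "unif 2 ^ E * u = 2"
      using E(5) by (simp add: mult.commute)
    ultimately show False
      using that K(2) p_in_P by auto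
  qed
  note props = ramification_index_props[of K E, OF bound]
  assume "odd (ramification_index L K P)"
  then obtain j where j: "ramification_index L K P = 2 * j + 1"
    by (rule oddE)
  have "P \<inter> K \<subseteq> V (2 * j + 2)"
  proof
    fix x assume x: "x \<in> P \<inter> K"
    then have "x \<in> V (2 * j + 1)"
      using props(1) unfolding j by blast
    moreover have "x \<in> R0"
      using x fixed P_subset_A by (intro fixed_in_R0) auto
    ultimately show "x \<in> V (2 * j + 2)"
      using V_odd_R0 by blast
  qed
  then have "2 * j + 2 \<le> 2 * j + 1"
    using props(4) unfolding j by blast
  then show False
    by simp
qed

end

lemma (in wild_cyclotomic) not_tamely_ramified:
  assumes K: "0 \<in> K" "2 \<in> K" and fixed: "\<And>x. x \<in> K \<Longrightarrow> \<sigma> s x = x"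
  shows "\<not> tamely_ramified L K"
proof -
  obtain P where P: "primeideal P R" "of_nat 2 \<in> P"
    by (rule exists_prime_ideal[OF two_prime])
  interpret wild_prime n e M s P
    by (intro wild_prime.intro cyclotomic_prime.intro cyclotomic_prime_axioms.intro
      wild_cyclotomic_axioms cyclotomic_axioms P two_prime)
  have "wildly_ramified_at L K P"
    unfolding wildly_ramified_at_def using even_ramification_index[OF K fixed] P(2)
    by (intro exI[of _ 2]) simp
  moreover have "P \<noteq> {0}"
    using P(2) by auto
  ultimately show ?thesis
    unfolding tamely_ramified_def integer_ring_L using P(1) by blast
qed

section \<open>The adjusted trace\<close>

text \<open>The condition \<open>c < \<phi> c\<close> selects one element of each two-element
  orbit.\<close>

lemma sum_involution:
  fixes g :: "nat \<Rightarrow> complex"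
  assumes H: "finite H" and \<phi>: "\<And>c. c \<in> H \<Longrightarrow> \<phi> c \<in> H" "\<And>c. c \<in> H \<Longrightarrow> \<phi> (\<phi> c) = c"
    "\<And>c. c \<in> H \<Longrightarrow> \<phi> c \<noteq> c" and g: "\<And>c. c \<in> H \<Longrightarrow> g (\<phi> c) = g c"
  shows "sum g H = 2 * sum g {c \<in> H. c < \<phi> c}"
proof -
  have split: "{c \<in> H. c < \<phi> c} \<union> {c \<in> H. \<phi> c < c} = H"
    using \<phi>(3) by (auto simp: not_less_iff_gr_or_eq)
  have "sum g {c \<in> H. \<phi> c < c} = sum g {c \<in> H. c < \<phi> c}"
    by (rule sum.reindex_bij_witness[of _ \<phi> \<phi>]) (use \<phi> g in auto)
  moreover have "sum g ({c \<in> H. c < \<phi> c} \<union> {c \<in> H. \<phi> c < c}) =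
      sum g {c \<in> H. c < \<phi> c} + sum g {c \<in> H. \<phi> c < c}"
  proof (rule sum.union_disjoint)
    show "finite {c \<in> H. c < \<phi> c}" "finite {c \<in> H. \<phi> c < c}"
      by (rule finite_subset[OF _ H], blast)+
    show "{c \<in> H. c < \<phi> c} \<inter> {c \<in> H. \<phi> c < c} = {}"
      using order.asym by blast
  qed
  ultimately show ?thesis
    unfolding split by simp
qed

section \<open>Half traces of fixed integers\<close>

locale wild_subfield = wild_cyclotomic n e M s + conductor_subfield n K for n e M s K +
  assumes s_H: "s \<in> H" and s_neq_1: "s \<noteq> Suc 0 mod n" and I_2: "I 2 = {Suc 0 mod n, s}"
    and s_square: "[s * s = 1] (mod n)"
begin

lemma M_eq: "M = m 2"
proof -
  have "n = 2 ^ multiplicity 2 n * M"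
    using n_decomp unfolding e_eq .
  then show ?thesis
    by (metis nonzero_mult_div_cancel_left power_not_zero zero_neq_numeral)
qed

lemma sigma_s_s: "x \<in> L \<Longrightarrow> \<sigma> s (\<sigma> s x) = x"
  using sigma_sigma[OF s_coprime s_coprime, of x] sigma_cong[of "s * s" "Suc 0" x] s_square sigma_1 by simp

definition Fix :: "complex set" where "Fix = {y \<in> A. \<sigma> s y = y}"

lemma B_subset_Fix: "B \<subseteq> Fix"
  using B_subset_A sigma_B by (auto simp: Fix_def)

lemma Fix_add: "x \<in> Fix \<Longrightarrow> y \<in> Fix \<Longrightarrow> x + y \<in> Fix"
  using sigma_add[OF s_coprime, of x y] A_subset_L by (auto simp: Fix_def)

lemma Fix_sum: "(\<And>i. i \<in> U \<Longrightarrow> f i \<in> Fix) \<Longrightarrow> sum f U \<in> Fix"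
proof (induction U rule: infinite_finite_induct)
  case (insert x U)
  then show ?case
    by (simp add: Fix_add)
qed (use B_subset_Fix in auto)

lemma Fix_trace:
  assumes "x \<in> A"
  shows "x + \<sigma> s x \<in> Fix"
proof -
  have "x \<in> L" "\<sigma> s x \<in> L" "\<sigma> s x \<in> A"
    using assms A_subset_L sigma_in_A[OF s_coprime] by auto
  then show ?thesis
    using assms sigma_add[OF s_coprime, of x "\<sigma> s x"] sigma_s_s[of x]
    by (auto simp: Fix_def)
qed

text \<open>Multiplication by \<open>s\<close> is an involution of \<open>H\<close> without fixed
  points, and it does not change the conjugates of \<open>y\<close>; half the trace is the sum over
  representatives of the orbits.\<close>

lemma half_T_Fix_in_A:
  assumes y: "y \<in> Fix"
  shows "1 / 2 * T y \<in> A"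
proof -
  have yA: "y \<in> A" and yL: "y \<in> L" and yfix: "\<sigma> s y = y"
    using y A_subset_L by (auto simp: Fix_def)
  have ss: "s * (s * c mod n) mod n = c" if "c \<in> H" for c
  proof -
    have "[s * s * c = 1 * c] (mod n)"
      using s_square by (rule cong_scalar_right)
    then have "s * s * c mod n = c"
      using H_less[OF that] by (simp add: cong_def)
    then show ?thesis
      by (simp add: mod_mult_right_eq mult.assoc)
  qed
  have neq: "s * c mod n \<noteq> c" if "c \<in> H" for c
  proof
    assume "s * c mod n = c"
    then have "[s * c = 1 * c] (mod n)"
      using H_less[OF that] by (simp add: cong_def)
    then have "[s = 1] (mod n)"
      using H_coprime[OF that] cong_mult_rcancel_nat by blast
    then show False
      using s_neq_1 H_less[OF s_H] by (simp add: cong_def)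
  qed
  have inv: "\<sigma> (s * c mod n) y = \<sigma> c y" if "c \<in> H" for c
  proof -
    have "\<sigma> (s * c mod n) y = \<sigma> (c * s) y"
      by (intro sigma_cong) (simp add: cong_def mult.commute)
    also have "\<dots> = \<sigma> c (\<sigma> s y)"
      using sigma_sigma[OF H_coprime[OF that] s_coprime yL] by simp
    finally show ?thesis
      by (simp add: yfix)
  qed
  have "T y = 2 * (\<Sum>c\<in>{c \<in> H. c < s * c mod n}. \<sigma> c y)"
    unfolding T_def
  proof (rule sum_involution)
    show "s * c mod n \<in> H" if "c \<in> H" for c
      using mult_in_H[OF s_H that] .
  qed (use ss neq inv in auto)
  moreover have "(\<Sum>c\<in>{c \<in> H. c < s * c mod n}. \<sigma> c y) \<in> A"
    using yA by (intro A.sum_closed sigma_in_A H_coprime) auto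
  ultimately show ?thesis
    by simp
qed

text \<open>On integers fixed by \<open>\<sigma> s\<close>, half the trace from \<open>L\<close> is
  the trace to \<open>K\<close> from the fixed field of \<open>\<sigma> s\<close>.\<close>

definition J :: "complex set" where "J = (\<lambda>y. 1 / 2 * T y) ` Fix"

lemma ideal_K_J: "ideal_K J"
  unfolding ideal_K_def
proof (intro conjI ballI)
  have FixL: "y \<in> L" if "y \<in> Fix" for y
    using that A_subset_L by (auto simp: Fix_def)
  show "0 \<in> J"
    unfolding J_def using T_rat[of 0] B_subset_Fix by (intro image_eqI[of _ _ 0]) auto
  show "J \<subseteq> K \<inter> A"
  proof
    fix x assume "x \<in> J"
    then obtain y where y: "y \<in> Fix" "x = 1 / 2 * T y"
      unfolding J_def by blast
    have "1 / 2 * T y \<in> K"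
      using T_in_K[OF FixL[OF y(1)]] by (intro K.mult_closed K.divide_closed) auto
    then show "x \<in> K \<inter> A"
      using half_T_Fix_in_A[OF y(1)] unfolding y(2) by blast
  qed
  fix x assume "x \<in> J"
  then obtain x' where x': "x' \<in> Fix" "x = 1 / 2 * T x'"
    unfolding J_def by blast
  show "x + y \<in> J" if y: "y \<in> J" for y
  proof -
    obtain y' where y': "y' \<in> Fix" "y = 1 / 2 * T y'"
      using y unfolding J_def by blast
    have "x + y = 1 / 2 * T (x' + y')"
      unfolding x'(2) y'(2) T_add[OF FixL[OF x'(1)] FixL[OF y'(1)]] by (simp only: distrib_left)
    then show ?thesis
      unfolding J_def using Fix_add[OF x'(1) y'(1)] by (rule image_eqI)
  qed
  show "a * x \<in> J" if a: "a \<in> K \<inter> A" for a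
  proof -
    have "\<sigma> s (a * x') = a * x'"
      using sigma_mult[OF s_coprime, of a x'] H_fixes[OF s_H, of a] a x'(1) FixL[OF x'(1)] K_subset_L
      by (auto simp: Fix_def)
    then have aF: "a * x' \<in> Fix"
      using a x'(1) by (auto simp: Fix_def)
    have "T (a * x') = a * T x'"
      using a FixL[OF x'(1)] by (intro T_mult) auto
    then have "a * x = 1 / 2 * T (a * x')"
      unfolding x'(2) by simp
    then show ?thesis
      unfolding J_def using aF by (rule image_eqI)
  qed
qed

lemma T_in_J:
  assumes x: "x \<in> A"
  shows "T x \<in> J"
proof -
  have "x \<in> L" "\<sigma> s x \<in> L"
    using x A_subset_L sigma_in_A[OF s_coprime] by auto
  then have "T (x + \<sigma> s x) = 2 * T x"
    by (simp add: T_add T_sigma[OF s_H])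
  then have "T x = 1 / 2 * T (x + \<sigma> s x)"
    by simp
  then show ?thesis
    unfolding J_def using Fix_trace[OF x] by (rule image_eqI)
qed

text \<open>At odd \<open>p\<close> the traces from \<open>A\<close> suffice, since they belong to
  \<open>J\<close>. At 2 the relation for traces has the value \<open>2 k\<close> with
  \<open>k\<close> odd; the powers of \<open>zeta (m 2)\<close> are themselves fixed, so their half
  traces belong to \<open>J\<close> and give the value \<open>k\<close>.\<close>

lemma J_eq: "J = K \<inter> A"
proof (rule ideal_K_eq_integers[OF ideal_K_J card_H_pos])
  show "of_nat (card H) \<in> J"
    using T_in_J[of 1] T_rat[of 1] by simp
next
  fix p :: nat assume p: "prime p"
  obtain f v k where f: "coeffs_in A f" "v \<in> A" "\<not> p dvd k"
    "(\<Sum>j\<le>degree f. T (zeta (m p) ^ j) * (coeff f j * v)) = of_nat (card (I p)) * of_nat k"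
    by (rule T_separating_unit[OF p])
  have zmA: "zeta (m p) ^ j \<in> A" for j
    by (rule zeta_divisor_in_A[OF m_dvd])
  have fv: "coeff f j * v \<in> A" for j
    using f(1,2) by (auto simp: coeffs_in_def)
  show "\<exists>U j a u. finite (U :: nat set) \<and> (\<forall>i\<in>U. j i \<in> J \<and> a i \<in> A) \<and>
      (\<Sum>i\<in>U. j i * a i) = of_int u \<and> \<not> int p dvd u"
  proof (cases "p = 2")
    case False
    have "\<not> p dvd card (I p) * k"
      using prime_not_dvd_card_I[OF p False] f(3) p prime_dvd_mult_nat by blast
    then have "\<not> int p dvd int (card (I p) * k)"
      unfolding int_dvd_int_iff .
    moreover have "(\<Sum>j\<le>degree f. T (zeta (m p) ^ j) * (coeff f j * v)) = of_int (int (card (I p) * k))"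
      using f(4) by simp
    moreover have "\<forall>j\<in>{..degree f}. T (zeta (m p) ^ j) \<in> J \<and> coeff f j * v \<in> A"
      using fv T_in_J[OF zmA] by blast
    ultimately show ?thesis
      by (intro exI[of _ "{..degree f}"] exI[of _ "\<lambda>j. T (zeta (m p) ^ j)"] exI[of _ "\<lambda>j. coeff f j * v"]
        exI[of _ "int (card (I p) * k)"] conjI finite_atMost)
  next
    case True
    have "card (I p) = 2"
      unfolding True I_2 using s_neq_1 by simp
    then have "(\<Sum>j\<le>degree f. T (zeta (m p) ^ j) * (coeff f j * v)) = 2 * of_nat k"
      using f(4) by simp
    moreover have "(\<Sum>j\<le>degree f. (1 / 2 * T (zeta (m p) ^ j)) * (coeff f j * v)) =
        1 / 2 * (\<Sum>j\<le>degree f. T (zeta (m p) ^ j) * (coeff f j * v))"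
      by (simp only: sum_distrib_left mult.assoc)
    ultimately have "(\<Sum>j\<le>degree f. (1 / 2 * T (zeta (m p) ^ j)) * (coeff f j * v)) = of_int (int k)"
      by simp
    moreover have "\<not> int p dvd int k"
      using f(3) unfolding int_dvd_int_iff .
    moreover have "1 / 2 * T (zeta (m p) ^ j) \<in> J" for j
      using w_in_B[of j] B_subset_Fix unfolding J_def True M_eq[symmetric] by blast
    then have "\<forall>j\<in>{..degree f}. 1 / 2 * T (zeta (m p) ^ j) \<in> J \<and> coeff f j * v \<in> A"
      using fv by blast
    ultimately show ?thesis
      by (intro exI[of _ "{..degree f}"] exI[of _ "\<lambda>j. 1 / 2 * T (zeta (m p) ^ j)"] exI[of _ "\<lambda>j. coeff f j * v"]
        exI[of _ "int k"] conjI finite_atMost)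
  qed
qed

definition adj :: "complex \<Rightarrow> complex" where
  "adj x = (\<Sum>i<N. \<Sum>j<totient M. of_rat (tensor_basis_coords e M x i j) *
    (if i = 0 then 1 / 2 * field_trace L K (w ^ j) else field_trace L K (z ^ i * w ^ j)))"

text \<open>The coordinates come from a \<open>SOME\<close>; grouped by powers of \<open>z\<close>
  they become coefficients in \<open>F\<close>, which are unique by \<open>span_F_unique\<close>. So
  the map can be computed from any expansion over \<open>B\<close>.\<close>

lemma adj_eq:
  assumes a: "\<And>i. a i \<in> B" and x: "x = (\<Sum>i<N. a i * z ^ i)"
  shows "adj x = 1 / 2 * T (a 0) + (\<Sum>i\<in>{1..<N}. T (a i * z ^ i))"
proof -
  have N0: "{..<N} = insert 0 {1..<N}"
    by auto
  define c where "c = tensor_basis_coords e M x"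
  have "\<exists>d :: nat \<Rightarrow> int. a i = (\<Sum>j<totient M. of_int (d j) * w ^ j)" for i
    using M.coords_exist[of "a i"] a[of i] unfolding B_eq by metis
  then obtain d :: "nat \<Rightarrow> nat \<Rightarrow> int" where d: "\<And>i. a i = (\<Sum>j<totient M. of_int (d i j) * w ^ j)"
    by metis
  have "x = (\<Sum>i<2 ^ (e - 1). \<Sum>j<totient M. of_rat (of_int (d i j)) * (zeta (2 ^ e) ^ i * zeta M ^ j))"
    unfolding x by (intro sum.cong refl, subst d) (simp add: sum_distrib_left sum_distrib_right mult_ac)
  then have c: "x = (\<Sum>i<N. \<Sum>j<totient M. of_rat (c i j) * (z ^ i * w ^ j))"
    unfolding c_def tensor_basis_coords_def by (rule someI[of _ "\<lambda>i j. of_int (d i j)"])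
  define a' where "a' i = (\<Sum>j<totient M. of_rat (c i j) * w ^ j)" for i
  have wF: "w ^ j \<in> F" for j
    using w_in_B B_subset_F by auto
  have ratF: "of_rat r \<in> F" for r
    using complex_subring.adjoin_base[OF complex_subring_Rats, of w] unfolding F_def by auto
  have a'F: "a' i \<in> F" for i
    unfolding a'_def using wF ratF by (intro F.sum_closed F.mult_closed)
  have "x = (\<Sum>i<N. a' i * z ^ i)"
    unfolding c a'_def by (intro sum.cong refl) (simp add: sum_distrib_left sum_distrib_right mult_ac)
  then have "(\<Sum>i<N. (a i - a' i) * z ^ i) = 0"
    using x by (simp add: left_diff_distrib sum_subtractf)
  then have "a i - a' i = 0" if "i < N" for i
    using a a'F B_subset_F that by (intro span_F_unique[of "\<lambda>i. a i - a' i"] F.diff_closed) auto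
  then have aa': "a i = a' i" if "i < N" for i
    using that by simp
  have wL: "w ^ j \<in> L" and zwL: "z ^ i * w ^ j \<in> L" for i j
    using w_in_A z_in_L A_subset_L by auto
  have Ti: "(\<Sum>j<totient M. of_rat (c i j) * T (z ^ i * w ^ j)) = T (a i * z ^ i)" if "i < N" for i
  proof -
    have "T (a i * z ^ i) = T (\<Sum>j<totient M. of_rat (c i j) * (z ^ i * w ^ j))"
      unfolding aa'[OF that] a'_def by (simp add: sum_distrib_left sum_distrib_right mult_ac)
    also have "\<dots> = (\<Sum>j<totient M. T (of_rat (c i j) * (z ^ i * w ^ j)))"
      using zwL L.of_rat_closed by (intro T_sum L.mult_closed[of "of_rat _"])
    also have "\<dots> = (\<Sum>j<totient M. of_rat (c i j) * T (z ^ i * w ^ j))"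
      using zwL K.of_rat_closed by (simp add: T_mult)
    finally show ?thesis ..
  qed
  have "(\<Sum>j<totient M. of_rat (c 0 j) * (1 / 2 * field_trace L K (w ^ j))) = 1 / 2 * T (a 0)"
  proof -
    have "(\<Sum>j<totient M. of_rat (c 0 j) * (1 / 2 * field_trace L K (w ^ j))) =
        1 / 2 * (\<Sum>j<totient M. of_rat (c 0 j) * T (z ^ 0 * w ^ j))"
      unfolding sum_distrib_left using field_trace_eq_sum_sigma[OF wL]
      by (intro sum.cong) (simp_all add: T_def)
    then show ?thesis
      using Ti[of 0] by simp
  qed
  moreover have "(\<Sum>i\<in>{1..<N}. \<Sum>j<totient M. of_rat (c i j) * field_trace L K (z ^ i * w ^ j)) =
      (\<Sum>i\<in>{1..<N}. T (a i * z ^ i))"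
    using Ti field_trace_eq_sum_sigma[OF zwL] by (intro sum.cong) (simp_all flip: T_def)
  moreover have "adj x = (\<Sum>j<totient M. of_rat (c 0 j) * (1 / 2 * field_trace L K (w ^ j))) +
      (\<Sum>i\<in>{1..<N}. \<Sum>j<totient M. of_rat (c i j) * field_trace L K (z ^ i * w ^ j))"
    unfolding adj_def N0 c_def by simp
  ultimately show ?thesis
    by simp
qed

lemma adj_image: "adj ` A = J"
proof (intro equalityI subsetI)
  fix t assume "t \<in> adj ` A"
  then obtain x where x: "x \<in> A" "t = adj x"
    by auto
  obtain a where a: "\<forall>i. a i \<in> B" "x = (\<Sum>i<N. a i * z ^ i)"
    using x(1) unfolding A_eq_span_B span_B_def by blast
  have az: "a i * z ^ i \<in> A" for i
    using a(1) B_subset_A z_in_A by (intro A.mult_closed) auto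
  have azL: "a i * z ^ i \<in> L" "\<sigma> s (a i * z ^ i) \<in> L" for i
    using az A_subset_L sigma_in_A[OF s_coprime az] by auto
  have a0L: "a 0 \<in> L"
    using a(1) B_subset_L by auto
  \<comment> \<open>Symmetrising every term except the one at 0 doubles its trace; the factor 1/2
    restores these and halves only \<open>T (a 0)\<close>.\<close>
  define y where "y = a 0 + (\<Sum>i\<in>{1..<N}. a i * z ^ i + \<sigma> s (a i * z ^ i))"
  have "y \<in> Fix"
    unfolding y_def by (rule Fix_add[OF _ Fix_sum[OF Fix_trace[OF az]]]) (use a(1) B_subset_Fix in auto)
  moreover have "T y = T (a 0) + (\<Sum>i\<in>{1..<N}. 2 * T (a i * z ^ i))"
    unfolding y_def using azL a0L
    by (subst T_add) (auto simp: T_sum T_add T_sigma[OF s_H] L.add_closed intro!: L.sum_closed)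
  then have "1 / 2 * T y = adj x"
    using adj_eq[of a x] a by (simp add: distrib_left sum_distrib_left)
  ultimately show "t \<in> J"
    unfolding J_def x(2) by (metis image_eqI)
next
  fix t assume "t \<in> J"
  then obtain y where y: "y \<in> Fix" "t = 1 / 2 * T y"
    unfolding J_def by blast
  then have yA: "y \<in> A" and yfix: "\<sigma> s y = y"
    by (auto simp: Fix_def)
  obtain a where a: "\<forall>i. a i \<in> B" "y = (\<Sum>i<N. a i * z ^ i)"
    using yA unfolding A_eq_span_B span_B_def by blast
  have az: "a i * z ^ i \<in> L" for i
    using a(1) B_subset_L z_in_L by auto
  note az = az sigma_in_L[OF s_coprime az]
  have a0L: "a 0 \<in> L"
    using a(1) B_subset_L by auto
  have rep: "y = a 0 + (\<Sum>i\<in>{1..<h}. a i * z ^ i + \<sigma> s (a i * z ^ i))"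
    using fixed_representation[of a y] a yfix by (simp add: sigma_B_z distrib_left)
  have Ty: "T y = T (a 0) + (\<Sum>i\<in>{1..<h}. 2 * T (a i * z ^ i))"
    unfolding rep using az a0L
    by (subst T_add) (auto simp: T_sum T_add T_sigma[OF s_H] L.add_closed intro!: L.sum_closed)
  \<comment> \<open>Cutting the coefficients at \<open>h\<close> keeps one term of each pair
    \<open>i\<close>, \<open>N - i\<close>; the doubled traces in \<open>Ty\<close> account for the
    other.\<close>
  define b where "b i = (if i < h then a i else 0)" for i
  define x where "x = (\<Sum>i<N. b i * z ^ i)"
  have bB: "b i \<in> B" for i
    using a(1) by (simp add: b_def)
  have "x \<in> A"
    unfolding A_eq_span_B span_B_def x_def using bB by blast
  have "(\<Sum>i\<in>{1..<N}. T (b i * z ^ i)) = (\<Sum>i\<in>{1..<h}. T (a i * z ^ i))"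
  proof (rule sum.mono_neutral_cong_right)
    show "{1..<h} \<subseteq> {1..<N}"
      unfolding N_eq by auto
    show "\<forall>i\<in>{1..<N} - {1..<h}. T (b i * z ^ i) = 0"
      using T_rat[of 0] by (auto simp: b_def)
  qed (auto simp: b_def)
  then have "adj x = 1 / 2 * T (a 0) + (\<Sum>i\<in>{1..<h}. T (a i * z ^ i))"
    using adj_eq[OF bB x_def] h_pos by (simp add: b_def)
  also have "\<dots> = t"
    unfolding y(2) Ty by (simp add: distrib_left sum_distrib_left)
  finally show "t \<in> adj ` A"
    using \<open>x \<in> A\<close> by blast
qed

end

theorem proposition6p2:
  fixes K :: "complex set" and n :: nat
  assumes "abelian_number_field K"
    and "is_conductor K n"
  shows "adjusted_trace n K ` ring_of_integers (cyclotomic_field n) = ring_of_integers K"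
proof -
  have n_pos: "n > 0" and sub: "K \<subseteq> cyclotomic_field n"
    and min: "\<And>k. k > 0 \<Longrightarrow> K \<subseteq> cyclotomic_field k \<Longrightarrow> n \<le> k"
    using assms(2) by (auto simp: is_conductor_def)
  have "complex_subfield K"
    using assms(1) by (simp add: abelian_number_field_def abelian_extension_def complex_subfield_iff)
  interpret cyclotomic n
    using n_pos by (rule cyclotomic.intro)
  have L: "cyclotomic_field n = L"
    using cyclotomic_field_eq[OF n_pos] by (simp add: L_def)
  interpret conductor_subfield n K
  proof (intro conductor_subfield.intro conductor_subfield_axioms.intro cyclotomic_subfield.intro
      cyclotomic_subfield_axioms.intro cyclotomic_axioms)
    show "complex_subfield K"
      by fact
    show "K \<subseteq> L"
      using sub by (simp add: L)
    show "n \<le> k" if "k > 0" "K \<subseteq> adjoin \<rat> (zeta k)" for k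
      using min[OF that(1)] that cyclotomic_field_eq[OF that(1)] by simp
  qed
  have int_L: "ring_of_integers L = A"
    using integers_eq_A by (simp add: ring_of_integers_def)
  have int_K: "ring_of_integers K = K \<inter> A"
    using integers_eq_A K_subset_L by (auto simp: ring_of_integers_def)
  show ?thesis
  \<comment> \<open>Odd primes never divide the order of inertia, so this parity decides which
    branch of the definition of the adjusted trace applies.\<close>
  proof (cases "even (card (I 2))")
    case False
    have *: "\<not> p dvd card (I p)" if "prime p" for p :: nat
      using prime_not_dvd_card_I[OF that] False by (cases "p = 2") auto
    have "adjusted_trace n K x = T x" if "x \<in> A" for x
      using tamely_ramified_if[OF *] field_trace_eq_sum_sigma[of x] that A_subset_L
      by (auto simp: adjusted_trace_def L T_def)
    then have "adjusted_trace n K ` A = T ` A"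
      by (intro image_cong) auto
    then show ?thesis
      unfolding L int_L int_K using trace_surjective[OF *] by simp
  next
    case True
    obtain s where s: "s \<in> H" "s \<noteq> Suc 0 mod n" "I 2 = {Suc 0 mod n, s}" "[s = 1] (mod m 2)"
      "[s * s = 1] (mod n)" "3 \<le> multiplicity 2 n" "[s + 1 = 0] (mod 2 ^ (multiplicity 2 n - 1))"
      by (rule I_2_cases[OF True])
    have "odd (m 2)"
      using not_dvd_m[of 2] by simp
    interpret wild_subfield n "multiplicity 2 n" "m 2" s K
    proof (intro wild_subfield.intro wild_cyclotomic.intro even_cyclotomic.intro
        even_cyclotomic_axioms.intro wild_cyclotomic_axioms.intro wild_subfield_axioms.intro
        cyclotomic_axioms conductor_subfield_axioms s)
      show "n = 2 ^ multiplicity 2 n * m 2"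
        by (rule n_eq)
      show "odd (m 2)"
        by fact
      show "0 < multiplicity 2 n"
        using s(6) by simp
      show "coprime s n"
        using H_coprime[OF s(1)] .
      show "multiplicity 2 n = multiplicity 2 n" ..
    qed
    have "\<not> tamely_ramified L K"
      using H_fixes[OF s(1)] by (intro not_tamely_ramified) auto
    then have "adjusted_trace n K x = adj x" for x
      by (simp add: adjusted_trace_def L adj_def Let_def)
    then have "adjusted_trace n K ` A = adj ` A"
      by simp
    then show ?thesis
      unfolding L int_L int_K using adj_image J_eq by simp
  qed
qed

end
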